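(* Let $n\ge 1$. Then $$C_{b,u}(\mathcal{F}^2)=\overline{\mathcal{W}^{2,\infty}(\mathcal{F}^2)},$$ where the closure is taken in the operator norm of $\mathcal{L}(\mathcal{F}^2)$.
   Context: $\mathcal{F}^2(\mathbb{C}^n)$ denotes the Fock space of entire functions on $\mathbb{C}^n$ that are square integrable with respect to $d\lambda(z)=e^{-\pi|z|^2}dz$, where $dz$ is Lebesgue measure. Its normalized reproducing kernels are $k_z(w)=e^{\pi\bar z w-\frac{\pi}{2}|z|^2}$, with $\bar z w=\sum_i \bar z_i w_i$. $\mathcal{L}(\mathcal{F}^2)$ denotes the bounded operators on $\mathcal{F}^2(\mathbb{C}^n)$. The Berezin transform of $S\in\mathcal{L}(\mathcal{F}^2)$ is $B(S)(z)=\langle Sk_z,k_z\rangle$. $\Delta=\sum_{i=1}^n\partial_{z_i}\partial_{\bar z_i}$. $\mathcal{W}^{2,\infty}(\mathcal{F}^2)$ is the set of all $S\in\mathcal{L}(\mathcal{F}^2)$ such that $\Delta B(S)=B(T)$ for some $T\in\mathcal{L}(\mathcal{F}^2)$. The Weyl operators are $W_zf(w)=k_z(w)f(w-z)$. $C_{b,u}(\mathcal{F}^2)$ is the set of all $S\in\mathcal{L}(\mathcal{F}^2)$ for which the map $z\mapsto W_zSW_z^*$ is continuous from $\mathbb{C}^n$ to $\mathcal{L}(\mathcal{F}^2)$ with the operator norm. *)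

theory Defs
  imports "HOL-Analysis.Analysis"
begin

text \<open>Points of C^n are modelled as complex ^ 'n for a finite index type 'n
  (so n = CARD('n) \<ge> 1). Elements of the Fock space are functions
  complex ^ 'n \<Rightarrow> complex; operators are maps on such functions, and only
  their behaviour on the Fock space matters.\<close>

type_synonym 'n fn = "complex ^ 'n \<Rightarrow> complex"
type_synonym 'n op = "'n fn \<Rightarrow> 'n fn"

definition entire_fn :: "'n::finite fn \<Rightarrow> bool" where
  "entire_fn f \<longleftrightarrow> (\<forall>z. \<exists>L. (f has_derivative L) (at z) \<and>
      (\<forall>v. L (\<chi> i. \<i> * v $ i) = \<i> * L v))"

definition gauss_wt :: "complex ^ 'n::finite \<Rightarrow> real" where
  "gauss_wt z = exp (- pi * (norm z)\<^sup>2)"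

definition fock :: "'n::finite fn set" where
  "fock = {f. entire_fn f \<and> integrable lborel (\<lambda>z. (cmod (f z))\<^sup>2 * gauss_wt z)}"

definition fock_inner :: "'n::finite fn \<Rightarrow> 'n fn \<Rightarrow> complex" where
  "fock_inner f g = integral\<^sup>L lborel (\<lambda>z. f z * cnj (g z) * complex_of_real (gauss_wt z))"

definition fock_norm :: "'n::finite fn \<Rightarrow> real" where
  "fock_norm f = sqrt (integral\<^sup>L lborel (\<lambda>z. (cmod (f z))\<^sup>2 * gauss_wt z))"

definition bounded_fock_op :: "'n::finite op \<Rightarrow> bool" where
  "bounded_fock_op S \<longleftrightarrow>
     (\<forall>f\<in>fock. S f \<in> fock) \<and>
     (\<forall>f\<in>fock. \<forall>g\<in>fock. S (\<lambda>w. f w + g w) = (\<lambda>w. S f w + S g w)) \<and>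
     (\<forall>f\<in>fock. \<forall>a::complex. S (\<lambda>w. a * f w) = (\<lambda>w. a * S f w)) \<and>
     (\<exists>C. \<forall>f\<in>fock. fock_norm (S f) \<le> C * fock_norm f)"

definition fock_opnorm :: "'n::finite op \<Rightarrow> real" where
  "fock_opnorm S = Sup {fock_norm (S f) | f. f \<in> fock \<and> fock_norm f \<le> 1}"

text \<open>Hilbert space adjoint (determined on the Fock space).\<close>
definition fock_adjoint :: "'n::finite op \<Rightarrow> 'n op" where
  "fock_adjoint S = (\<lambda>g. THE h. h \<in> fock \<and> (\<forall>f\<in>fock. fock_inner (S f) g = fock_inner f h))"

definition cdot :: "complex ^ 'n::finite \<Rightarrow> complex ^ 'n \<Rightarrow> complex" where
  "cdot z w = (\<Sum>i\<in>UNIV. cnj (z $ i) * w $ i)"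

text \<open>Normalized reproducing kernels k_z(w) = exp(pi conj(z) w - pi/2 |z|^2).\<close>
definition kern :: "complex ^ 'n::finite \<Rightarrow> 'n fn" where
  "kern z = (\<lambda>w. exp (complex_of_real pi * cdot z w - complex_of_real (pi / 2 * (norm z)\<^sup>2)))"

definition berezin :: "'n::finite op \<Rightarrow> complex ^ 'n \<Rightarrow> complex" where
  "berezin S z = fock_inner (S (kern z)) (kern z)"

definition weyl :: "complex ^ 'n::finite \<Rightarrow> 'n op" where
  "weyl z = (\<lambda>f w. kern z w * f (w - z))"

text \<open>Real directional derivative and the Laplacian
  sum_i d/dz_i d/dzbar_i = 1/4 sum_i (d^2/dx_i^2 + d^2/dy_i^2).\<close>
definition dirderiv :: "'n::finite fn \<Rightarrow> complex ^ 'n \<Rightarrow> complex ^ 'n \<Rightarrow> complex" where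
  "dirderiv F v z = vector_derivative (\<lambda>t::real. F (z + t *\<^sub>R v)) (at 0)"

definition laplacian :: "'n::finite fn \<Rightarrow> complex ^ 'n \<Rightarrow> complex" where
  "laplacian F z = (1/4) * (\<Sum>i\<in>UNIV.
      dirderiv (dirderiv F (axis i 1)) (axis i 1) z
    + dirderiv (dirderiv F (axis i \<i>)) (axis i \<i>) z)"

definition W2inf :: "'n::finite op set" where
  "W2inf = {S. bounded_fock_op S \<and>
     (\<exists>T. bounded_fock_op T \<and> (\<forall>z. laplacian (berezin S) z = berezin T z))}"

definition opnorm_closure :: "'n::finite op set \<Rightarrow> 'n op set" where
  "opnorm_closure A = {S. bounded_fock_op S \<and>
     (\<forall>e>0. \<exists>T\<in>A. fock_opnorm (\<lambda>f. S f - T f) < e)}"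

definition Cbu :: "'n::finite op set" where
  "Cbu = {S. bounded_fock_op S \<and>
     (\<forall>z0. \<forall>e>0. \<exists>d>0. \<forall>z. dist z z0 < d \<longrightarrow>
        fock_opnorm (\<lambda>f. weyl z (S (fock_adjoint (weyl z) f))
                       - weyl z0 (S (fock_adjoint (weyl z0) f))) < e)}"

end

theory Submission
  imports Defs "HOL-Probability.Distributions" "HOL-Complex_Analysis.Complex_Analysis"
begin

text \<open>
  Write \<open>\<alpha>\<^sub>z(S) = W\<^sub>z S W\<^sub>z\<^sup>*\<close>, so that \<open>B(\<alpha>\<^sub>z(S))\<close> is a translate of \<open>B(S)\<close>. Averaging
  \<open>\<alpha>\<^sub>y(S)\<close> over short segments in all coordinate directions and their negatives gives operators
  \<open>P\<^sub>h S\<close> for which \<open>\<Delta>B(P\<^sub>h S) = B(Q\<^sub>h S)\<close>, where \<open>Q\<^sub>h\<close> is a smoothed discrete Laplacian; for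
  \<open>S\<close> in \<open>C\<^sub>b\<^sub>,\<^sub>u\<close> these operators converge to \<open>S\<close> in norm.

  Conversely, if \<open>\<Delta>B(S) = B(T)\<close> then \<open>B(P\<^sub>h T) = B(Q\<^sub>h S)\<close>, hence \<open>P\<^sub>h T = Q\<^sub>h S\<close> because \<open>B\<close> is
  injective. Every matrix element \<open>\<langle>\<alpha>\<^sub>z(P\<^sub>h S) x, y\<rangle>\<close> is thus a bounded function of \<open>z\<close> whose
  Laplacian \<open>\<langle>\<alpha>\<^sub>z(P\<^sub>h T) x, y\<rangle>\<close> is bounded as well, uniformly in \<open>h\<close> and in unit vectors. An
  interior gradient estimate makes it Lipschitz in \<open>z\<close> with a uniform constant, and \<open>h \<rightarrow> 0\<close>
  shows that \<open>z \<mapsto> \<alpha>\<^sub>z(S)\<close> is Lipschitz in norm. Finally \<open>C\<^sub>b\<^sub>,\<^sub>u\<close> is norm closed.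
\<close>

section \<open>The gradient estimate for bounded Laplacians\<close>

text \<open>For a general bounded \<open>S\<close> the matrix elements of \<open>alpha z S\<close>
  need not be differentiable in \<open>z\<close>, and the equation for \<open>T\<close> is an
  identity between Berezin transforms only, that is, for a single matrix element at the vector
  \<open>kern_vec 0\<close>. Smoothing closes both gaps. Each average over a segment supplies one
  derivative by the fundamental theorem of calculus, so a second derivative needs two averages per
  direction; taking opposite signs turns it into the centred second difference. These identities are
  exact for fixed \<open>h\<close>, so neither distributions nor smooth mollifiers enter, and
  \<open>Q_h S\<close> is a bounded operator for every bounded \<open>S\<close>. The price is the
  factor \<open>1 / h^2\<close> in \<open>Q_h\<close>: the bound on the Laplacian that is uniform in
  \<open>h\<close> comes from \<open>P_h T\<close>, and injectivity of the Berezin transform is what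
  permits this exchange. The averages are formed vector by vector, because
  \<open>z \<mapsto> alpha z S x\<close> is continuous for each \<open>x\<close> while norm
  continuity of \<open>z \<mapsto> alpha z S\<close> is exactly what is at stake.\<close>

definition has_dirderiv :: "'a::euclidean_space \<Rightarrow> ('a \<Rightarrow> 'b::real_normed_vector) \<Rightarrow> ('a \<Rightarrow> 'b) \<Rightarrow> bool" where
  "has_dirderiv v u D \<longleftrightarrow> (\<forall>z. ((\<lambda>t::real. u (z + t *\<^sub>R v)) has_vector_derivative D z) (at 0))"

lemma has_dirderiv_line:
  assumes "has_dirderiv v u D"
  shows "((\<lambda>t::real. u (z + t *\<^sub>R v)) has_vector_derivative D (z + t *\<^sub>R v)) (at t)"
proof -
  have "((\<lambda>s::real. u ((z + t *\<^sub>R v) + s *\<^sub>R v)) has_vector_derivative D (z + t *\<^sub>R v)) (at 0)"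
    using assms by (auto simp: has_dirderiv_def)
  then have "(((\<lambda>s::real. u ((z + t *\<^sub>R v) + s *\<^sub>R v)) \<circ> (\<lambda>s. s - t)) has_vector_derivative
      1 *\<^sub>R D (z + t *\<^sub>R v)) (at t)"
    by (intro vector_diff_chain_at) (auto intro!: derivative_eq_intros)
  moreover have "(\<lambda>s::real. u ((z + t *\<^sub>R v) + s *\<^sub>R v)) \<circ> (\<lambda>s. s - t) = (\<lambda>s. u (z + s *\<^sub>R v))"
    by (auto simp: algebra_simps)
  ultimately show ?thesis by simp
qed

lemma has_dirderiv_scaleR:
  assumes "has_dirderiv v u D"
  shows "has_dirderiv (c *\<^sub>R v) u (\<lambda>z. c *\<^sub>R D z)"
  unfolding has_dirderiv_def
proof
  fix z
  have "(((\<lambda>t. u (z + t *\<^sub>R v)) \<circ> (\<lambda>t. t * c)) has_vector_derivative c *\<^sub>R D z) (at 0)"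
    using assms by (intro vector_diff_chain_at) (auto simp: has_dirderiv_def intro!: derivative_eq_intros)
  then show "((\<lambda>t. u (z + t *\<^sub>R c *\<^sub>R v)) has_vector_derivative c *\<^sub>R D z) (at 0)"
    by (simp add: comp_def)
qed

lemma has_dirderiv_affine:
  assumes "has_dirderiv v u D"
  shows "has_dirderiv v (\<lambda>z. u (z + a)) (\<lambda>z. D (z + a))"
proof -
  have "(\<lambda>t. u ((z + a) + t *\<^sub>R v)) = (\<lambda>t. u (z + t *\<^sub>R v + a))" for z
    by (simp add: algebra_simps)
  then show ?thesis using assms unfolding has_dirderiv_def by metis
qed

lemma has_dirderiv_linear:
  assumes "has_dirderiv v u D" "bounded_linear l"
  shows "has_dirderiv v (\<lambda>z. l (u z)) (\<lambda>z. l (D z))"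
  using assms unfolding has_dirderiv_def by (auto intro: bounded_linear.has_vector_derivative)

lemma has_dirderiv_diff:
  assumes "has_dirderiv v u D" "has_dirderiv v u' D'"
  shows "has_dirderiv v (\<lambda>z. u z - u' z) (\<lambda>z. D z - D' z)"
  using assms unfolding has_dirderiv_def by (auto intro!: derivative_eq_intros)

text \<open>If \<open>c\<close> were negative, \<open>g1\<close>, which vanishes at the minimum,
  would be negative just to the right of 0, and the mean value theorem would push \<open>g\<close>
  below \<open>g 0\<close>.\<close>

lemma second_deriv_at_min_nonneg:
  fixes g :: "real \<Rightarrow> real"
  assumes d: "d > 0"
    and g: "\<And>t. (g has_real_derivative g1 t) (at t)" 
    and g1: "(g1 has_real_derivative c) (at 0)"
    and min: "\<And>t. \<bar>t\<bar> < d \<Longrightarrow> g 0 \<le> g t"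
  shows "c \<ge> 0"
proof (rule ccontr)
  assume "\<not> c \<ge> 0"
  then have "c < 0" by simp
  have "g1 0 = 0"
    using g[of 0] d min by (intro DERIV_local_min[of g _ 0 d]) auto
  then obtain e where e: "e > 0" "\<And>h. 0 < h \<Longrightarrow> h < e \<Longrightarrow> g1 h < 0"
    using has_real_derivative_neg_dec_right[OF g1 \<open>c < 0\<close>] by auto
  define h where "h = min d e / 2"
  have h: "0 < h" "h < d" "h < e" using d e(1) by (auto simp: h_def min_def)
  obtain x where x: "0 < x" "x < h" "g h - g 0 = (h - 0) * g1 x"
    using MVT2[of 0 h g g1] h g by auto
  have "g1 x < 0" using e(2) x h by auto
  then have "g h < g 0" using x h by (smt (verit) mult_pos_neg)
  then show False using min[of h] h by auto
qed

text \<open>At an interior minimum every second derivative along a basis vector is nonnegative,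
  which contradicts the strictly negative sum. The minimum over the box therefore lies on its
  boundary.\<close>

lemma min_principle:
  fixes w :: "'a::euclidean_space \<Rightarrow> real"
  assumes cont: "continuous_on (cbox p q) w" and ne: "cbox p q \<noteq> {}"
    and D1: "\<And>b. b \<in> Basis \<Longrightarrow> has_dirderiv b w (D1 b)"
    and D2: "\<And>b. b \<in> Basis \<Longrightarrow> has_dirderiv b (D1 b) (D2 b)"
    and neg: "\<And>x. x \<in> box p q \<Longrightarrow> (\<Sum>b\<in>Basis. D2 b x) < 0"
    and bd: "\<And>x. x \<in> cbox p q - box p q \<Longrightarrow> w x \<ge> 0"
    and x: "x \<in> cbox p q"
  shows "w x \<ge> 0"
proof -
  obtain m where m: "m \<in> cbox p q" "\<And>y. y \<in> cbox p q \<Longrightarrow> w m \<le> w y"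
    using continuous_attains_inf[OF compact_cbox ne cont] by auto
  have "w m \<ge> 0"
  proof (cases "m \<in> box p q")
    case True
    then obtain d where d: "d > 0" "ball m d \<subseteq> box p q"
      using open_contains_ball open_box by blast
    have "D2 b m \<ge> 0" if b: "b \<in> Basis" for b
    proof (rule second_deriv_at_min_nonneg[OF d(1), where g="\<lambda>t. w (m + t *\<^sub>R b)" and ?g1.0="\<lambda>t. D1 b (m + t *\<^sub>R b)"])
      show "((\<lambda>t. w (m + t *\<^sub>R b)) has_real_derivative D1 b (m + t *\<^sub>R b)) (at t)" for t
        using has_dirderiv_line[OF D1[OF b]] by (simp add: has_real_derivative_iff_has_vector_derivative)
      show "((\<lambda>t. D1 b (m + t *\<^sub>R b)) has_real_derivative D2 b m) (at 0)"
        using D2[OF b] by (simp add: has_real_derivative_iff_has_vector_derivative has_dirderiv_def)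
      show "w (m + 0 *\<^sub>R b) \<le> w (m + t *\<^sub>R b)" if "\<bar>t\<bar> < d" for t
      proof -
        have "m + t *\<^sub>R b \<in> ball m d" using that b by (simp add: dist_norm)
        then have "m + t *\<^sub>R b \<in> cbox p q" using d(2) box_subset_cbox by blast
        then show ?thesis using m(2) by simp
      qed
    qed
    then have "(\<Sum>b\<in>Basis. D2 b m) \<ge> 0" by (intro sum_nonneg) auto
    with neg[OF True] show ?thesis by linarith
  qed (use bd m in auto)
  then show ?thesis using m(2)[OF x] by linarith
qed

lemma has_dirderiv_real_iff:
  "has_dirderiv v (u::_\<Rightarrow>real) D \<longleftrightarrow> (\<forall>z. ((\<lambda>t. u (z + t *\<^sub>R v)) has_real_derivative D z) (at 0))"
  by (simp add: has_dirderiv_def has_real_derivative_iff_has_vector_derivative)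

text \<open>The comparison argument of Gilbarg and Trudinger, Section 3.4: on a half cube the part of \<open>u\<close> that
  is odd in the direction \<open>b\<close> is dominated by an explicit quadratic barrier \<open>psi\<close> with Laplacian
  \<open>- N'\<close>.\<close>

lemma odd_part_barrier:
  fixes u :: "'a::euclidean_space \<Rightarrow> real" and D2 :: "'a \<Rightarrow> 'a \<Rightarrow> real" and M N :: real
  assumes cont: "continuous_on UNIV u" and b: "b \<in> Basis"
    and D1: "\<And>c. c \<in> Basis \<Longrightarrow> has_dirderiv c u (D1 c)"
    and D2: "\<And>c. c \<in> Basis \<Longrightarrow> has_dirderiv c (D1 c) (D2 c)"
    and M: "\<And>x. \<bar>u x\<bar> \<le> M" and N: "\<And>x. \<bar>\<Sum>c\<in>Basis. D2 c x\<bar> \<le> N"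
    and N': "N < N'" and s: "s = 1 \<or> s = -1" and t: "0 \<le> t" "t \<le> 1"
  shows "s * (u (t *\<^sub>R b) - u (- t *\<^sub>R b)) / 2 \<le> t * (M * DIM('a) + N' / 2)"
proof -
  define n where "n = real DIM('a)"
  define R where "R = (\<lambda>x::'a. x - (2 * (x \<bullet> b)) *\<^sub>R b)"
  define Phi where "Phi = (\<lambda>x. (u x - u (R x)) / 2)"
  \<comment> \<open>The \<open>n - 1\<close> coordinates other than \<open>b\<close> contribute
    \<open>2 * M\<close> each to the Laplacian; the coefficient \<open>n - 1\<close> of
    \<open>(x \<bullet> b)^2\<close> cancels them, leaving \<open>- N'\<close>. The linear
    coefficient \<open>n\<close> makes the middle term at least \<open>x \<bullet> b\<close> on
    \<open>[0, 1]\<close>.\<close>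
  define psi where "psi = (\<lambda>x. M * ((\<Sum>c\<in>Basis - {b}. (x \<bullet> c)\<^sup>2) + (x \<bullet> b) * (n - (n-1) * (x \<bullet> b)))
        + N' * ((x \<bullet> b) * (1 - x \<bullet> b)) / 2)"
  define psi1 where "psi1 = (\<lambda>c x. if c = b then M * (n - 2 * (n-1) * (x \<bullet> b)) + N' * (1 - 2 * (x \<bullet> b)) / 2
        else M * (2 * (x \<bullet> c)))"
  define psi2 where "psi2 = (\<lambda>c (x::'a). if c = b then - 2 * M * (n - 1) - N' else 2 * M)"
  \<comment> \<open>\<open>r c\<close> is the eigenvalue of the reflection \<open>R\<close> at
    \<open>c\<close>. It enters first derivatives of \<open>u (R x)\<close> once and second
    derivatives as its square 1.\<close>
  define r where "r = (\<lambda>c. if c = b then -1 else 1::real)"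
  define w where "w = (\<lambda>x. psi x - s * Phi x)"
  define w1 where "w1 = (\<lambda>c x. psi1 c x - s * ((D1 c x - r c * D1 c (R x)) / 2))"
  define w2 where "w2 = (\<lambda>c x. psi2 c x - s * ((D2 c x - D2 c (R x)) / 2))"
  \<comment> \<open>The box between \<open>p\<close> and \<open>q\<close> is the half cube with
    \<open>b\<close>-coordinate in \<open>[0, 1]\<close> and all others in
    \<open>[-1, 1]\<close>.\<close>
  define p where "p = b - (\<Sum>c\<in>Basis. c)"
  define q where "q = (\<Sum>c\<in>Basis. c :: 'a)"
  have n1: "n \<ge> 1" unfolding n_def using DIM_positive[where 'a='a] by linarith
  have M0: "M \<ge> 0" using M[of 0] by linarith
  have N0: "N' \<ge> 0" using N[of 0] N' by linarith
  have Basis_b: "(c \<bullet> b) = (if c = b then 1 else 0)" "(b \<bullet> c) = (if c = b then 1 else 0)" if "c \<in> Basis" for c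
    using that b by (auto simp: inner_Basis)
  have R_add: "R (x + t *\<^sub>R c) = R x + (t * r c) *\<^sub>R c" if "c \<in> Basis" for x t c
    using that b by (auto simp: R_def r_def inner_add_left Basis_b algebra_simps)
      (metis mult_2_right scaleR_left_distrib)
  have dpsi: "has_dirderiv c psi (psi1 c)" if c: "c \<in> Basis" for c
    unfolding has_dirderiv_real_iff
  proof
    fix z
    show "((\<lambda>t. psi (z + t *\<^sub>R c)) has_real_derivative psi1 c z) (at 0)"
    proof (cases "c = b")
      case True
      have eq: "psi (z + t *\<^sub>R c) = M * ((\<Sum>c\<in>Basis - {b}. (z \<bullet> c)\<^sup>2) + (z \<bullet> b + t) * (n - (n-1) * (z \<bullet> b + t)))
        + N' * ((z \<bullet> b + t) * (1 - (z \<bullet> b + t))) / 2" for t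
      proof -
        have "(\<Sum>c\<in>Basis - {b}. ((z + t *\<^sub>R b) \<bullet> c)\<^sup>2) = (\<Sum>c\<in>Basis - {b}. (z \<bullet> c)\<^sup>2)"
          by (intro sum.cong) (auto simp: inner_add_left Basis_b)
        then show ?thesis using True b by (simp add: psi_def inner_add_left)
      qed
      show ?thesis unfolding eq using True
        by (auto simp: psi1_def field_simps intro!: derivative_eq_intros)
    next
      case False
      have eq: "psi (z + t *\<^sub>R c) = M * (((\<Sum>d\<in>Basis - {b} - {c}. (z \<bullet> d)\<^sup>2) + (z \<bullet> c + t)\<^sup>2) + (z \<bullet> b) * (n - (n-1) * (z \<bullet> b)))
        + N' * ((z \<bullet> b) * (1 - (z \<bullet> b))) / 2" for t
      proof -
        have "(\<Sum>d\<in>Basis - {b}. ((z + t *\<^sub>R c) \<bullet> d)\<^sup>2) = 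
            ((z + t *\<^sub>R c) \<bullet> c)\<^sup>2 + (\<Sum>d\<in>Basis - {b} - {c}. ((z + t *\<^sub>R c) \<bullet> d)\<^sup>2)"
          using False c by (subst sum.remove[of _ c]) auto
        also have "(\<Sum>d\<in>Basis - {b} - {c}. ((z + t *\<^sub>R c) \<bullet> d)\<^sup>2) = (\<Sum>d\<in>Basis - {b} - {c}. (z \<bullet> d)\<^sup>2)"
          using c by (intro sum.cong) (auto simp: inner_add_left inner_Basis)
        finally show ?thesis using False c by (simp add: psi_def inner_add_left Basis_b)
      qed
      show ?thesis unfolding eq using False
        by (auto simp: psi1_def algebra_simps intro!: derivative_eq_intros)
    qed
  qed
  have dpsi1: "has_dirderiv c (psi1 c) (psi2 c)" if c: "c \<in> Basis" for c
    unfolding has_dirderiv_real_iff psi1_def psi2_def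
    using c b by (auto simp: inner_add_left Basis_b algebra_simps intro!: derivative_eq_intros)
  have dR: "has_dirderiv c (\<lambda>x. f (R x)) (\<lambda>x. r c *\<^sub>R g (R x))" if "has_dirderiv c f g" "c \<in> Basis" for f g :: "'a \<Rightarrow> real" and c
  proof -
    have "((\<lambda>t. f (R z + t *\<^sub>R (r c *\<^sub>R c))) has_vector_derivative r c *\<^sub>R g (R z)) (at 0)" for z
      using has_dirderiv_scaleR[OF that(1), of "r c"] unfolding has_dirderiv_def by blast
    then show ?thesis unfolding has_dirderiv_def using that(2) by (simp add: R_add)
  qed
  have dw: "has_dirderiv c w (w1 c)" if c: "c \<in> Basis" for c
  proof -
    have "has_dirderiv c (\<lambda>x. (s / 2) *\<^sub>R (u x - u (R x))) (\<lambda>x. (s/2) *\<^sub>R (D1 c x - r c *\<^sub>R D1 c (R x)))"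
      by (intro has_dirderiv_linear[OF has_dirderiv_diff[OF D1[OF c] dR[OF D1[OF c] c]]] bounded_linear_scaleR_right)
    from has_dirderiv_diff[OF dpsi[OF c] this] show ?thesis
      by (simp add: w_def w1_def Phi_def)
  qed
  have dw1: "has_dirderiv c (w1 c) (w2 c)" if c: "c \<in> Basis" for c
  proof -
    have "has_dirderiv c (\<lambda>x. r c *\<^sub>R D1 c (R x)) (\<lambda>x. r c *\<^sub>R (r c *\<^sub>R D2 c (R x)))"
      by (intro has_dirderiv_linear[OF dR[OF D2[OF c] c]] bounded_linear_scaleR_right)
    moreover have "(\<lambda>x. r c *\<^sub>R (r c *\<^sub>R D2 c (R x))) = (\<lambda>x. D2 c (R x))" by (auto simp: r_def)
    ultimately have "has_dirderiv c (\<lambda>x. r c *\<^sub>R D1 c (R x)) (\<lambda>x. D2 c (R x))" by simp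
    then have "has_dirderiv c (\<lambda>x. (s / 2) *\<^sub>R (D1 c x - r c *\<^sub>R D1 c (R x))) (\<lambda>x. (s/2) *\<^sub>R (D2 c x - D2 c (R x)))"
      by (intro has_dirderiv_linear[OF has_dirderiv_diff[OF D2[OF c]]] bounded_linear_scaleR_right)
    from has_dirderiv_diff[OF dpsi1[OF c] this] show ?thesis
      by (simp add: w1_def w2_def)
  qed
  have contw: "continuous_on A w" for A
    unfolding w_def psi_def Phi_def R_def
    by (intro continuous_intros continuous_on_compose2[OF cont]) auto
  have sum_psi2: "(\<Sum>c\<in>Basis. psi2 c x) = - N'" for x
  proof -
    have "(\<Sum>c\<in>Basis. psi2 c x) = psi2 b x + (\<Sum>c\<in>Basis - {b}. psi2 c x)"
      using b by (subst sum.remove[of _ b]) auto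
    also have "(\<Sum>c\<in>Basis - {b}. psi2 c x) = (\<Sum>c\<in>Basis - {b}. 2 * M)"
      by (intro sum.cong) (auto simp: psi2_def)
    also have "\<dots> = (n - 1) * (2 * M)"
      using b n1 by (simp add: n_def card_Diff_singleton of_nat_diff)
    finally show ?thesis by (simp add: psi2_def algebra_simps)
  qed
  \<comment> \<open>The Laplacian of \<open>s * Phi\<close> is bounded by \<open>N\<close>, so the
    gap \<open>N < N'\<close> makes the inequality strict, as the minimum principle
    requires.\<close>
  have neg: "(\<Sum>c\<in>Basis. w2 c x) < 0" for x
  proof -
    have "(\<Sum>c\<in>Basis. w2 c x) = - N' - s * (((\<Sum>c\<in>Basis. D2 c x) - (\<Sum>c\<in>Basis. D2 c (R x))) / 2)"
      by (simp add: w2_def sum_subtractf sum_psi2 sum_distrib_left[symmetric] sum_divide_distrib[symmetric])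
    also have "\<dots> < 0"
      using N[of x] N[of "R x"] N' s by (auto simp: abs_le_iff field_simps)
    finally show ?thesis .
  qed
  have pq: "p \<bullet> c = (if c = b then 0 else -1)" "q \<bullet> c = 1" if "c \<in> Basis" for c
    using that b by (auto simp: p_def q_def inner_diff_left inner_Basis inner_sum_left_Basis)
  have inb: "(x \<in> cbox p q) \<longleftrightarrow> (\<forall>c\<in>Basis. (if c = b then 0 else -1) \<le> x \<bullet> c \<and> x \<bullet> c \<le> 1)" 
           "(x \<in> box p q) \<longleftrightarrow> (\<forall>c\<in>Basis. (if c = b then 0 else -1) < x \<bullet> c \<and> x \<bullet> c < 1)" for x
    by (auto simp: mem_box pq)
  have Phi_le: "s * Phi x \<le> M" for x
    using M[of x] M[of "R x"] s by (auto simp: Phi_def abs_le_iff field_simps)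
  \<comment> \<open>On the face \<open>x \<bullet> b = 0\<close> the reflection fixes
    \<open>x\<close>, so \<open>Phi\<close> vanishes and \<open>psi\<close> is nonnegative. On every
    other face \<open>psi\<close> is at least \<open>M\<close>, which dominates
    \<open>s * Phi\<close>.\<close>
  have bd: "w x \<ge> 0" if x: "x \<in> cbox p q - box p q" for x
  proof -
    obtain c where c: "c \<in> Basis" "x \<bullet> c = (if c = b then 0 else -1) \<or> x \<bullet> c = 1"
      using x unfolding Diff_iff inb by (metis order_le_imp_less_or_eq)
    have xb: "0 \<le> x \<bullet> b" "x \<bullet> b \<le> 1" using x b unfolding Diff_iff inb by (metis (full_types))+
    have q1: "(x \<bullet> b) * (n - (n-1) * (x \<bullet> b)) \<ge> x \<bullet> b"
    proof -
      have "n - (n-1) * (x \<bullet> b) \<ge> 1" using n1 xb mult_left_mono[of "x \<bullet> b" 1 "n-1"] by auto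
      then show ?thesis using xb mult_left_mono[of 1 "n - (n-1) * (x \<bullet> b)" "x \<bullet> b"] by auto
    qed
    have q2: "N' * ((x \<bullet> b) * (1 - x \<bullet> b)) / 2 \<ge> 0" using N0 xb by auto
    have q3: "(\<Sum>c\<in>Basis - {b}. (x \<bullet> c)\<^sup>2) \<ge> 0" by (intro sum_nonneg) auto
    show ?thesis
    proof (cases "c = b \<and> x \<bullet> b = 0")
      case True
      then have "Phi x = 0" "psi x = M * (\<Sum>c\<in>Basis - {b}. (x \<bullet> c)\<^sup>2)" by (auto simp: Phi_def psi_def R_def)
      then show ?thesis using M0 q3 by (simp add: w_def)
    next
      case False
      have "1 \<le> (\<Sum>c\<in>Basis - {b}. (x \<bullet> c)\<^sup>2) + (x \<bullet> b) * (n - (n-1) * (x \<bullet> b))"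
      proof (cases "c = b")
        case True
        then show ?thesis using False c q1 q3 by auto
      next
        case F: False
        have "(x \<bullet> c)\<^sup>2 \<le> (\<Sum>c\<in>Basis - {b}. (x \<bullet> c)\<^sup>2)"
          by (rule member_le_sum) (use F c in auto)
        moreover have "(x \<bullet> c)\<^sup>2 = 1" using c F by auto
        ultimately show ?thesis using q1 xb by linarith
      qed
      then have "M * 1 \<le> M * ((\<Sum>c\<in>Basis - {b}. (x \<bullet> c)\<^sup>2) + (x \<bullet> b) * (n - (n-1) * (x \<bullet> b)))"
        using M0 by (rule mult_left_mono)
      then have "M \<le> psi x" using q2 unfolding psi_def by linarith
      then show ?thesis using Phi_le[of x] by (simp add: w_def)
    qed
  qed
  have tb: "t *\<^sub>R b \<in> cbox p q" unfolding inb using t b by (auto simp: inner_Basis)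
  then have w0: "w (t *\<^sub>R b) \<ge> 0"
    using min_principle[of p q w w1 w2 "t *\<^sub>R b"] contw dw dw1 neg bd by blast
  have Phi_t: "Phi (t *\<^sub>R b) = (u (t *\<^sub>R b) - u (- t *\<^sub>R b)) / 2"
    using b by (simp add: Phi_def R_def scaleR_left_diff_distrib[symmetric])
  have psi_t: "psi (t *\<^sub>R b) = M * (t * (n - (n-1) * t)) + N' * (t * (1 - t)) / 2"
  proof -
    have "(\<Sum>c\<in>Basis - {b}. (t *\<^sub>R b \<bullet> c)\<^sup>2) = 0"
      by (intro sum.neutral) (auto simp: Basis_b)
    then show ?thesis using b by (simp add: psi_def)
  qed
  have le1: "M * (t * (n - (n-1) * t)) \<le> M * (t * n)"
    using M0 t n1 by (intro mult_left_mono) auto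
  have le2: "N' * (t * (1 - t)) / 2 \<le> N' * (t * 1) / 2"
    using N0 t by (intro divide_right_mono mult_left_mono) auto
  have "s * ((u (t *\<^sub>R b) - u (- t *\<^sub>R b)) / 2) \<le> psi (t *\<^sub>R b)"
    using w0 by (simp only: w_def Phi_t)
  also have "\<dots> \<le> M * (t * n) + N' * (t * 1) / 2"
    unfolding psi_t using le1 le2 by (rule add_mono)
  also have "\<dots> = t * (M * n + N' / 2)" by (simp add: algebra_simps)
  finally show ?thesis by (simp add: n_def)
qed

text \<open>The barrier compares two points symmetric about the origin, so \<open>u\<close> is
  translated to the midpoint \<open>a\<close> of the segment and the half length \<open>r\<close> is
  used; \<open>s\<close> picks the sign that produces the absolute value.\<close>

lemma gradient_bound_step:
  fixes u :: "'a::euclidean_space \<Rightarrow> real" and D2 :: "'a \<Rightarrow> 'a \<Rightarrow> real" and M N :: real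
  assumes cont: "continuous_on UNIV u" and b: "b \<in> Basis"
    and D1: "\<And>c. c \<in> Basis \<Longrightarrow> has_dirderiv c u (D1 c)"
    and D2: "\<And>c. c \<in> Basis \<Longrightarrow> has_dirderiv c (D1 c) (D2 c)"
    and M: "\<And>x. \<bar>u x\<bar> \<le> M" and N: "\<And>x. \<bar>\<Sum>c\<in>Basis. D2 c x\<bar> \<le> N"
    and t: "\<bar>t\<bar> \<le> 1"
  shows "\<bar>u (z + t *\<^sub>R b) - u z\<bar> \<le> \<bar>t\<bar> * (M * DIM('a) + N)"
proof -
  define a where "a = z + (t / 2) *\<^sub>R b"
  define r where "r = \<bar>t\<bar> / 2"
  define s where "s = (if (u (a + r *\<^sub>R b) - u (a - r *\<^sub>R b)) \<ge> 0 then 1 else -1::real)"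
  have N0: "0 \<le> N" using N[of 0] by linarith
  have barrier: "s * (u (r *\<^sub>R b + a) - u (- r *\<^sub>R b + a)) / 2 \<le> r * (M * DIM('a) + N' / 2)" if "N < N'" for N'
    by (rule odd_part_barrier[where u="\<lambda>x. u (x + a)" and N=N and ?D1.0="\<lambda>c x. D1 c (x + a)" and ?D2.0="\<lambda>c x. D2 c (x + a)"])
      (use that b t in \<open>auto simp: s_def r_def M N intro!: has_dirderiv_affine D1 D2 continuous_on_compose2[OF cont] continuous_intros\<close>)
  have le: "s * (u (r *\<^sub>R b + a) - u (- r *\<^sub>R b + a)) / 2 \<le> r * (M * DIM('a) + N / 2)"
  proof -
    \<comment> \<open>The barrier needs \<open>N' > N\<close>. Here \<open>N' = N + 2 * e\<close>,
      and \<open>r \<le> 1\<close> limits the excess to \<open>e\<close>, which then tends to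
      0.\<close>
    have *: "s * (u (r *\<^sub>R b + a) - u (- r *\<^sub>R b + a)) / 2 - r * (M * DIM('a)) - r * N / 2 \<le> e" if "e > 0" for e
    proof -
      have "r * (M * DIM('a) + (N + 2 * e) / 2) \<le> r * (M * DIM('a)) + r * N / 2 + e"
        using t that mult_right_mono[of r 1 e] by (simp add: r_def field_simps)
      moreover have "s * (u (r *\<^sub>R b + a) - u (- r *\<^sub>R b + a)) / 2 \<le> r * (M * DIM('a) + (N + 2 * e) / 2)"
        using that barrier[of "N + 2 * e"] by simp
      ultimately show ?thesis by linarith
    qed
    from field_le_epsilon[of _ 0, simplified, OF *] show ?thesis by (simp add: algebra_simps)
  qed
  have "\<bar>u (a + r *\<^sub>R b) - u (a - r *\<^sub>R b)\<bar> / 2 = s * (u (r *\<^sub>R b + a) - u (- r *\<^sub>R b + a)) / 2"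
    by (auto simp: s_def add.commute)
  with le have "\<bar>u (a + r *\<^sub>R b) - u (a - r *\<^sub>R b)\<bar> \<le> \<bar>t\<bar> * (M * DIM('a) + N / 2)"
    by (simp add: r_def)
  moreover have "\<bar>u (z + t *\<^sub>R b) - u z\<bar> = \<bar>u (a + r *\<^sub>R b) - u (a - r *\<^sub>R b)\<bar>"
  proof (cases "t \<ge> 0")
    case True
    then have "a + r *\<^sub>R b = z + t *\<^sub>R b" "a - r *\<^sub>R b = z"
      by (auto simp: a_def r_def scaleR_left_distrib[symmetric])
    then show ?thesis by simp
  next
    case False
    then have "a - r *\<^sub>R b = z + t *\<^sub>R b" "a + r *\<^sub>R b = z"
      by (auto simp: a_def r_def scaleR_left_distrib[symmetric])
    then show ?thesis by (simp add: abs_minus_commute)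
  qed
  moreover have "\<bar>t\<bar> * (M * DIM('a) + N / 2) \<le> \<bar>t\<bar> * (M * DIM('a) + N)"
    using N0 by (intro mult_left_mono) auto
  ultimately show ?thesis by linarith
qed

text \<open>The displacement is made one coordinate at a time. Each coordinate of \<open>y\<close>
  is at most \<open>norm y \<le> 1\<close>, so the one-direction estimate applies to every
  step.\<close>

lemma Lipschitz_of_bounded_laplacian:
  fixes u :: "'a::euclidean_space \<Rightarrow> real" and D2 :: "'a \<Rightarrow> 'a \<Rightarrow> real" and M N :: real
  assumes cont: "continuous_on UNIV u"
    and D1: "\<And>c. c \<in> Basis \<Longrightarrow> has_dirderiv c u (D1 c)"
    and D2: "\<And>c. c \<in> Basis \<Longrightarrow> has_dirderiv c (D1 c) (D2 c)"
    and M: "\<And>x. \<bar>u x\<bar> \<le> M" and N: "\<And>x. \<bar>\<Sum>c\<in>Basis. D2 c x\<bar> \<le> N"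
    and y: "norm y \<le> 1"
  shows "\<bar>u (z + y) - u z\<bar> \<le> DIM('a) * (M * DIM('a) + N) * norm y"
proof -
  have N0: "0 \<le> N" using N[of 0] by linarith
  have M0: "0 \<le> M" using M[of 0] by linarith
  have "\<bar>u (z + (\<Sum>c\<in>F. (y \<bullet> c) *\<^sub>R c)) - u z\<bar> \<le> card F * ((M * DIM('a) + N) * norm y)" if "F \<subseteq> Basis" for F
    using finite_subset[OF that finite_Basis] that
  proof (induction F rule: finite_induct)
    case (insert c F)
    have c: "c \<in> Basis" using insert by auto
    have yc: "\<bar>y \<bullet> c\<bar> \<le> norm y" using c by (rule Basis_le_norm)
    have "\<bar>u ((z + (\<Sum>c\<in>F. (y \<bullet> c) *\<^sub>R c)) + (y \<bullet> c) *\<^sub>R c) - u (z + (\<Sum>c\<in>F. (y \<bullet> c) *\<^sub>R c))\<bar>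
        \<le> \<bar>y \<bullet> c\<bar> * (M * DIM('a) + N)"
      by (rule gradient_bound_step[OF cont c D1 D2 M N]) (use yc y in auto)
    also have "\<dots> \<le> norm y * (M * DIM('a) + N)"
      using yc M0 N0 by (intro mult_right_mono) auto
    finally have "\<bar>u ((z + (\<Sum>c\<in>F. (y \<bullet> c) *\<^sub>R c)) + (y \<bullet> c) *\<^sub>R c) - u (z + (\<Sum>c\<in>F. (y \<bullet> c) *\<^sub>R c))\<bar>
        \<le> (M * DIM('a) + N) * norm y" by (simp add: mult.commute)
    moreover have "(z + (\<Sum>c\<in>F. (y \<bullet> c) *\<^sub>R c)) + (y \<bullet> c) *\<^sub>R c = z + (\<Sum>c\<in>insert c F. (y \<bullet> c) *\<^sub>R c)"
      using insert by (simp add: algebra_simps)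
    ultimately show ?case using insert by (auto simp: algebra_simps)
  qed simp
  from this[of Basis] show ?thesis by (simp add: euclidean_representation mult.assoc)
qed

section \<open>Averages over segments\<close>

definition seg_avg :: "'a::euclidean_space \<Rightarrow> ('a \<Rightarrow> 'b::banach) \<Rightarrow> 'a \<Rightarrow> 'b" where
  "seg_avg v u z = integral {0..1} (\<lambda>s. u (z + s *\<^sub>R v))"

lemma seg_avg_integrable:
  fixes u :: "'a::euclidean_space \<Rightarrow> 'b::banach"
  assumes "continuous_on UNIV u"
  shows "(\<lambda>s. u (z + s *\<^sub>R v)) integrable_on {a..b::real}"
  by (intro integrable_continuous_real continuous_on_compose2[OF assms] continuous_intros) auto

lemma continuous_seg_avg:
  assumes "continuous_on UNIV u"
  shows "continuous_on UNIV (seg_avg v u)"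
  unfolding seg_avg_def
  by (intro integral_continuous_on_param[where a="0::real" and b=1, unfolded cbox_interval])
    (auto simp: case_prod_unfold intro!: continuous_on_compose2[OF assms] continuous_intros)

lemma seg_avg_linear:
  assumes "continuous_on UNIV u" "bounded_linear l"
  shows "seg_avg v (\<lambda>z. l (u z)) z = l (seg_avg v u z)"
  using integral_linear[OF seg_avg_integrable[OF assms(1)] assms(2)]
  by (simp add: seg_avg_def comp_def)

lemma seg_avg_add:
  assumes "continuous_on UNIV u" "continuous_on UNIV u'"
  shows "seg_avg v (\<lambda>z. u z + u' z) z = seg_avg v u z + seg_avg v u' z"
  unfolding seg_avg_def by (intro integral_add seg_avg_integrable assms)

lemma seg_avg_translate: "seg_avg v (\<lambda>z. u (z + a)) z = seg_avg v u (z + a)"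
  by (simp add: seg_avg_def algebra_simps)

lemma seg_avg_commute:
  assumes "continuous_on UNIV u"
  shows "seg_avg v (seg_avg w u) = seg_avg w (seg_avg v u)"
proof
  fix z
  have "continuous_on (cbox (0::real,0::real) (1,1)) (\<lambda>(x,y). u (z + x *\<^sub>R v + y *\<^sub>R w))"
    unfolding case_prod_unfold by (intro continuous_on_compose2[OF assms] continuous_intros) auto
  from integral_swap_continuous[OF this]
  show "seg_avg v (seg_avg w u) z = seg_avg w (seg_avg v u) z"
    unfolding seg_avg_def cbox_interval by (simp add: algebra_simps)
qed

lemma seg_avg_close:
  assumes "continuous_on UNIV u" "\<And>s. 0 \<le> s \<Longrightarrow> s \<le> 1 \<Longrightarrow> norm (u (z + s *\<^sub>R v) - c) \<le> e"
  shows "norm (seg_avg v u z - c) \<le> e"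
proof -
  have "seg_avg v u z - c = integral {0..1} (\<lambda>s. u (z + s *\<^sub>R v) - c)"
    unfolding seg_avg_def using seg_avg_integrable[OF assms(1)]
    by (subst integral_diff) auto
  also have "norm \<dots> \<le> e * (1 - 0)"
    using assms(2)
    by (intro integral_bound continuous_on_compose2[OF assms(1)] continuous_intros) auto
  finally show ?thesis by simp
qed

text \<open>Along the line in direction \<open>v\<close> the average is
  \<open>G (t + 1) - G t\<close> for a primitive \<open>G\<close>, so continuity of \<open>u\<close>
  alone yields a derivative. The companion \<open>seg_avg_has_dirderiv\<close> undoes a derivative
  instead.\<close>

lemma has_dirderiv_seg_avg:
  assumes "continuous_on UNIV u"
  shows "has_dirderiv v (seg_avg v u) (\<lambda>z. u (z + v) - u z)"
  unfolding has_dirderiv_def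
proof
  fix z
  define g where "g = (\<lambda>s. u (z + s *\<^sub>R v))"
  \<comment> \<open>Starting at \<open>-1\<close> keeps both \<open>t\<close> and
    \<open>t + 1\<close> inside the interval where \<open>G\<close> is differentiable for all
    \<open>t\<close> near 0.\<close>
  define G where "G = (\<lambda>t. integral {-1..t} g)"
  have cg: "continuous_on A g" for A
    unfolding g_def by (intro continuous_on_compose2[OF assms] continuous_intros) auto
  have ig: "g integrable_on {a..b}" for a b using cg by (rule integrable_continuous_real)
  have G: "(G has_vector_derivative g t) (at t)" if "-1 < t" "t < 3" for t
  proof -
    have "(G has_vector_derivative g t) (at t within {-1..3})"
      unfolding G_def using that by (intro integral_has_vector_derivative cg) auto
    then show ?thesis
      using that by (metis at_within_Icc_at)
  qed
  have eq: "seg_avg v u (z + t *\<^sub>R v) = G (t + 1) - G t" if "\<bar>t\<bar> < 1" for t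
  proof -
    have "seg_avg v u (z + t *\<^sub>R v) = integral {0..1} (g \<circ> ((+) t))"
      by (simp add: seg_avg_def g_def algebra_simps comp_def)
    also have "\<dots> = integral {t..t + 1} g"
      unfolding integral_shift_Icc_real by (simp add: add.commute)
    also have "\<dots> = G (t + 1) - G t"
      unfolding G_def using Henstock_Kurzweil_Integration.integral_combine[of "-1" t "t+1" g] that ig[of "-1" "t+1"] by (simp add: algebra_simps)
    finally show ?thesis .
  qed
  have "((\<lambda>t. G (t + 1) - G t) has_vector_derivative g 1 - g 0) (at 0)"
  proof -
    have "((G \<circ> (\<lambda>t. t + 1)) has_vector_derivative 1 *\<^sub>R g 1) (at 0)"
      by (intro vector_diff_chain_at) (auto intro!: derivative_eq_intros G)
    then show ?thesis by (auto intro!: has_vector_derivative_diff G simp: comp_def)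
  qed
  then have "((\<lambda>t. seg_avg v u (z + t *\<^sub>R v)) has_vector_derivative g 1 - g 0) (at 0)"
    by (rule has_vector_derivative_transform_within_open[where S="{-1<..<1}"]) (auto simp: eq)
  then show "((\<lambda>t. seg_avg v u (z + t *\<^sub>R v)) has_vector_derivative u (z + v) - u z) (at 0)"
    by (simp add: g_def)
qed

lemma seg_avg_has_dirderiv:
  assumes "has_dirderiv v u D"
  shows "seg_avg v D z = u (z + v) - u z"
proof -
  have "((\<lambda>t. D (z + t *\<^sub>R v)) has_integral (u (z + 1 *\<^sub>R v) - u (z + 0 *\<^sub>R v))) {0..1}"
    by (intro fundamental_theorem_of_calculus has_vector_derivative_at_within[OF has_dirderiv_line[OF assms]]) auto
  then show ?thesis by (auto simp: seg_avg_def)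
qed

section \<open>Iterated segment averages and second differences\<close>

definition smear :: "'a::euclidean_space list \<Rightarrow> ('a \<Rightarrow> 'b::banach) \<Rightarrow> 'a \<Rightarrow> 'b" where
  "smear vs u = foldr seg_avg vs u"

lemma smear_simps [simp]: "smear [] u = u" "smear (v # vs) u = seg_avg v (smear vs u)"
  "smear (vs @ ws) u = smear vs (smear ws u)"
  by (auto simp: smear_def)

lemma continuous_smear:
  assumes "continuous_on UNIV u"
  shows "continuous_on UNIV (smear vs u)"
  by (induction vs) (auto intro: continuous_seg_avg assms)

lemma smear_linear:
  assumes "continuous_on UNIV u" "bounded_linear l"
  shows "smear vs (\<lambda>z. l (u z)) = (\<lambda>z. l (smear vs u z))"
proof (induction vs)
  case (Cons v vs)
  show ?case unfolding smear_simps Cons.IH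
    by (rule ext) (rule seg_avg_linear[OF continuous_smear[OF assms(1)] assms(2)])
qed auto

lemma smear_add:
  assumes "continuous_on UNIV u" "continuous_on UNIV u'"
  shows "smear vs (\<lambda>z. u z + u' z) = (\<lambda>z. smear vs u z + smear vs u' z)"
proof (induction vs)
  case (Cons v vs)
  show ?case unfolding smear_simps Cons.IH
    by (rule ext) (rule seg_avg_add[OF continuous_smear[OF assms(1)] continuous_smear[OF assms(2)]])
qed auto

lemma smear_translate: "smear vs (\<lambda>z. u (z + a)) = (\<lambda>z. smear vs u (z + a))"
proof (induction vs)
  case (Cons v vs)
  show ?case unfolding smear_simps Cons.IH by (rule ext) (rule seg_avg_translate)
qed auto

text \<open>Averages in two directions commute by Fubini. Hence the two averages belonging to one
  basis direction can be moved to either end of the list: to the front to differentiate the result,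
  to the back to integrate a derivative.\<close>

lemma smear_perm:
  assumes "continuous_on UNIV u" "mset vs = mset ws"
  shows "smear vs u = smear ws u"
  using assms(2)
proof (induction vs arbitrary: ws)
  case (Cons v vs)
  then have "v \<in> set ws" by (metis list.set_intros(1) mset_eq_setD)
  then obtain xs ys where ws: "ws = xs @ v # ys" by (meson split_list)
  have *: "smear xs (seg_avg v f) = seg_avg v (smear xs f)" if "continuous_on UNIV f" for f
    by (induction xs) (auto simp: seg_avg_commute continuous_smear that)
  have "smear vs u = smear (xs @ ys) u" using Cons.prems ws by (intro Cons.IH) auto
  then show ?case using ws *[OF continuous_smear[OF assms(1)]] by simp
qed auto

text \<open>Nested averaging evaluates \<open>u\<close> only at points whose distance from
  \<open>z\<close> is at most the total length of the segments. The case \<open>c = 0\<close> gives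
  the sup bound, and short segments give convergence.\<close>

lemma smear_close:
  assumes "continuous_on UNIV u"
    and "\<And>y. norm (y - z) \<le> sum_list (map norm vs) \<Longrightarrow> norm (u y - c) \<le> e"
  shows "norm (smear vs u z - c) \<le> e"
  using assms(2)
proof (induction vs arbitrary: z)
  case (Cons v vs)
  show ?case unfolding smear_simps
  proof (intro seg_avg_close continuous_smear assms(1) Cons.IH Cons.prems)
    fix s y assume s: "0 \<le> s" "s \<le> (1::real)" and y: "norm (y - (z + s *\<^sub>R v)) \<le> sum_list (map norm vs)"
    have "norm (y - z) \<le> norm (y - (z + s *\<^sub>R v)) + norm (s *\<^sub>R v)"
      using norm_triangle_ineq[of "y - (z + s *\<^sub>R v)" "s *\<^sub>R v"] by simp
    also have "norm (s *\<^sub>R v) \<le> 1 * norm v" unfolding norm_scaleR using s by (intro mult_right_mono) auto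
    finally show "norm (y - z) \<le> sum_list (map norm (v # vs))" using y by simp
  qed
qed auto

lemma smear_bound:
  assumes "continuous_on UNIV u" "\<And>y. norm (u y) \<le> M"
  shows "norm (smear vs u z) \<le> M"
  using smear_close[of u z vs 0 M] assms by simp

text \<open>Each basis vector occurs with both signs: one average per derivative, with opposite
  orientation so that the resulting second difference is centred.\<close>

definition dirs :: "real \<Rightarrow> 'a::real_vector list \<Rightarrow> 'a list" where
  "dirs h bs = map (\<lambda>b. h *\<^sub>R b) bs @ map (\<lambda>b. - (h *\<^sub>R b)) bs"

definition second_diff :: "'a::real_vector \<Rightarrow> ('a \<Rightarrow> 'b::real_vector) \<Rightarrow> 'a \<Rightarrow> 'b" where
  "second_diff v u z = u (z + v) + u (z - v) - 2 *\<^sub>R u z"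

lemma mset_dirs_remove1:
  assumes "b \<in> set bs"
  shows "mset (dirs h bs) = mset (h *\<^sub>R b # - (h *\<^sub>R b) # dirs h (remove1 b bs))"
proof -
  have "mset bs = add_mset b (mset (remove1 b bs))"
    using assms by simp
  then show ?thesis unfolding dirs_def mset_append mset_map mset.simps by (simp del: mset_remove1)
qed

lemma continuous_second_diff:
  "continuous_on UNIV u \<Longrightarrow> continuous_on UNIV (second_diff v u)" for u :: "'a::euclidean_space \<Rightarrow> 'b::real_normed_vector"
  unfolding second_diff_def by (auto intro!: continuous_intros intro: continuous_on_compose2[of UNIV u])

lemma smear_second_diff:
  assumes "continuous_on UNIV u"
  shows "smear vs (second_diff v u) = second_diff v (smear vs u)"
proof -
  have c: "continuous_on UNIV (\<lambda>z. u (z + a))" for a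
    by (intro continuous_on_compose2[OF assms] continuous_intros) auto
  have "second_diff v u = (\<lambda>z. (u (z + v) + u (z + (- v))) + (-2) *\<^sub>R u z)"
    by (auto simp: second_diff_def fun_eq_iff)
  then have "smear vs (second_diff v u) = (\<lambda>z. (smear vs (\<lambda>z. u (z + v)) z + smear vs (\<lambda>z. u (z + (- v))) z) + smear vs (\<lambda>z. (-2) *\<^sub>R u z) z)"
    using c[of v] c[of "-v"] assms
    by (simp add: smear_add continuous_on_add continuous_on_scaleR continuous_on_const continuous_on_minus del: add_uminus_conv_diff scaleR_minus_left)
  also have "\<dots> = second_diff v (smear vs u)"
    unfolding smear_translate smear_linear[OF assms bounded_linear_scaleR_right]
    by (auto simp: second_diff_def fun_eq_iff)
  finally show ?thesis .
qed

text \<open>Moving the averages along \<open>h *\<^sub>R b\<close> and its negative to the front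
  gives two derivatives of a merely continuous \<open>u\<close>. They consume this pair of averages,
  hence \<open>remove1 b bs\<close>; each rescaling from \<open>h *\<^sub>R b\<close> to
  \<open>b\<close> costs a factor \<open>1 / h\<close>.\<close>

lemma smear_dirs_has_dirderiv2:
  fixes u :: "'a::euclidean_space \<Rightarrow> 'b::banach"
  assumes u: "continuous_on UNIV u" and b: "b \<in> set bs" and h: "h \<noteq> 0"
  shows "\<exists>D1. has_dirderiv b (smear (dirs h bs) u) D1 \<and>
    has_dirderiv b D1 (\<lambda>z. (1 / h\<^sup>2) *\<^sub>R smear (dirs h (remove1 b bs)) (second_diff (h *\<^sub>R b) u) z)"
proof -
  define w where "w = smear (dirs h (remove1 b bs)) u"
  define v where "v = h *\<^sub>R b"
  define g where "g = seg_avg (- v) w"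
  have cw: "continuous_on UNIV w" unfolding w_def by (intro continuous_smear u)
  have cg: "continuous_on UNIV g" unfolding g_def by (intro continuous_seg_avg cw)
  have eq: "smear (dirs h bs) u = seg_avg v g"
    using smear_perm[OF u mset_dirs_remove1[OF b]] by (simp add: g_def v_def w_def)
  have dg: "has_dirderiv v g (\<lambda>z. w z - w (z - v))"
    using has_dirderiv_scaleR[OF has_dirderiv_seg_avg[OF cw, of "-v"], of "-1"] by (simp add: g_def)
  have "has_dirderiv v (\<lambda>z. g (z + v) - g z) (second_diff v w)"
    using has_dirderiv_diff[OF has_dirderiv_affine[OF dg, of v] dg] by (simp add: second_diff_def[abs_def] algebra_simps scaleR_2)
  then have "has_dirderiv v (\<lambda>z. (1/h) *\<^sub>R (g (z + v) - g z)) (\<lambda>z. (1/h) *\<^sub>R second_diff v w z)"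
    by (rule has_dirderiv_linear) (rule bounded_linear_scaleR_right)
  from has_dirderiv_scaleR[OF this, of "1/h"]
  have "has_dirderiv b (\<lambda>z. (1/h) *\<^sub>R (g (z + v) - g z)) (\<lambda>z. (1/h\<^sup>2) *\<^sub>R second_diff v w z)"
    using h by (simp add: v_def power2_eq_square)
  moreover have "has_dirderiv b (seg_avg v g) (\<lambda>z. (1/h) *\<^sub>R (g (z + v) - g z))"
    using has_dirderiv_scaleR[OF has_dirderiv_seg_avg[OF cg, of v], of "1/h"] h by (simp add: v_def)
  ultimately show ?thesis unfolding eq smear_second_diff[OF u] w_def[symmetric] v_def[symmetric] by blast
qed

text \<open>The counterpart for a function that is already twice differentiable: the pair of
  averages is moved to the inside and integrates \<open>D2\<close> twice. The outcome is the same
  expression as in \<open>smear_dirs_has_dirderiv2\<close>, which later makes two operators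
  comparable.\<close>

lemma smear_dirs_of_has_dirderiv2:
  fixes u :: "'a::euclidean_space \<Rightarrow> 'b::banach"
  assumes u: "continuous_on UNIV u" "continuous_on UNIV D2"
    and d: "has_dirderiv b u D1" "has_dirderiv b D1 D2"
    and b: "b \<in> set bs" and h: "h \<noteq> 0"
  shows "smear (dirs h bs) D2 = (\<lambda>z. (1 / h\<^sup>2) *\<^sub>R smear (dirs h (remove1 b bs)) (second_diff (h *\<^sub>R b) u) z)"
proof -
  define v where "v = h *\<^sub>R b"
  have "mset (dirs h bs) = mset (dirs h (remove1 b bs) @ [v, - v])"
    unfolding mset_dirs_remove1[OF b] v_def by simp
  then have 1: "smear (dirs h bs) D2 = smear (dirs h (remove1 b bs)) (seg_avg v (seg_avg (- v) D2))"
    using smear_perm[OF u(2)] by fastforce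
  have d': "has_dirderiv v u (\<lambda>z. h *\<^sub>R D1 z)" "has_dirderiv (- v) D1 (\<lambda>z. - h *\<^sub>R D2 z)"
    using has_dirderiv_scaleR[OF d(1), of h] has_dirderiv_scaleR[OF d(2), of "-h"] by (auto simp: v_def)
  have "seg_avg (- v) D2 = (\<lambda>z. (1/h) *\<^sub>R (D1 z - D1 (z - v)))"
  proof
    fix z
    have "- h *\<^sub>R seg_avg (- v) D2 z = D1 (z - v) - D1 z"
      using seg_avg_has_dirderiv[OF d'(2), of z] seg_avg_linear[OF u(2) bounded_linear_scaleR_right, of "-v" "-h" z] by simp
    then have "(-1/h) *\<^sub>R (- h *\<^sub>R seg_avg (- v) D2 z) = (-1/h) *\<^sub>R (D1 (z - v) - D1 z)" by simp
    then show "seg_avg (- v) D2 z = (1/h) *\<^sub>R (D1 z - D1 (z - v))" using h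
      by (simp add: scaleR_diff_right)
  qed
  moreover have "has_dirderiv v (\<lambda>z. (1/h\<^sup>2) *\<^sub>R (u z - u (z + (- v)))) (\<lambda>z. (1/h) *\<^sub>R (D1 z - D1 (z - v)))"
  proof -
    have "has_dirderiv v (\<lambda>z. (1/h\<^sup>2) *\<^sub>R (u z - u (z + (- v)))) (\<lambda>z. (1/h\<^sup>2) *\<^sub>R (h *\<^sub>R D1 z - h *\<^sub>R D1 (z + (- v))))"
      by (intro has_dirderiv_linear[OF has_dirderiv_diff[OF d'(1) has_dirderiv_affine[OF d'(1)]]] bounded_linear_scaleR_right)
    then show ?thesis using h by (simp add: scaleR_diff_right power2_eq_square)
  qed
  ultimately have "seg_avg v (seg_avg (- v) D2) = (\<lambda>z. (1/h\<^sup>2) *\<^sub>R second_diff v u z)"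
    using seg_avg_has_dirderiv by (fastforce simp: second_diff_def algebra_simps scaleR_2)
  then show ?thesis
    unfolding 1 v_def by (simp add: smear_linear[OF continuous_second_diff[OF u(1)] bounded_linear_scaleR_right])
qed

section \<open>Gaussian measure and entire functions\<close>

lemma gauss_nn_integral_real:
  assumes "a > 0"
  shows "(\<integral>\<^sup>+x. ennreal (exp (- (a * x\<^sup>2))) \<partial>lborel) = ennreal (sqrt (pi / a))"
proof -
  \<comment> \<open>The standard deviation for which the normal density is proportional to
    \<open>exp (- (a * x^2))\<close>.\<close>
  define s where "s = sqrt (1 / (2 * a))"
  have s: "s > 0" "s\<^sup>2 = 1 / (2 * a)" using assms by (auto simp: s_def)
  have eq: "exp (- (a * x\<^sup>2)) = sqrt (pi / a) * normal_density 0 s x" for x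
  proof -
    have "sqrt (2 * pi * s\<^sup>2) = sqrt (pi / a)" using assms by (simp add: s)
    then have "sqrt (pi / a) * normal_density 0 s x = exp (- x\<^sup>2 / (2 * s\<^sup>2))"
      using assms by (simp add: normal_density_def)
    then show ?thesis using assms by (simp add: s field_simps)
  qed
  have "(\<integral>\<^sup>+x. ennreal (exp (- (a * x\<^sup>2))) \<partial>lborel) = ennreal (\<integral>x. exp (- (a * x\<^sup>2)) \<partial>lborel)"
    by (rule nn_integral_eq_integral) (use s assms in \<open>simp_all only: eq, auto\<close>)
  also have "(\<integral>x. exp (- (a * x\<^sup>2)) \<partial>lborel) = sqrt (pi / a)"
    unfolding eq using s by simp
  finally show ?thesis .
qed

lemma gauss_nn_integral:
  assumes "a > 0"
  shows "(\<integral>\<^sup>+z. ennreal (exp (- (a * (norm z)\<^sup>2))) \<partial>(lborel :: 'a::euclidean_space measure)) = ennreal (sqrt (pi / a) ^ DIM('a))"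
proof -
  have "exp (- (a * (norm z)\<^sup>2)) = (\<Prod>b\<in>Basis. exp (- (a * (z \<bullet> b)\<^sup>2)))" for z :: 'a
  proof -
    have "- (a * (norm z)\<^sup>2) = (\<Sum>b\<in>Basis. - (a * (z \<bullet> b)\<^sup>2))"
      unfolding power2_norm_eq_inner by (subst euclidean_inner) (simp add: sum_distrib_left power2_eq_square sum_negf)
    then show ?thesis by (simp only: exp_sum[OF finite_Basis])
  qed
  then have "(\<integral>\<^sup>+z. ennreal (exp (- (a * (norm z)\<^sup>2))) \<partial>(lborel :: 'a measure)) =
     (\<integral>\<^sup>+z. (\<Prod>b\<in>Basis. ennreal (exp (- (a * (z \<bullet> b)\<^sup>2)))) \<partial>(lborel :: 'a measure))"
    by (simp add: prod_ennreal)
  also have "\<dots> = (\<Prod>b\<in>(Basis::'a set). (\<integral>\<^sup>+x. ennreal (exp (- (a * x\<^sup>2))) \<partial>lborel))"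
    by (rule nn_integral_lborel_prod) auto
  also have "\<dots> = ennreal (sqrt (pi / a) ^ DIM('a))"
    unfolding gauss_nn_integral_real[OF assms] using assms by (simp add: ennreal_power)
  finally show ?thesis .
qed

lemma integrable_gauss:
  assumes "a > 0"
  shows "integrable (lborel :: 'a::euclidean_space measure) (\<lambda>z. exp (- (a * (norm z)\<^sup>2)))"
  by (rule integrableI_nonneg) (use assms in \<open>auto simp: gauss_nn_integral\<close>)

lemma gauss_wt_nonneg [simp]: "gauss_wt z \<ge> 0" by (simp add: gauss_wt_def)

lemma continuous_gauss_wt [continuous_intros]:
  "continuous_on S f \<Longrightarrow> continuous_on S (\<lambda>x. gauss_wt (f x))"
  unfolding gauss_wt_def by (intro continuous_intros)

lemma borel_measurable_gauss_wt [measurable]: "gauss_wt \<in> borel_measurable borel"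
  by (intro borel_measurable_continuous_onI continuous_intros)

lemma integrable_gauss_wt: "integrable lborel gauss_wt"
  using integrable_gauss[of pi] unfolding gauss_wt_def[abs_def] by simp

lemma nn_integral_gauss_wt: "(\<integral>\<^sup>+z. ennreal (gauss_wt z) \<partial>lborel) = 1"
  using gauss_nn_integral[of pi] by (simp add: gauss_wt_def[abs_def])

lemma integral_gauss_wt: "integral\<^sup>L lborel gauss_wt = 1"
  by (subst integral_eq_nn_integral) (auto simp: nn_integral_gauss_wt)

text \<open>Both measures are translation invariant, hence proportional; the constant is read off from a Gaussian.\<close>

lemma lborel_distr_isometry:
  fixes R R' :: "'a::euclidean_space \<Rightarrow> 'a"
  assumes R: "linear R" and norm: "\<And>x. norm (R x) = norm x" and R': "\<And>x. R (R' x) = x"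
  shows "distr lborel borel R = lborel"
proof -
  have contR: "continuous_on UNIV R" using R by (simp add: linear_continuous_on linear_conv_bounded_linear)
  note [measurable] = borel_measurable_continuous_onI[OF contR]
  have shift: "(\<integral>\<^sup>+x. F (x + a) \<partial>lborel) = (\<integral>\<^sup>+x. F x \<partial>lborel)"
    if [measurable]: "F \<in> borel_measurable borel" for F :: "'a \<Rightarrow> ennreal" and a
    using nn_integral_distr[of "(+) a" lborel borel F] by (simp add: lborel_distr_plus add.commute)
  have refl: "(\<integral>\<^sup>+x. F (- x) \<partial>lborel) = (\<integral>\<^sup>+x. F x \<partial>lborel)"
    if [measurable]: "F \<in> borel_measurable borel" for F :: "'a \<Rightarrow> ennreal"
  proof -
    have "distr lborel borel uminus = (lborel :: 'a measure)"
      by (subst (2) lborel_affine[of "-1" 0]) (auto simp: density_1)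
    then show ?thesis using nn_integral_distr[of "uminus" lborel borel F] by simp
  qed
  \<comment> \<open>Both products are the integral of \<open>F x * G (R y + x)\<close> over
    \<open>x\<close> and \<open>y\<close>, evaluated in the two orders. Taking for \<open>G\<close>
    a normalized Gaussian, unchanged by the isometry \<open>R\<close>, removes the factors in
    \<open>G\<close>.\<close>
  have key: "(\<integral>\<^sup>+x. F x \<partial>lborel) * (\<integral>\<^sup>+x. G (R x) \<partial>lborel) = (\<integral>\<^sup>+x. G x \<partial>lborel) * (\<integral>\<^sup>+x. F (R x) \<partial>lborel)"
    if [measurable]: "F \<in> borel_measurable borel" "G \<in> borel_measurable borel" for F G :: "'a \<Rightarrow> ennreal"
  proof -
    have Radd: "R (x + R' y) = R x + y" for x y using R R' by (simp add: linear_add)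
    have Rneg: "R (- x) = - R x" for x using R by (simp add: linear_neg)
    have "(\<integral>\<^sup>+x. F x \<partial>lborel) * (\<integral>\<^sup>+y. G (R y) \<partial>lborel) = (\<integral>\<^sup>+x. (\<integral>\<^sup>+y. F x * G (R y + x) \<partial>lborel) \<partial>lborel)"
    proof -
      have "(\<integral>\<^sup>+y. G (R y + x) \<partial>lborel) = (\<integral>\<^sup>+y. G (R y) \<partial>lborel)" for x
        using shift[of "\<lambda>y. G (R y)" "R' x"] by (simp add: Radd)
      then show ?thesis by (simp add: nn_integral_cmult nn_integral_multc)
    qed
    also have "\<dots> = (\<integral>\<^sup>+y. (\<integral>\<^sup>+x. F x * G (R y + x) \<partial>lborel) \<partial>lborel)"
      by (rule lborel_pair.Fubini') measurable
    also have "\<dots> = (\<integral>\<^sup>+y. (\<integral>\<^sup>+x. F (x - R y) * G x \<partial>lborel) \<partial>lborel)"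
    proof -
      have "(\<integral>\<^sup>+x. F x * G (R y + x) \<partial>lborel) = (\<integral>\<^sup>+x. F (x - R y) * G x \<partial>lborel)" for y
        using shift[of "\<lambda>x. F x * G (R y + x)" "- R y"] by simp
      then show ?thesis by simp
    qed
    also have "\<dots> = (\<integral>\<^sup>+x. (\<integral>\<^sup>+y. F (x - R y) * G x \<partial>lborel) \<partial>lborel)"
      by (rule lborel_pair.Fubini'[symmetric]) measurable
    also have "\<dots> = (\<integral>\<^sup>+x. G x \<partial>lborel) * (\<integral>\<^sup>+x. F (R x) \<partial>lborel)"
    proof -
      have "(\<integral>\<^sup>+y. F (x - R y) \<partial>lborel) = (\<integral>\<^sup>+y. F (R y) \<partial>lborel)" for x
        using refl[of "\<lambda>y. F (x + R y)"] shift[of "\<lambda>y. F (R y)" "R' x"]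
        by (simp add: Rneg Radd add.commute)
      then show ?thesis by (simp add: nn_integral_multc nn_integral_cmult) (simp add: mult.commute)
    qed
    finally show ?thesis .
  qed
  show ?thesis
  proof (rule measure_eqI)
    fix A assume "A \<in> sets (distr lborel borel R)"
    then have [measurable]: "A \<in> sets borel" by simp
    define G :: "'a \<Rightarrow> ennreal" where "G = (\<lambda>z. ennreal (exp (- (pi * (norm z)\<^sup>2))))"
    have [measurable]: "G \<in> borel_measurable borel" unfolding G_def by measurable
    have G: "(\<integral>\<^sup>+x. G x \<partial>lborel) = 1" "(\<integral>\<^sup>+x. G (R x) \<partial>lborel) = 1"
      using gauss_nn_integral[of pi, where 'a='a] by (auto simp: G_def norm)
    have "emeasure (distr lborel borel R) A = (\<integral>\<^sup>+x. indicator A (R x) \<partial>lborel)"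
      using nn_integral_distr[of R lborel borel "indicator A"] by simp
    also have "\<dots> = emeasure lborel A"
      using key[of "indicator A" G] G by simp
    finally show "emeasure (distr lborel borel R) A = emeasure lborel A" .
  qed simp
qed

lemma integral_lborel_translate:
  fixes a :: "'a::euclidean_space" and f :: "'a \<Rightarrow> 'b::{banach,second_countable_topology}"
  assumes [measurable]: "f \<in> borel_measurable borel"
  shows "(\<integral>x. f (x - a) \<partial>lborel) = (\<integral>x. f x \<partial>lborel)"
  using integral_distr[of "(+) (- a)" lborel borel f] by (simp add: lborel_distr_plus)

lemma integrable_lborel_translate:
  fixes a :: "'a::euclidean_space" and f :: "'a \<Rightarrow> 'b::{banach,second_countable_topology}"
  assumes [measurable]: "f \<in> borel_measurable borel" and "integrable lborel f"
  shows "integrable lborel (\<lambda>x. f (x - a))"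
  using integrable_distr_eq[of "(+) (- a)" lborel borel f] assms by (simp add: lborel_distr_plus)

section \<open>Entire functions of several complex variables\<close>

lemma norm_smult: "norm (c *s (v :: complex ^ 'n)) = cmod c * norm v"
  by (simp add: norm_vec_def L2_set_def norm_mult power_mult_distrib sum_distrib_left[symmetric] real_sqrt_mult)

lemma bounded_linear_smult_left: "bounded_linear (\<lambda>c. c *s (v :: complex ^ 'n::finite))"
  by (rule bounded_linear_intro[where K="norm v"])
    (auto simp: vec_eq_iff algebra_simps norm_smult)

lemma bounded_linear_smult_right: "bounded_linear (\<lambda>v. c *s (v :: complex ^ 'n::finite))"
  by (rule bounded_linear_intro[where K="cmod c"])
    (auto simp: vec_eq_iff algebra_simps norm_smult)

lemma continuous_on_smult [continuous_intros]:
  fixes g :: "'a::topological_space \<Rightarrow> complex ^ 'n::finite"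
  assumes "continuous_on S f" "continuous_on S g"
  shows "continuous_on S (\<lambda>x. f x *s g x)"
  unfolding vector_scalar_mult_def by (intro continuous_intros assms)

lemma smult_complex: "c *s (v :: complex ^ 'n) = Re c *\<^sub>R v + Im c *\<^sub>R (\<i> *s v)"
  by (simp add: vec_eq_iff complex_eq_iff)

lemma clinear_of_i:
  fixes L :: "complex ^ 'n::finite \<Rightarrow> complex"
  assumes "linear L" "\<And>v. L (\<i> *s v) = \<i> * L v"
  shows "L (c *s v) = c * L v"
proof -
  have "L (c *s v) = Re c *\<^sub>R L v + Im c *\<^sub>R (\<i> * L v)"
    by (subst smult_complex) (simp add: assms linear_add linear_scale)
  also have "\<dots> = c * L v"
    by (subst (4) complex_eq) (simp add: scaleR_conv_of_real algebra_simps)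
  finally show ?thesis .
qed

lemma entire_fn_iff:
  "entire_fn f \<longleftrightarrow> (\<forall>z. \<exists>L. (f has_derivative L) (at z) \<and> (\<forall>c v. L (c *s v) = c * L v))"
proof -
  have "(\<forall>c v. L (c *s v) = c * L v) \<longleftrightarrow> (\<forall>v. L (\<chi> i. \<i> * v $ i) = \<i> * L v)"
    if "(f has_derivative L) (at z)" for z L
    using clinear_of_i[OF has_derivative_linear[OF that]]
    unfolding vector_scalar_mult_def[symmetric] by blast
  then show ?thesis unfolding entire_fn_def by blast
qed

lemma entire_continuous: "entire_fn f \<Longrightarrow> continuous_on A f"
  unfolding entire_fn_iff
  by (meson continuous_at_imp_continuous_on has_derivative_continuous)

lemma entire_measurable: "entire_fn f \<Longrightarrow> f \<in> borel_measurable borel"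
  by (intro borel_measurable_continuous_onI entire_continuous)

lemma entire_const: "entire_fn (\<lambda>_. c)"
  unfolding entire_fn_iff by (intro allI exI[of _ "\<lambda>_. 0"]) auto

lemma entire_add:
  assumes "entire_fn f" "entire_fn g" shows "entire_fn (\<lambda>w. f w + g w)"
  unfolding entire_fn_iff
proof
  fix z
  obtain L M where "(f has_derivative L) (at z)" "\<forall>c v. L (c *s v) = c * L v"
    "(g has_derivative M) (at z)" "\<forall>c v. M (c *s v) = c * M v"
    using assms unfolding entire_fn_iff by meson
  then show "\<exists>L. ((\<lambda>w. f w + g w) has_derivative L) (at z) \<and> (\<forall>c v. L (c *s v) = c * L v)"
    by (intro exI[of _ "\<lambda>h. L h + M h"]) (auto intro!: derivative_eq_intros simp: algebra_simps)
qed

lemma entire_mult: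
  assumes "entire_fn f" "entire_fn g" shows "entire_fn (\<lambda>w. f w * g w)"
  unfolding entire_fn_iff
proof
  fix z
  obtain L M where "(f has_derivative L) (at z)" "\<forall>c v. L (c *s v) = c * L v"
    "(g has_derivative M) (at z)" "\<forall>c v. M (c *s v) = c * M v"
    using assms unfolding entire_fn_iff by meson
  then show "\<exists>L. ((\<lambda>w. f w * g w) has_derivative L) (at z) \<and> (\<forall>c v. L (c *s v) = c * L v)"
    by (intro exI[of _ "\<lambda>h. f z * M h + L h * g z"]) (auto intro!: derivative_eq_intros simp: algebra_simps)
qed

lemma entire_translate:
  assumes "entire_fn f" shows "entire_fn (\<lambda>w. f (w - a))"
  unfolding entire_fn_iff
proof
  fix z
  obtain L where L: "(f has_derivative L) (at (z - a))" "\<forall>c v. L (c *s v) = c * L v"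
    using assms unfolding entire_fn_iff by meson
  have "((f \<circ> (\<lambda>w. w - a)) has_derivative (L \<circ> (\<lambda>h. h))) (at z)"
    by (intro diff_chain_at L) (auto intro!: derivative_eq_intros)
  then show "\<exists>L. ((\<lambda>w. f (w - a)) has_derivative L) (at z) \<and> (\<forall>c v. L (c *s v) = c * L v)"
    using L(2) by (auto simp: comp_def)
qed

lemma cdot_smult: "cdot q (c *s v) = c * cdot q v"
  by (simp add: cdot_def sum_distrib_left algebra_simps)

lemma cdot_add: "cdot q (v + w) = cdot q v + cdot q w" "cdot (v + w) q = cdot v q + cdot w q"
  by (simp_all add: cdot_def sum.distrib algebra_simps)

lemma cdot_minus: "cdot q (- v) = - cdot q v" "cdot (- v) q = - cdot v q"
  by (simp_all add: cdot_def sum_negf)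

lemma cdot_diff: "cdot q (v - w) = cdot q v - cdot q w" "cdot (v - w) q = cdot v q - cdot w q"
  by (simp_all add: cdot_def sum_subtractf algebra_simps)

lemma cdot_commute: "cdot v w = cnj (cdot w v)"
  by (simp add: cdot_def mult.commute)

lemma cdot_scaleR: "cdot q (r *\<^sub>R v) = r *\<^sub>R cdot q v" "cdot (r *\<^sub>R v) q = r *\<^sub>R cdot v q"
  by (simp_all add: cdot_def scaleR_sum_right)

lemma cdot_self: "cdot z z = complex_of_real ((norm z)\<^sup>2)"
proof -
  have "(norm z)\<^sup>2 = (\<Sum>i\<in>UNIV. (cmod (z $ i))\<^sup>2)"
    by (simp add: norm_vec_def L2_set_def sum_nonneg)
  moreover have "cnj a * a = complex_of_real ((cmod a)\<^sup>2)" for a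
    using complex_norm_square[of a] by (simp add: mult.commute)
  ultimately show ?thesis by (simp add: cdot_def)
qed

lemma Re_cdot: "Re (cdot v w) = v \<bullet> w"
  by (simp add: cdot_def inner_vec_def inner_complex_def)

lemma norm_cdot_le: "cmod (cdot v w) \<le> norm v * norm w"
proof -
  have "cmod (cdot v w) \<le> (\<Sum>i\<in>UNIV. \<bar>cmod (v $ i)\<bar> * \<bar>cmod (w $ i)\<bar>)"
    unfolding cdot_def by (rule order_trans[OF norm_sum]) (simp add: norm_mult)
  also have "\<dots> \<le> norm v * norm w"
    unfolding norm_vec_def by (rule L2_set_mult_ineq)
  finally show ?thesis .
qed

lemma bounded_linear_cdot: "bounded_linear (cdot q)"
  by (rule bounded_linear_intro[where K="norm q"])
    (auto simp: cdot_add cdot_scaleR norm_cdot_le mult.commute[of "norm _" "norm q"])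

lemma continuous_on_cdot [continuous_intros]:
  assumes "continuous_on S f" "continuous_on S g"
  shows "continuous_on S (\<lambda>x. cdot (f x) (g x))"
  unfolding cdot_def by (intro continuous_intros assms)

lemma entire_comp_cdot:
  assumes "\<And>z. (g has_field_derivative g' z) (at z)"
  shows "entire_fn (\<lambda>w. g (cdot q w))"
  unfolding entire_fn_iff
proof
  fix z
  have "((g \<circ> cdot q) has_derivative ((*) (g' (cdot q z)) \<circ> cdot q)) (at z)"
    by (rule diff_chain_at[OF bounded_linear_imp_has_derivative[OF bounded_linear_cdot]])
      (rule assms[unfolded has_field_derivative_def])
  then show "\<exists>L. ((\<lambda>w. g (cdot q w)) has_derivative L) (at z) \<and> (\<forall>c v. L (c *s v) = c * L v)"
    by (intro exI[of _ "(*) (g' (cdot q z)) \<circ> cdot q"]) (auto simp: comp_def cdot_smult)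
qed

lemma entire_kern: "entire_fn (kern z)"
proof -
  have "((\<lambda>\<zeta>. exp (complex_of_real pi * \<zeta> - complex_of_real (pi / 2 * (norm z)\<^sup>2))) has_field_derivative
     exp (complex_of_real pi * \<zeta> - complex_of_real (pi / 2 * (norm z)\<^sup>2)) * complex_of_real pi) (at \<zeta>)" for \<zeta>
    by (auto intro!: derivative_eq_intros)
  from entire_comp_cdot[OF this, of z] show ?thesis by (simp add: kern_def)
qed

lemma entire_on_line:
  fixes f :: "'n::finite fn"
  assumes "(f has_derivative L) (at (p + \<zeta> *s q))" "\<And>c v. L (c *s v) = c * L v"
  shows "((\<lambda>\<zeta>. f (p + \<zeta> *s q)) has_field_derivative L q) (at \<zeta>)"
proof -
  have "((\<lambda>\<zeta>. p + \<zeta> *s q) has_derivative (\<lambda>h. h *s q)) (at \<zeta>)"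
    using has_derivative_add[OF has_derivative_const[of p] bounded_linear_imp_has_derivative[OF bounded_linear_smult_left[of q]]]
    by simp
  from diff_chain_at[OF this, OF assms(1)] show ?thesis
    by (simp add: has_field_derivative_def comp_def assms(2) mult_commute_abs)
qed

lemma entire_holomorphic_line:
  assumes "entire_fn f"
  shows "(\<lambda>\<zeta>. f (p + \<zeta> *s q)) holomorphic_on A"
  unfolding holomorphic_on_def
proof
  fix \<zeta>
  obtain L where "(f has_derivative L) (at (p + \<zeta> *s q))" "\<forall>c v. L (c *s v) = c * L v"
    using assms unfolding entire_fn_iff by meson
  then have "((\<lambda>\<zeta>. f (p + \<zeta> *s q)) has_field_derivative L q) (at \<zeta>)"
    using entire_on_line[of f L p \<zeta> q] by blast
  then show "(\<lambda>\<zeta>. f (p + \<zeta> *s q)) field_differentiable at \<zeta> within A"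
    by (meson field_differentiable_at_within field_differentiable_def)
qed

section \<open>The Fock space and its reproducing kernel\<close>

lemma lborel_integral_isometry:
  fixes R R' :: "'a::euclidean_space \<Rightarrow> 'a" and f :: "'a \<Rightarrow> 'b::{banach,second_countable_topology}"
  assumes R: "linear R" and norm: "\<And>x. norm (R x) = norm x" and R': "\<And>x. R (R' x) = x"
    and f: "f \<in> borel_measurable borel"
  shows "(\<integral>x. f (R x) \<partial>lborel) = (\<integral>x. f x \<partial>lborel)" "integrable lborel (\<lambda>x. f (R x)) \<longleftrightarrow> integrable lborel f"
proof -
  have "continuous_on UNIV R" using R by (simp add: linear_continuous_on linear_conv_bounded_linear)
  then have m: "R \<in> measurable lborel borel" by (simp add: borel_measurable_continuous_onI)
  note d = lborel_distr_isometry[OF R norm R']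
  show "(\<integral>x. f (R x) \<partial>lborel) = (\<integral>x. f x \<partial>lborel)"
    using integral_distr[OF m f] by (simp add: d)
  show "integrable lborel (\<lambda>x. f (R x)) \<longleftrightarrow> integrable lborel f"
    using integrable_distr_eq[OF m f] by (simp add: d)
qed

lemma fock_entire: "f \<in> fock \<Longrightarrow> entire_fn f"
  and fock_integrable: "f \<in> fock \<Longrightarrow> integrable lborel (\<lambda>z. (cmod (f z))\<^sup>2 * gauss_wt z)"
  by (auto simp: fock_def)

lemma fock_measurable: "f \<in> fock \<Longrightarrow> f \<in> borel_measurable borel"
  by (simp add: fock_entire entire_measurable)

lemma borel_measurable_cnj [measurable (raw)]:
  "f \<in> borel_measurable M \<Longrightarrow> (\<lambda>x. cnj (f x)) \<in> borel_measurable M"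
  by (rule borel_measurable_continuous_on[of cnj]) (auto intro: continuous_intros)

lemma fock_inner_integrable:
  assumes f: "f \<in> fock" and g: "g \<in> fock"
  shows "integrable lborel (\<lambda>z. f z * cnj (g z) * complex_of_real (gauss_wt z))"
proof (rule Bochner_Integration.integrable_bound)
  show "integrable lborel (\<lambda>z. (cmod (f z))\<^sup>2 * gauss_wt z + (cmod (g z))\<^sup>2 * gauss_wt z)"
    using f g by (intro Bochner_Integration.integrable_add fock_integrable)
  show "(\<lambda>z. f z * cnj (g z) * complex_of_real (gauss_wt z)) \<in> borel_measurable lborel"
    using fock_measurable[OF f] fock_measurable[OF g] by simp
  have "cmod a * cmod b * w \<le> (cmod a)\<^sup>2 * w + (cmod b)\<^sup>2 * w" if "w \<ge> 0" for a b w
  proof -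
    have "2 * (cmod a * cmod b) \<le> (cmod a)\<^sup>2 + (cmod b)\<^sup>2" using sum_squares_bound[of "cmod a" "cmod b"] by simp
    moreover have "0 \<le> cmod a * cmod b" by simp
    ultimately have "cmod a * cmod b \<le> (cmod a)\<^sup>2 + (cmod b)\<^sup>2" by linarith
    then show ?thesis using that by (metis distrib_right mult_right_mono)
  qed
  then show "AE z in lborel. norm (f z * cnj (g z) * complex_of_real (gauss_wt z))
       \<le> norm ((cmod (f z))\<^sup>2 * gauss_wt z + (cmod (g z))\<^sup>2 * gauss_wt z)"
    by (simp add: norm_mult)
qed

lemma fock_add: assumes f: "f \<in> fock" and g: "g \<in> fock" shows "(\<lambda>w. f w + g w) \<in> fock"
proof -
  have "integrable lborel (\<lambda>z. (cmod (f z + g z))\<^sup>2 * gauss_wt z)"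
  proof (rule Bochner_Integration.integrable_bound)
    show "integrable lborel (\<lambda>z. 2 * ((cmod (f z))\<^sup>2 * gauss_wt z) + 2 * ((cmod (g z))\<^sup>2 * gauss_wt z))"
      using f g by (intro Bochner_Integration.integrable_add integrable_mult_right fock_integrable)
    show "(\<lambda>z. (cmod (f z + g z))\<^sup>2 * gauss_wt z) \<in> borel_measurable lborel"
      using fock_measurable[OF f] fock_measurable[OF g] by simp
    have "(cmod (a + b))\<^sup>2 \<le> 2 * (cmod a)\<^sup>2 + 2 * (cmod b)\<^sup>2" for a b
    proof -
      have "(cmod (a + b))\<^sup>2 \<le> (cmod a + cmod b)\<^sup>2" by (intro power_mono norm_triangle_ineq) auto
      also have "\<dots> \<le> 2 * (cmod a)\<^sup>2 + 2 * (cmod b)\<^sup>2"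
        using sum_squares_bound[of "cmod a" "cmod b"] by (simp add: power2_sum)
      finally show ?thesis .
    qed
    from mult_right_mono[OF this gauss_wt_nonneg]
    show "AE z in lborel. norm ((cmod (f z + g z))\<^sup>2 * gauss_wt z)
         \<le> norm (2 * ((cmod (f z))\<^sup>2 * gauss_wt z) + 2 * ((cmod (g z))\<^sup>2 * gauss_wt z))"
      by (auto simp: norm_mult algebra_simps)
  qed
  then show ?thesis using f g by (simp add: fock_def entire_add)
qed

lemma fock_scale: assumes f: "f \<in> fock" shows "(\<lambda>w. c * f w) \<in> fock"
proof -
  have "integrable lborel (\<lambda>z. (cmod c)\<^sup>2 * ((cmod (f z))\<^sup>2 * gauss_wt z))"
    using f by (intro integrable_mult_right fock_integrable)
  moreover have "entire_fn (\<lambda>w. c * f w)" by (intro entire_mult entire_const fock_entire f)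
  ultimately show ?thesis by (simp add: fock_def norm_mult power_mult_distrib algebra_simps)
qed

lemma fock_zero: "(\<lambda>_. 0) \<in> fock"
  by (simp add: fock_def entire_const)

lemma fock_one: "(\<lambda>_. 1) \<in> fock"
  by (simp add: fock_def entire_const integrable_gauss_wt)

lemma fock_diff: "f \<in> fock \<Longrightarrow> g \<in> fock \<Longrightarrow> (\<lambda>w. f w - g w) \<in> fock"
  using fock_add[OF _ fock_scale[of g "-1"], of f] by simp

lemma fock_inner_add: "f \<in> fock \<Longrightarrow> g \<in> fock \<Longrightarrow> h \<in> fock \<Longrightarrow>
    fock_inner (\<lambda>w. f w + g w) h = fock_inner f h + fock_inner g h"
  unfolding fock_inner_def
  by (subst Bochner_Integration.integral_add[symmetric])
    (simp_all only: fock_inner_integrable distrib_right)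

lemma fock_inner_scale: "fock_inner (\<lambda>w. c * f w) h = c * fock_inner f h"
  unfolding fock_inner_def by (subst integral_mult_right_zero[symmetric]) (simp add: algebra_simps)

lemma fock_inner_commute: "fock_inner f g = cnj (fock_inner g f)"
proof -
  have "cnj (fock_inner g f) = (\<integral>z. cnj (g z * cnj (f z) * complex_of_real (gauss_wt z)) \<partial>lborel)"
    unfolding fock_inner_def by (rule Bochner_Integration.integral_cnj[symmetric])
  also have "\<dots> = fock_inner f g"
    unfolding fock_inner_def by (rule Bochner_Integration.integral_cong) (auto simp: mult.commute)
  finally show ?thesis by simp
qed

lemma fock_inner_self: "fock_inner f f = complex_of_real (integral\<^sup>L lborel (\<lambda>z. (cmod (f z))\<^sup>2 * gauss_wt z))"
proof -
  have "f z * cnj (f z) * complex_of_real (gauss_wt z) = complex_of_real ((cmod (f z))\<^sup>2 * gauss_wt z)" for z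
    using complex_norm_square[of "f z"] by simp
  then show ?thesis by (simp add: fock_inner_def del: of_real_mult)
qed

text \<open>Vanishing almost everywhere is upgraded to vanishing everywhere: the set where a
  continuous function is nonzero is open, and a nonempty open set is not negligible.\<close>

lemma fock_inner_definite:
  assumes f: "f \<in> fock" and 0: "Re (fock_inner f f) = 0"
  shows "f z = 0"
proof (rule ccontr)
  assume "f z \<noteq> 0"
  have "open {z. f z \<noteq> 0}"
    using entire_continuous[OF fock_entire[OF f]] by (intro open_Collect_neq) auto
  moreover have "AE z in lborel. (cmod (f z))\<^sup>2 * gauss_wt z = 0"
    using 0 integral_nonneg_eq_0_iff_AE[OF fock_integrable[OF f]] by (simp add: fock_inner_self)
  then have "AE z in lborel. f z = 0"
    by (simp add: gauss_wt_def)
  then have "{z. f z \<noteq> 0} \<in> null_sets lborel"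
    using fock_measurable[OF f] by (subst AE_iff_null_sets) auto
  then have "negligible {z. f z \<noteq> 0}"
    unfolding negligible_iff_null_sets by (rule null_sets_completionI)
  ultimately show False using open_not_negligible[of "{z. f z \<noteq> 0}"] \<open>f z \<noteq> 0\<close> by auto
qed

lemma circle_mean:
  assumes "g holomorphic_on UNIV"
  shows "((\<lambda>\<theta>. g (exp (2 * of_real pi * \<i> * of_real \<theta>))) has_integral g 0) {0..1::real}"
proof -
  have "((\<lambda>u. g u / (u - 0)) has_contour_integral (2 * of_real pi * \<i> * g 0)) (circlepath 0 1)"
    using assms by (intro Cauchy_integral_circlepath_simple) (auto intro: holomorphic_on_subset)
  then have "((\<lambda>x. (g (circlepath 0 1 x) / circlepath 0 1 x) * vector_derivative (circlepath 0 1) (at x within {0..1}))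
      has_integral (2 * of_real pi * \<i> * g 0)) {0..1}"
    by (simp add: has_contour_integral_def)
  then have "((\<lambda>x. (2 * of_real pi * \<i>) * g (exp (2 * of_real pi * \<i> * of_real x))) has_integral (2 * of_real pi * \<i> * g 0)) {0..1}"
    by (rule has_integral_eq[rotated]) (simp add: vector_derivative_circlepath01, simp add: circlepath)
  from has_integral_mult_right[OF this, of "1 / (2 * of_real pi * \<i>)"] show ?thesis by simp
qed

lemma gauss_wt_norm: "norm x = norm y \<Longrightarrow> gauss_wt x = gauss_wt y"
  by (simp add: gauss_wt_def)

text \<open>Lebesgue measure and the weight are invariant under multiplication by unimodular
  scalars. Averaging over these rotations with Fubini replaces \<open>f z\<close> by its mean over a
  circle in the complex line through \<open>z\<close>, which is \<open>f 0\<close> by Cauchy's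
  formula.\<close>

lemma fock_mean_value:
  assumes f: "f \<in> fock"
  shows "(\<integral>z. f z * complex_of_real (gauss_wt z) \<partial>lborel) = f 0"
proof -
  define e where "e = (\<lambda>\<theta>::real. exp (2 * of_real pi * \<i> * of_real \<theta>))"
  define G where "G = (\<lambda>z. f z * complex_of_real (gauss_wt z))"
  have ne: "cmod (e \<theta>) = 1" for \<theta> by (simp add: e_def)
  have e0: "e \<theta> \<noteq> 0" for \<theta> by (simp add: e_def)
  have iG: "integrable lborel G"
    using fock_inner_integrable[OF f fock_one] by (simp add: G_def)
  have contf: "continuous_on A f" for A by (intro entire_continuous fock_entire f)
  have mG: "G \<in> borel_measurable borel" using fock_measurable[OF f] unfolding G_def by measurable
  have rot: "(\<integral>z. h (e \<theta> *s z) \<partial>lborel) = (\<integral>z. h z \<partial>lborel)"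
     "integrable lborel (\<lambda>z. h (e \<theta> *s z)) \<longleftrightarrow> integrable lborel h"
    if "h \<in> borel_measurable borel" for h :: "'a fn" and \<theta>
    using that e0
    by (intro lborel_integral_isometry[where R'="\<lambda>z. inverse (e \<theta>) *s z"];
        simp add: bounded_linear.linear[OF bounded_linear_smult_right] norm_smult ne vector_smult_assoc)+
  have rot_real: "(\<integral>z. h (e \<theta> *s z) \<partial>lborel) = (\<integral>z. h z \<partial>lborel)"
    if "h \<in> borel_measurable borel" for h :: "complex ^ 'a \<Rightarrow> real" and \<theta>
    using that e0
    by (intro lborel_integral_isometry[where R'="\<lambda>z. inverse (e \<theta>) *s z"];
        simp add: bounded_linear.linear[OF bounded_linear_smult_right] norm_smult ne vector_smult_assoc)+
  have Ge: "G (e \<theta> *s z) = f (e \<theta> *s z) * complex_of_real (gauss_wt z)" for \<theta> z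
    using gauss_wt_norm[of "e \<theta> *s z" z] by (simp add: G_def norm_smult ne)
  define F where "F = (\<lambda>\<theta> z. indicator {0..1::real} \<theta> *\<^sub>R G (e \<theta> *s z))"
  have contG: "continuous_on UNIV G" unfolding G_def by (intro continuous_intros contf)
  have mF: "case_prod F \<in> borel_measurable (lborel \<Otimes>\<^sub>M lborel)"
  proof -
    have "(\<lambda>x. G (e (fst x) *s snd x)) \<in> borel_measurable borel"
      unfolding e_def by (intro borel_measurable_continuous_onI continuous_on_compose2[OF contG] continuous_intros) auto
    moreover have "indicat_real ({0..1::real} \<times> (UNIV :: (complex ^ 'a) set)) \<in> borel_measurable borel"
      by (intro borel_measurable_indicator borel_closed closed_Times) auto
    ultimately have "(\<lambda>x. indicat_real ({0..1::real} \<times> UNIV) x *\<^sub>R G (e (fst x) *s snd x)) \<in> borel_measurable borel"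
      by (intro borel_measurable_scaleR)
    moreover have "case_prod F = (\<lambda>x. indicat_real ({0..1::real} \<times> UNIV) x *\<^sub>R G (e (fst x) *s snd x))"
      by (auto simp: F_def fun_eq_iff indicator_def)
    ultimately show ?thesis by (simp add: lborel_prod)
  qed
  have iF: "integrable (lborel \<Otimes>\<^sub>M lborel) (case_prod F)"
  proof (rule lborel_pair.Fubini_integrable[OF mF])
    have "(\<integral>y. norm (F x y) \<partial>lborel) = indicator {0..1} x * (\<integral>z. norm (G z) \<partial>lborel)" for x
      using rot_real[of "\<lambda>z. norm (G z)" x] mG by (simp add: F_def)
    then show "integrable lborel (\<lambda>x. \<integral>y. norm (case (x, y) of (x, y) \<Rightarrow> F x y) \<partial>lborel)"
      by simp
    show "AE x in lborel. integrable lborel (\<lambda>y. case (x, y) of (x, y) \<Rightarrow> F x y)"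
      using rot(2)[OF mG] iG by (simp add: F_def)
  qed
  have F1: "(\<integral>z. F \<theta> z \<partial>lborel) = indicator {0..1} \<theta> *\<^sub>R (\<integral>z. G z \<partial>lborel)" for \<theta>
    using rot(1)[OF mG] by (simp add: F_def)
  have F2: "(\<integral>\<theta>. F \<theta> z \<partial>lborel) = f 0 * complex_of_real (gauss_wt z)" for z
  proof -
    have c: "continuous_on {0..1} (\<lambda>\<theta>. f (e \<theta> *s z))"
      unfolding e_def by (intro continuous_on_compose2[OF contf] continuous_intros) auto
    have "((\<lambda>\<theta>. f (0 + e \<theta> *s z)) has_integral f (0 + 0 *s z)) {0..1}"
      unfolding e_def by (rule circle_mean) (rule entire_holomorphic_line[OF fock_entire[OF f]])
    then have "(LINT \<theta>:{0..1}|lborel. f (e \<theta> *s z)) = f 0"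
      using c by (subst set_borel_integral_eq_integral(2)) (auto simp: borel_integrable_atLeastAtMost' integral_unique)
    moreover have "(\<integral>\<theta>. (indicator {0..1} \<theta> *\<^sub>R f (e \<theta> *s z)) * complex_of_real (gauss_wt z) \<partial>lborel)
       = (\<integral>\<theta>. indicator {0..1} \<theta> *\<^sub>R f (e \<theta> *s z) \<partial>lborel) * complex_of_real (gauss_wt z)"
      by (rule integral_mult_left_zero)
    ultimately have "(\<integral>\<theta>. (indicator {0..1} \<theta> *\<^sub>R f (e \<theta> *s z)) * complex_of_real (gauss_wt z) \<partial>lborel) = f 0 * complex_of_real (gauss_wt z)"
      by (simp only: set_lebesgue_integral_def)
    then show ?thesis by (simp add: F_def Ge)
  qed
  have "(\<integral>z. f 0 * complex_of_real (gauss_wt (z :: complex ^ 'a)) \<partial>lborel) = (\<integral>\<theta>. indicator {0..1::real} \<theta> *\<^sub>R (\<integral>z. G z \<partial>lborel) \<partial>lborel)"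
    using lborel_pair.Fubini_integral[OF iF] by (simp only: F1 F2)
  moreover have "(\<integral>z. f 0 * complex_of_real (gauss_wt (z :: complex ^ 'a)) \<partial>lborel) = f 0"
    by (simp add: integral_gauss_wt)
  moreover have "(\<integral>\<theta>. indicator {0..1::real} \<theta> *\<^sub>R (\<integral>z. G z \<partial>lborel) \<partial>lborel) = (\<integral>z. G z \<partial>lborel)"
    by simp
  ultimately show ?thesis by (simp add: G_def)
qed

section \<open>Weyl operators and the reproducing property\<close>

definition phase :: "complex ^ 'n::finite \<Rightarrow> complex ^ 'n \<Rightarrow> complex" where
  "phase z w = exp (of_real pi * (of_real (z \<bullet> w) - cdot w z))"

lemma norm_phase: "cmod (phase z w) = 1"
  by (simp add: phase_def Re_cdot inner_commute)

lemma phase_simps [simp]: "phase z (- z) = 1" "phase (- z) z = 1"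
  by (simp_all add: phase_def cdot_minus cdot_self power2_norm_eq_inner)

text \<open>The Weyl operators form a projective representation of the translations. The exponent of
  \<open>phase z w\<close> is \<open>- \<i> * pi * Im (cdot w z)\<close>, so the multiplier is
  unimodular.\<close>

lemma weyl_weyl: "weyl z (weyl w f) = (\<lambda>u. phase z w * weyl (z + w) f u)"
proof
  fix u
  have n: "(norm (z + w))\<^sup>2 = (norm z)\<^sup>2 + (norm w)\<^sup>2 + 2 * (z \<bullet> w)"
    by (simp add: power2_norm_eq_inner inner_add_left inner_add_right inner_commute)
  have "kern z u * kern w (u - z) = phase z w * kern (z + w) u"
    unfolding kern_def phase_def exp_add[symmetric] n
    by (rule arg_cong[where f=exp]) (simp add: cdot_add cdot_diff algebra_simps)
  then show "weyl z (weyl w f) u = phase z w * weyl (z + w) f u"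
    by (simp add: weyl_def algebra_simps)
qed

lemma weyl_0: "weyl 0 f = f"
  by (simp add: weyl_def kern_def cdot_def)

lemma weyl_one: "weyl z (\<lambda>_. 1) = kern z"
  by (simp add: weyl_def)

text \<open>Completing the square: \<open>kern z\<close> is exactly the factor that turns the
  Gaussian into its translate by \<open>z\<close>. This is why the Weyl operators are
  isometric.\<close>

lemma kern_sq_gauss: "kern z w * cnj (kern z w) * complex_of_real (gauss_wt w) = complex_of_real (gauss_wt (w - z))"
proof -
  have n: "(norm (w - z))\<^sup>2 = (norm w)\<^sup>2 + (norm z)\<^sup>2 - 2 * (z \<bullet> w)"
    by (simp add: power2_norm_eq_inner inner_diff_left inner_diff_right inner_commute)
  have r: "cdot z w + cdot w z = of_real (2 * (z \<bullet> w))"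
    using complex_add_cnj[of "cdot z w"] by (simp add: cdot_commute[of w z] Re_cdot)
  have "kern z w * cnj (kern z w) = exp (of_real pi * (cdot z w + cdot w z) - of_real (pi * (norm z)\<^sup>2))"
    unfolding kern_def exp_cnj exp_add[symmetric]
    by (rule arg_cong[where f=exp]) (simp add: cdot_commute[of w z] algebra_simps)
  also have "\<dots> = complex_of_real (exp (2 * pi * (z \<bullet> w) - pi * (norm z)\<^sup>2))"
    unfolding r exp_of_real[symmetric] by (simp add: algebra_simps)
  finally show ?thesis
    unfolding gauss_wt_def n of_real_mult[symmetric] exp_add[symmetric] by (simp flip: of_real_mult exp_add add: algebra_simps)
qed

lemma weyl_inner_integrand: "weyl z f w * cnj (weyl z g w) * complex_of_real (gauss_wt w)
    = (\<lambda>u. f u * cnj (g u) * complex_of_real (gauss_wt u)) (w - z)"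
proof -
  have "weyl z f w * cnj (weyl z g w) * complex_of_real (gauss_wt w)
     = f (w - z) * cnj (g (w - z)) * (kern z w * cnj (kern z w) * complex_of_real (gauss_wt w))"
    by (simp add: weyl_def)
  then show ?thesis by (simp add: kern_sq_gauss)
qed

lemma weyl_fock: assumes f: "f \<in> fock" shows "weyl z f \<in> fock"
proof -
  have "integrable lborel (\<lambda>w. complex_of_real ((cmod (f (w - z)))\<^sup>2 * gauss_wt (w - z)))"
    using f fock_measurable[OF f]
    by (intro integrable_of_real integrable_lborel_translate[of "\<lambda>w. (cmod (f w))\<^sup>2 * gauss_wt w"] fock_integrable) auto
  moreover have "complex_of_real ((cmod (weyl z f w))\<^sup>2 * gauss_wt w) = complex_of_real ((cmod (f (w - z)))\<^sup>2 * gauss_wt (w - z))" for w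
    using weyl_inner_integrand[of z f w f] unfolding of_real_mult complex_norm_square by simp
  ultimately have "integrable lborel (\<lambda>w. complex_of_real ((cmod (weyl z f w))\<^sup>2 * gauss_wt w))" by (simp del: of_real_mult)
  then have "integrable lborel (\<lambda>w. (cmod (weyl z f w))\<^sup>2 * gauss_wt w)"
    using complex_of_real_integrable_eq by blast
  moreover have "entire_fn (weyl z f)"
    unfolding weyl_def by (intro entire_mult entire_kern entire_translate fock_entire f)
  ultimately show ?thesis by (simp add: fock_def)
qed

lemma fock_inner_weyl: assumes "f \<in> fock" "g \<in> fock" shows "fock_inner (weyl z f) (weyl z g) = fock_inner f g"
  unfolding fock_inner_def weyl_inner_integrand
  by (rule integral_lborel_translate) (use assms fock_measurable in measurable)

lemma kern_fock: "kern z \<in> fock"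
  using weyl_fock[OF fock_one] by (simp add: weyl_one)

text \<open>The isometry \<open>weyl (- z)\<close> carries \<open>kern z\<close> to the constant 1,
  which reduces the claim to the mean value property at the origin.\<close>

lemma reproducing:
  assumes f: "f \<in> fock"
  shows "fock_inner f (kern z) = exp (- of_real (pi / 2 * (norm z)\<^sup>2)) * f z"
proof -
  have "fock_inner f (kern z) = fock_inner (weyl (- z) f) (weyl (- z) (kern z))"
    by (rule fock_inner_weyl[symmetric]) (simp_all add: f kern_fock)
  also have "weyl (- z) (kern z) = (\<lambda>_. 1)"
    unfolding weyl_one[symmetric] weyl_weyl by (simp add: weyl_0)
  also have "fock_inner (weyl (- z) f) (\<lambda>_. 1) = weyl (- z) f 0"
    using fock_mean_value[OF weyl_fock[OF f]] by (simp add: fock_inner_def)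
  also have "\<dots> = exp (- of_real (pi / 2 * (norm z)\<^sup>2)) * f z"
    by (simp add: weyl_def kern_def cdot_def)
  finally show ?thesis .
qed

section \<open>The Fock space as a Hilbert space\<close>

text \<open>Making the Fock space a type gives access to bounded linear maps, derivatives and
  integrals with values in a real Banach space. The complex structure is carried separately by
  \<open>cscale\<close> and \<open>cinner\<close>.\<close>

typedef (overloaded) ('n::finite) hfock = "fock :: 'n fn set"
  morphisms rep_hfock abs_hfock by (rule exI[of _ "\<lambda>_. 0"]) (rule fock_zero)

declare rep_hfock_inverse [simp]

lemma rep_hfock_fock [simp]: "rep_hfock x \<in> fock" by (rule rep_hfock)

lemma hfock_eqI: "(\<And>w. rep_hfock x w = rep_hfock y w) \<Longrightarrow> x = y"
  by (simp add: rep_hfock_inject[symmetric] ext)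

instantiation hfock :: (finite) real_vector
begin

definition zero_hfock_def: "0 = abs_hfock (\<lambda>_. 0)"
definition plus_hfock_def: "x + y = abs_hfock (\<lambda>w. rep_hfock x w + rep_hfock y w)"
definition minus_hfock_def: "x - y = abs_hfock (\<lambda>w. rep_hfock x w - rep_hfock y w)"
definition uminus_hfock_def: "- x = abs_hfock (\<lambda>w. (-1) * rep_hfock x w)"
definition scaleR_hfock_def: "r *\<^sub>R x = abs_hfock (\<lambda>w. of_real r * rep_hfock x w)"

lemma rep_hfock_simps [simp]:
  fixes x y :: "'a hfock"
  shows "rep_hfock (0 :: 'a hfock) = (\<lambda>_. 0)" "rep_hfock (x + y) = (\<lambda>w. rep_hfock x w + rep_hfock y w)" "rep_hfock (x - y) = (\<lambda>w. rep_hfock x w - rep_hfock y w)"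
    "rep_hfock (- x) = (\<lambda>w. - rep_hfock x w)" "rep_hfock (r *\<^sub>R x) = (\<lambda>w. of_real r * rep_hfock x w)"
  using fock_scale[OF rep_hfock_fock, of "-1" x]
  by (simp_all add: zero_hfock_def plus_hfock_def minus_hfock_def uminus_hfock_def scaleR_hfock_def
     abs_hfock_inverse fock_zero fock_add fock_diff fock_scale)

instance
  by standard (auto intro!: hfock_eqI simp: algebra_simps)

end

instantiation hfock :: (finite) real_inner
begin

definition inner_hfock_def: "inner x y = Re (fock_inner (rep_hfock x) (rep_hfock y))"
definition norm_hfock_def: "norm (x :: 'a hfock) = sqrt (inner x x)"
definition dist_hfock_def: "dist (x :: 'a hfock) y = norm (x - y)"
definition sgn_hfock_def: "sgn (x :: 'a hfock) = x /\<^sub>R norm x"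
definition uniformity_hfock_def:
  "(uniformity :: ('a hfock \<times> 'a hfock) filter) = (INF e\<in>{0<..}. principal {(x, y). dist x y < e})"
definition open_hfock_def:
  "open (U :: 'a hfock set) \<longleftrightarrow> (\<forall>x\<in>U. eventually (\<lambda>(x', y). x' = x \<longrightarrow> y \<in> U) uniformity)"

instance
proof
  fix x y z :: "'a hfock" and r s :: real and U :: "'a hfock set"
  show "dist x y = norm (x - y)" by (rule dist_hfock_def)
  show "sgn x = x /\<^sub>R norm x" by (rule sgn_hfock_def)
  show "inner x y = inner y x"
    using fock_inner_commute[of "rep_hfock x" "rep_hfock y"] by (simp add: inner_hfock_def)
  show "inner (x + y) z = inner x z + inner y z"
    by (simp add: inner_hfock_def fock_inner_add)
  show "inner (r *\<^sub>R x) y = r * inner x y"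
    by (simp add: inner_hfock_def fock_inner_scale)
  show "0 \<le> inner x x"
    by (simp add: inner_hfock_def fock_inner_self)
  show "inner x x = 0 \<longleftrightarrow> x = 0"
  proof
    assume "inner x x = 0"
    then show "x = 0" using fock_inner_definite[OF rep_hfock_fock, of x] by (intro hfock_eqI) (simp add: inner_hfock_def)
  qed (simp add: inner_hfock_def fock_inner_self)
  show "norm x = sqrt (inner x x)" by (rule norm_hfock_def)
  show "(uniformity :: ('a hfock \<times> 'a hfock) filter) = (INF e\<in>{0<..}. principal {(x, y). dist x y < e})"
    by (rule uniformity_hfock_def)
  show "open U \<longleftrightarrow> (\<forall>x\<in>U. eventually (\<lambda>(x', y). x' = x \<longrightarrow> y \<in> U) uniformity)"
    by (rule open_hfock_def)
qed

end

definition cinner :: "'n::finite hfock \<Rightarrow> 'n hfock \<Rightarrow> complex" where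
  "cinner x y = fock_inner (rep_hfock x) (rep_hfock y)"

definition cscale :: "complex \<Rightarrow> 'n::finite hfock \<Rightarrow> 'n hfock" where
  "cscale c x = abs_hfock (\<lambda>w. c * rep_hfock x w)"

lemma rep_hfock_cscale [simp]: "rep_hfock (cscale c x) = (\<lambda>w. c * rep_hfock x w)"
  by (simp add: cscale_def abs_hfock_inverse fock_scale)

lemma cscale_simps: "cscale c (x + y) = cscale c x + cscale c y" "cscale (c + d) x = cscale c x + cscale d x"
  "cscale c (cscale d x) = cscale (c * d) x" "cscale 1 x = x" "cscale (of_real r) x = r *\<^sub>R x" "cscale c (r *\<^sub>R x) = r *\<^sub>R cscale c x"
  "cscale (r *\<^sub>R c) x = r *\<^sub>R cscale c x" "cscale c (x - y) = cscale c x - cscale c y"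
  by (auto intro!: hfock_eqI simp: algebra_simps scaleR_conv_of_real)

lemma norm_hfock: "norm x = fock_norm (rep_hfock x)"
  by (simp add: norm_hfock_def inner_hfock_def fock_inner_self fock_norm_def)

lemma fock_norm_abs_hfock: "f \<in> fock \<Longrightarrow> fock_norm f = norm (abs_hfock f)"
  by (simp add: norm_hfock abs_hfock_inverse)

lemma Re_cinner: "Re (cinner x y) = inner x y"
  by (simp add: cinner_def inner_hfock_def)

lemma cinner_simps: "cinner (x + y) z = cinner x z + cinner y z" "cinner z (x + y) = cinner z x + cinner z y"
  "cinner (cscale c x) y = c * cinner x y" "cinner x (cscale c y) = cnj c * cinner x y"
proof -
  have *: "cinner y x = cnj (cinner x y)" for x y unfolding cinner_def by (rule fock_inner_commute)
  show 1: "cinner (x + y) z = cinner x z + cinner y z" for x y z by (simp add: cinner_def fock_inner_add)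
  show 2: "cinner (cscale c x) y = c * cinner x y" for x y by (simp add: cinner_def fock_inner_scale)
  show "cinner z (x + y) = cinner z x + cinner z y" using 1[of x y z] * by (metis complex_cnj_add complex_cnj_cnj)
  show "cinner x (cscale c y) = cnj c * cinner x y" using 2[of y x] * by (metis complex_cnj_mult)
qed

lemma cinner_scaleR: "cinner (r *\<^sub>R x) y = r *\<^sub>R cinner x y" "cinner x (r *\<^sub>R y) = r *\<^sub>R cinner x y"
  by (simp_all flip: cscale_simps(5) add: cinner_simps scaleR_conv_of_real)

lemma cinner_commute: "cinner y x = cnj (cinner x y)"
  unfolding cinner_def by (rule fock_inner_commute)

lemma norm_cscale: "norm (cscale c x) = cmod c * norm x"
  unfolding norm_hfock fock_norm_def
  by (simp add: norm_mult power_mult_distrib mult.assoc real_sqrt_mult)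

text \<open>Multiplying \<open>x\<close> by a unimodular scalar makes \<open>cinner x y\<close> real
  and nonnegative, and the real Cauchy-Schwarz inequality applies.\<close>

lemma norm_cinner_le: "cmod (cinner x y) \<le> norm x * norm y"
proof (cases "cinner x y = 0")
  case False
  define c where "c = cnj (cinner x y) / of_real (cmod (cinner x y))"
  have c: "cmod c = 1" using False by (simp add: c_def norm_divide)
  have "cinner (cscale c x) y = of_real (cmod (cinner x y))"
    using False complex_norm_square[of "cinner x y"]
    by (simp add: cinner_simps c_def field_simps power2_eq_square)
  then have "cmod (cinner x y) = inner (cscale c x) y" by (metis Re_cinner Re_complex_of_real)
  also have "\<dots> \<le> norm (cscale c x) * norm y" by (rule norm_cauchy_schwarz)
  finally show ?thesis by (simp add: norm_cscale c)
qed simp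

lemma bounded_bilinear_cinner: "bounded_bilinear cinner"
  by standard (auto simp: cinner_simps cinner_scaleR intro!: exI[of _ 1] norm_cinner_le)

lemma bounded_linear_cscale: "bounded_linear (cscale c)"
  by (rule bounded_linear_intro[where K="cmod c"]) (auto simp: cscale_simps norm_cscale)

lemma bounded_linear_cscale_left: "bounded_linear (\<lambda>c. cscale c x)"
  by (rule bounded_linear_intro[where K="norm x"]) (auto simp: cscale_simps norm_cscale)

definition kern_vec :: "complex ^ 'n::finite \<Rightarrow> 'n hfock" where "kern_vec z = abs_hfock (kern z)"

lemma rep_hfock_kern_vec [simp]: "rep_hfock (kern_vec z) = kern z"
  by (simp add: kern_vec_def abs_hfock_inverse kern_fock)

lemma cinner_kern_vec: "cinner x (kern_vec z) = exp (- of_real (pi / 2 * (norm z)\<^sup>2)) * rep_hfock x z"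
  by (simp add: cinner_def reproducing)

lemma norm_kern_vec: "norm (kern_vec z) = 1"
proof -
  have "fock_inner (kern z) (kern z) = fock_inner (\<lambda>_ :: complex ^ 'a. 1) (\<lambda>_. 1)"
    using fock_inner_weyl[OF fock_one fock_one, of z] by (simp add: weyl_one)
  also have "\<dots> = 1" using fock_mean_value[OF fock_one] by (simp add: fock_inner_def)
  finally show ?thesis by (simp add: norm_hfock_def inner_hfock_def)
qed

text \<open>Point evaluations are bounded, locally uniformly in \<open>z\<close>, because they are
  inner products with scaled unit kernels. Norm convergence therefore controls pointwise
  values.\<close>

lemma eval_bound: "cmod (rep_hfock x z) \<le> exp (pi / 2 * (norm z)\<^sup>2) * norm x"
proof -
  have "exp (- (pi / 2 * (norm z)\<^sup>2)) * cmod (rep_hfock x z) = cmod (cinner x (kern_vec z))"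
    by (simp add: cinner_kern_vec norm_mult)
  also have "\<dots> \<le> norm x * 1" using norm_cinner_le[of x "kern_vec z"] by (simp add: norm_kern_vec)
  finally show ?thesis by (simp add: exp_minus field_simps)
qed

lemma nn_norm: "(\<integral>\<^sup>+w. ennreal ((cmod (rep_hfock x w))\<^sup>2 * gauss_wt w) \<partial>lborel) = ennreal ((norm x)\<^sup>2)"
proof -
  have "(\<integral>\<^sup>+w. ennreal ((cmod (rep_hfock x w))\<^sup>2 * gauss_wt w) \<partial>lborel) = ennreal (\<integral>w. (cmod (rep_hfock x w))\<^sup>2 * gauss_wt w \<partial>lborel)"
    by (intro nn_integral_eq_integral fock_integrable) auto
  also have "(\<integral>w. (cmod (rep_hfock x w))\<^sup>2 * gauss_wt w \<partial>lborel) = (norm x)\<^sup>2"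
    by (simp add: norm_hfock fock_norm_def)
  finally show ?thesis .
qed

text \<open>The limit \<open>h\<close> is a bare function here: this bound is what later shows that
  a pointwise limit is square integrable.\<close>

lemma fatou_hfock:
  assumes lim: "\<And>w. (\<lambda>m. rep_hfock (x m) w) \<longlonglongrightarrow> h w" and b: "\<forall>\<^sub>F m in sequentially. norm (x m) \<le> c"
  shows "(\<integral>\<^sup>+w. ennreal ((cmod (h w))\<^sup>2 * gauss_wt w) \<partial>lborel) \<le> ennreal (c\<^sup>2)"
proof -
  have m: "(\<lambda>w. ennreal ((cmod (rep_hfock (x m) w))\<^sup>2 * gauss_wt w)) \<in> borel_measurable lborel" for m
    using fock_measurable[OF rep_hfock_fock, of "x m"] by measurable
  have "ennreal ((cmod (h w))\<^sup>2 * gauss_wt w) = liminf (\<lambda>m. ennreal ((cmod (rep_hfock (x m) w))\<^sup>2 * gauss_wt w))" for w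
    by (intro lim_imp_Liminf[symmetric] tendsto_ennrealI tendsto_intros lim) auto
  then have "(\<integral>\<^sup>+w. ennreal ((cmod (h w))\<^sup>2 * gauss_wt w) \<partial>lborel)
      \<le> liminf (\<lambda>m. \<integral>\<^sup>+w. ennreal ((cmod (rep_hfock (x m) w))\<^sup>2 * gauss_wt w) \<partial>lborel)"
    using nn_integral_liminf[of "\<lambda>m w. ennreal ((cmod (rep_hfock (x m) w))\<^sup>2 * gauss_wt w)", OF m] by simp
  also have "\<dots> \<le> ennreal (c\<^sup>2)"
    unfolding nn_norm
    by (intro Liminf_le eventually_mono[OF b]) (auto intro!: ennreal_leI power_mono)
  finally show ?thesis .
qed

lemma norm_le_of_pointwise_limit:
  assumes "\<And>w. (\<lambda>m. rep_hfock (x m) w) \<longlonglongrightarrow> rep_hfock y w" and "\<forall>\<^sub>F m in sequentially. norm (x m) \<le> c"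
  shows "norm y \<le> c"
proof -
  have "ennreal ((norm y)\<^sup>2) \<le> ennreal (c\<^sup>2)"
    using fatou_hfock[OF assms] by (simp add: nn_norm)
  then have "(norm y)\<^sup>2 \<le> c\<^sup>2" by (simp add: ennreal_le_iff)
  moreover have "0 \<le> c" using assms(2) eventually_happens'[OF sequentially_bot assms(2)] norm_ge_zero order_trans by blast
  ultimately show ?thesis by (rule power2_le_imp_le)
qed

text \<open>By Fatou, \<open>norm (x n + y)\<close> is asymptotically at least \<open>2 * norm y\<close>; the parallelogram law then forces
  \<open>norm (x n - y)\<close> to vanish.\<close>

lemma tendsto_of_pointwise:
  assumes lim: "\<And>w. (\<lambda>n. rep_hfock (x n) w) \<longlonglongrightarrow> rep_hfock y w" and norm: "\<And>n. norm (x n) = norm y"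
  shows "x \<longlonglongrightarrow> y"
proof (rule ccontr)
  assume "\<not> x \<longlonglongrightarrow> y"
  then obtain e where e: "e > 0" "\<not> (\<forall>\<^sub>F n in sequentially. dist (x n) y < e)"
    unfolding tendsto_iff by auto
  then have "infinite {n. dist (x n) y \<ge> e}"
    unfolding not_eventually not_less frequently_cofinite[symmetric] cofinite_eq_sequentially[symmetric] by simp
  then obtain r :: "nat \<Rightarrow> nat" where r: "strict_mono r" "\<And>n. e \<le> dist (x (r n)) y"
    using infinite_enumerate by (metis mem_Collect_eq)
  have par: "(norm (x n + y))\<^sup>2 = 4 * (norm y)\<^sup>2 - (dist (x n) y)\<^sup>2" for n
  proof -
    have "inner (x n) (x n) = inner y y" using norm[of n] by (metis power2_norm_eq_inner)
    then show ?thesis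
      by (simp add: dist_norm power2_norm_eq_inner inner_add_left inner_add_right inner_diff_left inner_diff_right inner_commute)
  qed
  have "e\<^sup>2 \<le> (dist (x (r n)) y)\<^sup>2" for n using r(2)[of n] e(1) by (intro power_mono) auto
  then have le: "(norm (x (r n) + y))\<^sup>2 \<le> 4 * (norm y)\<^sup>2 - e\<^sup>2" for n unfolding par by (metis diff_left_mono)
  define c where "c = sqrt (4 * (norm y)\<^sup>2 - e\<^sup>2)"
  have nn: "0 \<le> 4 * (norm y)\<^sup>2 - e\<^sup>2" using le[of 0] by (meson order_trans zero_le_power2)
  have "norm (x (r n) + y) \<le> c" for n unfolding c_def using le[of n] by (rule real_le_rsqrt)
  moreover have "(\<lambda>n. rep_hfock (x (r n) + y) w) \<longlonglongrightarrow> rep_hfock (y + y) w" for w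
    using tendsto_add[OF LIMSEQ_subseq_LIMSEQ[OF lim[of w] r(1)] tendsto_const[of "rep_hfock y w"]] by (simp add: comp_def)
  ultimately have "norm (y + y) \<le> c" by (intro norm_le_of_pointwise_limit[of "\<lambda>n. x (r n) + y"]) auto
  then have "2 * norm y \<le> c" by (simp flip: scaleR_2)
  then have "(2 * norm y)\<^sup>2 \<le> c\<^sup>2" by (intro power_mono) auto
  then show False using e(1) nn by (simp add: c_def power_mult_distrib)
qed

section \<open>Completeness of the Fock space\<close>

definition deriv_hfock :: "'n::finite hfock \<Rightarrow> complex ^ 'n \<Rightarrow> complex ^ 'n \<Rightarrow> complex" where
  "deriv_hfock x z = (SOME L. (rep_hfock x has_derivative L) (at z) \<and> (\<forall>c v. L (c *s v) = c * L v))"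

lemma deriv_hfock: "(rep_hfock x has_derivative deriv_hfock x z) (at z)" "deriv_hfock x z (c *s v) = c * deriv_hfock x z v"
proof -
  have "\<exists>L. (rep_hfock x has_derivative L) (at z) \<and> (\<forall>c v. L (c *s v) = c * L v)"
    using fock_entire[OF rep_hfock_fock, of x] unfolding entire_fn_iff by blast
  from someI_ex[OF this] show "(rep_hfock x has_derivative deriv_hfock x z) (at z)" "deriv_hfock x z (c *s v) = c * deriv_hfock x z v"
    unfolding deriv_hfock_def by blast+
qed

lemma deriv_hfock_diff: "deriv_hfock (x - y) z h = deriv_hfock x z h - deriv_hfock y z h"
proof -
  have "((\<lambda>w. rep_hfock x w - rep_hfock y w) has_derivative (\<lambda>h. deriv_hfock x z h - deriv_hfock y z h)) (at z)"
    by (intro has_derivative_diff deriv_hfock)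
  then have "deriv_hfock (x - y) z = (\<lambda>h. deriv_hfock x z h - deriv_hfock y z h)"
    using deriv_hfock(1)[of "x - y" z] by (simp add: has_derivative_unique)
  then show ?thesis by simp
qed

text \<open>Cauchy's inequality on the unit circle of the complex line through \<open>z\<close> in
  direction \<open>h\<close>; all points of this circle have norm at most \<open>norm z + 1\<close>,
  where \<open>eval_bound\<close> applies.\<close>

lemma deriv_hfock_bound: "cmod (deriv_hfock x z h) \<le> exp (pi / 2 * (norm z + 1)\<^sup>2) * norm x * norm h"
proof (cases "h = 0")
  case True
  then show ?thesis using deriv_hfock(2)[of x z 0 0] by simp
next
  case False
  define v where "v = (1 / norm h) *\<^sub>R h"
  have v: "norm v = 1" using False by (simp add: v_def)
  define g where "g = (\<lambda>\<zeta>. rep_hfock x (z + \<zeta> *s v))"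
  have hol: "g holomorphic_on A" for A unfolding g_def by (rule entire_holomorphic_line[OF fock_entire[OF rep_hfock_fock]])
  have "cmod ((deriv ^^ 1) g 0) \<le> fact 1 * (exp (pi / 2 * (norm z + 1)\<^sup>2) * norm x) / 1 ^ 1"
  proof (rule Cauchy_inequality)
    fix \<zeta> :: complex assume "norm (0 - \<zeta>) = 1"
    then have "norm (z + \<zeta> *s v) \<le> norm z + 1"
      using norm_triangle_ineq[of z "\<zeta> *s v"] by (simp add: norm_smult v)
    then have "exp (pi / 2 * (norm (z + \<zeta> *s v))\<^sup>2) \<le> exp (pi / 2 * (norm z + 1)\<^sup>2)"
      by (simp add: power_mono)
    then show "cmod (g \<zeta>) \<le> exp (pi / 2 * (norm z + 1)\<^sup>2) * norm x"
      unfolding g_def using eval_bound[of x "z + \<zeta> *s v"] by (meson mult_right_mono norm_ge_zero order_trans)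
  qed (auto simp: hol holomorphic_on_imp_continuous_on)
  moreover have "deriv g 0 = deriv_hfock x z v"
    unfolding g_def using deriv_hfock[of x "z + 0 *s v"] deriv_hfock(2)[of x z]
    by (intro DERIV_imp_deriv entire_on_line[of "rep_hfock x" "deriv_hfock x z" z 0 v]) auto
  ultimately have "cmod (deriv_hfock x z v) \<le> exp (pi / 2 * (norm z + 1)\<^sup>2) * norm x" by simp
  moreover have "deriv_hfock x z h = of_real (norm h) * deriv_hfock x z v"
  proof -
    have "h = of_real (norm h) *s v" using False unfolding v_def vec_eq_iff
      by (auto simp: scaleR_conv_of_real[where 'a=complex])
    then show ?thesis using deriv_hfock(2)[of x z "of_real (norm h)" v] by simp
  qed
  ultimately show ?thesis by (simp add: norm_mult mult.commute mult_left_mono)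
qed

text \<open>By \<open>deriv_hfock_bound\<close> the derivatives of a Cauchy sequence converge
  uniformly on unit balls, so the limit may be differentiated termwise. Complex linearity of the
  derivative survives the pointwise limit.\<close>

lemma entire_limit:
  assumes X: "Cauchy X" and lim: "\<And>w. (\<lambda>n. rep_hfock (X n) w) \<longlonglongrightarrow> F w"
  shows "entire_fn F"
  unfolding entire_fn_iff
proof
  fix z0 :: "complex ^ 'a"
  define S where "S = ball z0 1"
  \<comment> \<open>The radius is \<open>norm z0\<close> plus 1 for the ball \<open>S\<close> and
    another 1 for the circle in Cauchy's inequality.\<close>
  define C where "C = exp (pi / 2 * (norm z0 + 2)\<^sup>2)"
  have Cpos: "C > 0" by (simp add: C_def)
  have bd: "cmod (deriv_hfock x z h) \<le> C * norm x * norm h" if "z \<in> S" for x z h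
  proof -
    have "norm z \<le> norm z0 + 1" using that norm_triangle_sub[of z z0]
      by (auto simp: S_def dist_norm norm_minus_commute)
    then have "exp (pi / 2 * (norm z + 1)\<^sup>2) \<le> C" unfolding C_def by (simp add: power_mono)
    then have "exp (pi / 2 * (norm z + 1)\<^sup>2) * norm x * norm h \<le> C * norm x * norm h"
      by (intro mult_right_mono) auto
    then show ?thesis using deriv_hfock_bound order_trans by blast
  qed
  have cau: "cmod (deriv_hfock (X n) z h - deriv_hfock (X m) z h) \<le> C * dist (X n) (X m) * norm h" if "z \<in> S" for n m z h
    using bd[OF that, of "X n - X m" h] by (simp add: deriv_hfock_diff dist_norm)
  define g' where "g' = (\<lambda>z h. lim (\<lambda>n. deriv_hfock (X n) z h))"
  have g': "(\<lambda>n. deriv_hfock (X n) z h) \<longlonglongrightarrow> g' z h" if z: "z \<in> S" for z h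
  proof -
    have "Cauchy (\<lambda>n. deriv_hfock (X n) z h)"
    proof (rule metric_CauchyI)
      fix e :: real assume "e > 0"
      then obtain M where M: "\<And>m n. m \<ge> M \<Longrightarrow> n \<ge> M \<Longrightarrow> dist (X m) (X n) < e / (C * norm h + 1)"
        using X[unfolded Cauchy_def] Cpos
        by (metis add_nonneg_pos divide_pos_pos less_imp_le mult_nonneg_nonneg norm_ge_zero zero_less_one)
      have "dist (deriv_hfock (X m) z h) (deriv_hfock (X n) z h) < e" if mn: "m \<ge> M" "n \<ge> M" for m n
      proof -
        have p: "0 < C * norm h + 1" using Cpos by (simp add: add_nonneg_pos)
        have "dist (deriv_hfock (X m) z h) (deriv_hfock (X n) z h) \<le> (C * norm h) * dist (X m) (X n)"
          using cau[OF z, of m h n] by (simp add: dist_norm[of "deriv_hfock _ _ _"] algebra_simps)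
        also have "\<dots> \<le> (C * norm h + 1) * dist (X m) (X n)" by (intro mult_right_mono) auto
        also have "\<dots> < e" using M[OF mn] p by (simp add: pos_less_divide_eq mult.commute)
        finally show ?thesis .
      qed
      then show "\<exists>M. \<forall>m\<ge>M. \<forall>n\<ge>M. dist (deriv_hfock (X m) z h) (deriv_hfock (X n) z h) < e" by blast
    qed
    then show ?thesis unfolding g'_def by (metis Cauchy_convergent convergent_LIMSEQ_iff)
  qed
  have "\<exists>g. \<forall>z\<in>S. (\<lambda>n. rep_hfock (X n) z) \<longlonglongrightarrow> g z \<and> (g has_derivative g' z) (at z within S)"
  proof (rule has_derivative_sequence)
    show "convex S" "z0 \<in> S" by (auto simp: S_def)
    show "(rep_hfock (X n) has_derivative deriv_hfock (X n) z) (at z within S)" for n z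
      by (rule has_derivative_at_withinI[OF deriv_hfock(1)])
    show "(\<lambda>n. rep_hfock (X n) z0) \<longlonglongrightarrow> F z0" by (rule lim)
    fix e :: real assume e: "e > 0"
    then obtain M where M: "\<And>m n. m \<ge> M \<Longrightarrow> n \<ge> M \<Longrightarrow> dist (X m) (X n) < e / C"
      using X[unfolded Cauchy_def] Cpos by (metis divide_pos_pos)
    have "cmod (deriv_hfock (X n) z h - g' z h) \<le> e * norm h" if n: "n \<ge> M" and z: "z \<in> S" for n z h
    proof (rule tendsto_upperbound)
      show "(\<lambda>m. cmod (deriv_hfock (X n) z h - deriv_hfock (X m) z h)) \<longlonglongrightarrow> cmod (deriv_hfock (X n) z h - g' z h)"
        by (intro tendsto_intros g' z)
      show "\<forall>\<^sub>F m in sequentially. cmod (deriv_hfock (X n) z h - deriv_hfock (X m) z h) \<le> e * norm h"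
        using eventually_ge_at_top[of M]
      proof eventually_elim
        fix m assume "m \<ge> M"
        then have "C * dist (X n) (X m) \<le> e" using M[OF n] Cpos by (simp add: field_simps less_imp_le)
        then show "cmod (deriv_hfock (X n) z h - deriv_hfock (X m) z h) \<le> e * norm h"
          using cau[OF z, of n h m] by (meson mult_right_mono norm_ge_zero order_trans)
      qed
    qed simp
    then show "\<forall>\<^sub>F n in sequentially. \<forall>z\<in>S. \<forall>h. cmod (deriv_hfock (X n) z h - g' z h) \<le> e * norm h"
      by (auto simp: eventually_at_top_linorder)
  qed
  then obtain g where g: "\<And>z. z \<in> S \<Longrightarrow> (\<lambda>n. rep_hfock (X n) z) \<longlonglongrightarrow> g z" "\<And>z. z \<in> S \<Longrightarrow> (g has_derivative g' z) (at z within S)"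
    by blast
  have gF: "g z = F z" if "z \<in> S" for z using g(1)[OF that] lim LIMSEQ_unique by blast
  have z0: "z0 \<in> S" "open S" by (auto simp: S_def)
  have "(g has_derivative g' z0) (at z0)"
    using g(2)[OF z0(1)] unfolding at_within_open[OF z0] .
  then have "(F has_derivative g' z0) (at z0)"
    by (rule has_derivative_transform_within_open[OF _ z0(2,1)]) (rule gF)
  moreover have "g' z0 (c *s v) = c * g' z0 v" for c v
  proof -
    have "(\<lambda>n. deriv_hfock (X n) z0 (c *s v)) \<longlonglongrightarrow> c * g' z0 v"
      unfolding deriv_hfock(2) by (intro tendsto_intros g' z0)
    then show ?thesis using g'[OF z0(1)] LIMSEQ_unique by blast
  qed
  ultimately show "\<exists>L. (F has_derivative L) (at z0) \<and> (\<forall>c v. L (c *s v) = c * L v)" by blast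
qed

text \<open>A Cauchy sequence converges pointwise to an entire function \<open>F\<close>. Fatou
  applied to \<open>X n - X m\<close> as \<open>m\<close> grows bounds the norm of
  \<open>X n - F\<close>, which gives both membership of \<open>F\<close> in \<open>fock\<close> and
  convergence in norm.\<close>

instance hfock :: (finite) banach
proof
  fix X :: "nat \<Rightarrow> 'a hfock"
  assume X: "Cauchy X"
  have conv: "convergent (\<lambda>n. rep_hfock (X n) w)" for w
  proof -
    have "Cauchy (\<lambda>n. rep_hfock (X n) w)"
    proof (rule metric_CauchyI)
      fix e :: real assume "e > 0"
      define C where "C = exp (pi / 2 * (norm w)\<^sup>2)"
      have "C > 0" by (simp add: C_def)
      with \<open>e > 0\<close> obtain M where M: "\<And>m n. m \<ge> M \<Longrightarrow> n \<ge> M \<Longrightarrow> dist (X m) (X n) < e / C"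
        using X[unfolded Cauchy_def] by (metis divide_pos_pos)
      have "dist (rep_hfock (X m) w) (rep_hfock (X n) w) < e" if "m \<ge> M" "n \<ge> M" for m n
      proof -
        have "dist (rep_hfock (X m) w) (rep_hfock (X n) w) \<le> C * dist (X m) (X n)"
          using eval_bound[of "X m - X n" w] by (simp add: dist_norm C_def)
        also have "\<dots> < e" using M[OF that] \<open>C > 0\<close> by (simp add: pos_less_divide_eq mult.commute)
        finally show ?thesis .
      qed
      then show "\<exists>M. \<forall>m\<ge>M. \<forall>n\<ge>M. dist (rep_hfock (X m) w) (rep_hfock (X n) w) < e" by blast
    qed
    then show ?thesis by (simp add: Cauchy_convergent)
  qed
  define F where "F = (\<lambda>w. lim (\<lambda>n. rep_hfock (X n) w))"
  have F: "(\<lambda>n. rep_hfock (X n) w) \<longlonglongrightarrow> F w" for w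
    using conv[of w] by (simp add: F_def convergent_LIMSEQ_iff)
  have eF: "entire_fn F" using X F by (rule entire_limit)
  have tail: "(\<integral>\<^sup>+w. ennreal ((cmod (rep_hfock (X n) w - F w))\<^sup>2 * gauss_wt w) \<partial>lborel) \<le> ennreal (e\<^sup>2)"
    if "\<And>m. m \<ge> M \<Longrightarrow> dist (X n) (X m) < e" for n M e
  proof (rule fatou_hfock[of "\<lambda>m. X n - X m"])
    show "(\<lambda>m. rep_hfock (X n - X m) w) \<longlonglongrightarrow> rep_hfock (X n) w - F w" for w
      unfolding rep_hfock_simps by (rule tendsto_diff[OF tendsto_const F])
    show "\<forall>\<^sub>F m in sequentially. norm (X n - X m) \<le> e"
      by (rule eventually_sequentiallyI[of M]) (use that in \<open>simp add: dist_norm less_imp_le\<close>)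
  qed
  have in_fock: "(\<lambda>w. rep_hfock (X n) w - F w) \<in> fock" if "\<And>m. m \<ge> M \<Longrightarrow> dist (X n) (X m) < e" for n M e
  proof -
    have ent: "entire_fn (\<lambda>w. rep_hfock (X n) w - F w)"
      using entire_add[OF fock_entire[OF rep_hfock_fock] entire_mult[OF entire_const eF], of "X n" "-1"] by simp
    have "integrable lborel (\<lambda>w. (cmod (rep_hfock (X n) w - F w))\<^sup>2 * gauss_wt w)"
    proof (rule integrableI_nonneg)
      show "(\<lambda>w. (cmod (rep_hfock (X n) w - F w))\<^sup>2 * gauss_wt w) \<in> borel_measurable lborel"
        using entire_measurable[OF ent] by measurable
      show "(\<integral>\<^sup>+w. ennreal ((cmod (rep_hfock (X n) w - F w))\<^sup>2 * gauss_wt w) \<partial>lborel) < \<infinity>"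
        by (rule le_less_trans[OF tail[of M n e]]) (use that in auto)
    qed simp
    with ent show ?thesis by (simp add: fock_def)
  qed
  have "\<exists>M. \<forall>n\<ge>M. \<forall>m\<ge>M. dist (X n) (X m) < 1" using X unfolding Cauchy_def by (meson zero_less_one)
  then obtain N where N: "\<And>n m. n \<ge> N \<Longrightarrow> m \<ge> N \<Longrightarrow> dist (X n) (X m) < 1" by blast
  have Ff: "F \<in> fock"
    using fock_diff[OF rep_hfock_fock in_fock[of N N 1], of "X N"] N by simp
  have "X \<longlonglongrightarrow> abs_hfock F"
  proof (rule metric_LIMSEQ_I)
    fix r :: real assume r: "r > 0"
    then obtain M where M: "\<And>n m. n \<ge> M \<Longrightarrow> m \<ge> M \<Longrightarrow> dist (X n) (X m) < r / 2"
      using X unfolding Cauchy_def by (meson half_gt_zero)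
    have "dist (X n) (abs_hfock F) < r" if "n \<ge> M" for n
    proof -
      have "ennreal ((norm (X n - abs_hfock F))\<^sup>2) \<le> ennreal ((r / 2)\<^sup>2)"
        using tail[of M n "r / 2"] M[OF that] by (subst nn_norm[symmetric]) (simp add: abs_hfock_inverse Ff)
      then have "(norm (X n - abs_hfock F))\<^sup>2 \<le> (r / 2)\<^sup>2" by (subst (asm) ennreal_le_iff) auto
      then have "norm (X n - abs_hfock F) \<le> r / 2" by (rule power2_le_imp_le) (use r in simp)
      then show ?thesis using r by (simp add: dist_norm)
    qed
    then show "\<exists>no. \<forall>n\<ge>no. dist (X n) (abs_hfock F) < r" by blast
  qed
  then show "convergent X" by (auto simp: convergent_def)
qed

section \<open>Conjugation by Weyl operators\<close>

definition weyl_op :: "complex ^ 'n::finite \<Rightarrow> 'n hfock \<Rightarrow> 'n hfock" where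
  "weyl_op z x = abs_hfock (weyl z (rep_hfock x))"

lemma rep_hfock_weyl_op: "rep_hfock (weyl_op z x) = weyl z (rep_hfock x)"
  by (simp add: weyl_op_def abs_hfock_inverse weyl_fock)

lemma cinner_weyl_op: "cinner (weyl_op z x) (weyl_op z y) = cinner x y"
  by (simp add: cinner_def rep_hfock_weyl_op fock_inner_weyl)

lemma norm_weyl_op [simp]: "norm (weyl_op z x) = norm x"
  unfolding norm_eq_sqrt_inner Re_cinner[symmetric] cinner_weyl_op ..

lemma weyl_op_add: "weyl_op z (x + y) = weyl_op z x + weyl_op z y"
  by (rule hfock_eqI) (simp add: rep_hfock_weyl_op weyl_def algebra_simps)

lemma weyl_op_diff: "weyl_op z (x - y) = weyl_op z x - weyl_op z y"
  by (rule hfock_eqI) (simp add: rep_hfock_weyl_op weyl_def algebra_simps)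

lemma weyl_op_cscale: "weyl_op z (cscale c x) = cscale c (weyl_op z x)"
  by (rule hfock_eqI) (simp add: rep_hfock_weyl_op weyl_def algebra_simps)

lemma bounded_linear_weyl_op: "bounded_linear (weyl_op z)"
  by (rule bounded_linear_intro[where K=1]) (simp_all add: weyl_op_add weyl_op_cscale flip: cscale_simps(5))

lemma weyl_op_weyl_op: "weyl_op z (weyl_op w x) = cscale (phase z w) (weyl_op (z + w) x)"
  by (rule hfock_eqI) (simp add: rep_hfock_weyl_op weyl_weyl)

lemma weyl_op_0 [simp]: "weyl_op 0 x = x"
  by (rule hfock_eqI) (simp add: rep_hfock_weyl_op weyl_0)

lemma weyl_op_inverse [simp]: "weyl_op z (weyl_op (- z) x) = x" "weyl_op (- z) (weyl_op z x) = x"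
  by (simp_all add: weyl_op_weyl_op cscale_simps)

lemma cinner_weyl_op_adjoint: "cinner (weyl_op z x) y = cinner x (weyl_op (- z) y)"
  using cinner_weyl_op[of z x "weyl_op (- z) y"] by simp

lemma kern_vec_eq_weyl_op: "kern_vec z = weyl_op z (kern_vec 0)"
  by (rule hfock_eqI) (simp add: rep_hfock_weyl_op weyl_def kern_def cdot_def)

lemma continuous_kern: "continuous_on S f \<Longrightarrow> continuous_on S (\<lambda>t. kern (f t) w)"
  unfolding kern_def by (intro continuous_intros)

text \<open>Strong continuity: the values at each point depend continuously on \<open>z\<close> and
  the norms are constant, so \<open>tendsto_of_pointwise\<close> gives convergence in norm.\<close>

lemma continuous_weyl_op_left: "continuous_on UNIV (\<lambda>z. weyl_op z x)"
proof (rule continuous_on_sequentiallyI)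
  fix u :: "nat \<Rightarrow> complex ^ 'a" and a assume u: "u \<longlonglongrightarrow> a"
  have "(\<lambda>n. rep_hfock (weyl_op (u n) x) w) \<longlonglongrightarrow> rep_hfock (weyl_op a x) w" for w
  proof -
    have "continuous_on UNIV (\<lambda>z. rep_hfock x (w - z))"
      by (rule continuous_on_compose2[OF entire_continuous[OF fock_entire[OF rep_hfock_fock, of x], of UNIV]])
        (simp_all add: continuous_on_diff continuous_on_const continuous_on_id)
    then have "continuous_on UNIV (\<lambda>z. kern z w * rep_hfock x (w - z))"
      by (rule continuous_on_mult[OF continuous_kern[OF continuous_on_id]])
    then have "isCont (\<lambda>z. kern z w * rep_hfock x (w - z)) a" by (simp add: continuous_on_eq_continuous_at)
    then show ?thesis unfolding rep_hfock_weyl_op weyl_def by (rule isCont_tendsto_compose) (rule u)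
  qed
  then show "(\<lambda>n. weyl_op (u n) x) \<longlonglongrightarrow> weyl_op a x" by (rule tendsto_of_pointwise) simp
qed

lemma tendsto_weyl_op:
  assumes f: "(f \<longlongrightarrow> z) F" and g: "(g \<longlongrightarrow> x) F"
  shows "((\<lambda>t. weyl_op (f t) (g t)) \<longlongrightarrow> weyl_op z x) F"
proof -
  have "isCont (\<lambda>z. weyl_op z x) z" using continuous_weyl_op_left[of x] by (simp add: continuous_on_eq_continuous_at)
  then have 1: "((\<lambda>t. weyl_op (f t) x) \<longlongrightarrow> weyl_op z x) F" using f by (rule isCont_tendsto_compose)
  have "((\<lambda>t. g t - x) \<longlongrightarrow> 0) F" using g by (simp add: LIM_zero)
  then have "((\<lambda>t. norm (g t - x)) \<longlongrightarrow> 0) F" by (rule tendsto_norm_zero)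
  then have "((\<lambda>t. norm (weyl_op (f t) (g t - x))) \<longlongrightarrow> 0) F" by simp
  then have "((\<lambda>t. weyl_op (f t) (g t - x)) \<longlongrightarrow> 0) F" by (rule tendsto_norm_zero_cancel)
  from tendsto_add[OF this 1] show ?thesis by (simp add: weyl_op_diff)
qed

lemma continuous_on_weyl_op:
  "continuous_on S f \<Longrightarrow> continuous_on S g \<Longrightarrow> continuous_on S (\<lambda>t. weyl_op (f t) (g t))"
  unfolding continuous_on_def by (intro ballI tendsto_weyl_op) simp_all

section \<open>Complex linear operators, their conjugates and averages\<close>

definition clinear_op :: "('n::finite hfock \<Rightarrow> 'n hfock) \<Rightarrow> bool" where
  "clinear_op A \<longleftrightarrow> bounded_linear A \<and> (\<forall>c x. A (cscale c x) = cscale c (A x))"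

lemma clinear_op_bounded_linear: "clinear_op A \<Longrightarrow> bounded_linear A" and clinear_op_cscale: "clinear_op A \<Longrightarrow> A (cscale c x) = cscale c (A x)"
  by (auto simp: clinear_op_def)

lemma clinear_op_diff:
  assumes "clinear_op A" "clinear_op B" shows "clinear_op (\<lambda>x. A x - B x)"
  using assms by (auto simp: clinear_op_def cscale_simps intro: bounded_linear_sub)

lemma clinear_op_add:
  assumes "clinear_op A" "clinear_op B" shows "clinear_op (\<lambda>x. A x + B x)"
  using assms by (auto simp: clinear_op_def cscale_simps intro: bounded_linear_add)

lemma clinear_op_scaleR:
  assumes "clinear_op A" shows "clinear_op (\<lambda>x. r *\<^sub>R A x)"
  using assms by (auto simp: clinear_op_def cscale_simps intro: bounded_linear_const_scaleR)

lemma clinear_op_zero: "clinear_op (\<lambda>x. 0)"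
  by (auto simp: clinear_op_def intro!: hfock_eqI)

lemma clinear_op_sum:
  assumes "\<And>i. i \<in> I \<Longrightarrow> clinear_op (A i)" shows "clinear_op (\<lambda>x. \<Sum>i\<in>I. A i x)"
  using assms by (induction I rule: infinite_finite_induct) (auto simp: clinear_op_zero intro: clinear_op_add)

lemma clinear_op_weyl_op: "clinear_op (weyl_op z)"
  by (simp add: clinear_op_def bounded_linear_weyl_op weyl_op_cscale)

lemma clinear_op_comp: "clinear_op A \<Longrightarrow> clinear_op B \<Longrightarrow> clinear_op (\<lambda>x. A (B x))"
  unfolding clinear_op_def by (metis bounded_linear_compose)

definition alpha :: "complex ^ 'n::finite \<Rightarrow> ('n hfock \<Rightarrow> 'n hfock) \<Rightarrow> 'n hfock \<Rightarrow> 'n hfock" where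
  "alpha z A x = weyl_op z (A (weyl_op (- z) x))"

lemma clinear_op_alpha: "clinear_op A \<Longrightarrow> clinear_op (alpha z A)"
  unfolding alpha_def[abs_def] by (rule clinear_op_comp[OF clinear_op_weyl_op clinear_op_comp[OF _ clinear_op_weyl_op]])

lemma alpha_0 [simp]: "alpha 0 A = A"
  by (simp add: alpha_def fun_eq_iff)

text \<open>The multipliers of the outer and inner Weyl operators have product 1, so conjugation is
  a true action although the Weyl operators are only projective. Complex linearity of
  \<open>A\<close> lets the inner multiplier pass through.\<close>

lemma alpha_alpha:
  assumes "clinear_op A" shows "alpha z (alpha w A) = alpha (z + w) A"
proof
  fix x
  have r: "cdot z w + cdot w z = of_real (2 * (z \<bullet> w))"
    using complex_add_cnj[of "cdot z w"] by (simp only: cdot_commute[of w z] Re_cdot)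
  have "phase z w * phase (- w) (- z) = exp (of_real pi * (of_real (2 * (z \<bullet> w)) - (cdot z w + cdot w z)))"
    unfolding phase_def exp_add[symmetric]
    by (rule arg_cong[where f=exp]) (simp add: cdot_minus inner_commute[of w z] algebra_simps)
  then have "phase z w * phase (- w) (- z) = 1" unfolding r by simp
  then have "phase (- w) (- z) * phase z w = 1" by (simp only: mult.commute)
  then show "alpha z (alpha w A) x = alpha (z + w) A x"
    by (simp add: alpha_def weyl_op_weyl_op clinear_op_cscale[OF assms] weyl_op_cscale cscale_simps add.commute)
qed

lemma norm_alpha_le:
  assumes "\<And>x. norm (A x) \<le> K * norm x"
  shows "norm (alpha z A x) \<le> K * norm x"
  using assms[of "weyl_op (- z) x"] by (simp add: alpha_def)

lemma continuous_alpha: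
  assumes "clinear_op A" shows "continuous_on UNIV (\<lambda>z. alpha z A x)"
proof -
  have "continuous_on UNIV (\<lambda>z. A (weyl_op (- z) x))"
    by (intro bounded_linear.continuous_on[OF clinear_op_bounded_linear[OF assms]] continuous_on_weyl_op continuous_intros)
  then show ?thesis unfolding alpha_def by (intro continuous_on_weyl_op continuous_intros)
qed

lemma cinner_alpha: "cinner (alpha z A x) y = cinner (A (weyl_op (- z) x)) (weyl_op (- z) y)"
  by (simp add: alpha_def cinner_weyl_op_adjoint)

definition smear_op :: "(complex ^ 'n::finite) list \<Rightarrow> ('n hfock \<Rightarrow> 'n hfock) \<Rightarrow> 'n hfock \<Rightarrow> 'n hfock" where
  "smear_op vs A x = smear vs (\<lambda>y. alpha y A x) 0"

text \<open>Conjugation by a fixed Weyl operator translates the orbit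
  \<open>y \<mapsto> alpha y A x\<close>. Hence the orbit of the averaged operator is the averaged
  orbit, and the calculus of segment averages applies to it.\<close>

lemma alpha_smear_op:
  assumes A: "clinear_op A"
  shows "alpha z (smear_op vs A) x = smear vs (\<lambda>y. alpha y A x) z"
proof -
  have "alpha z (smear_op vs A) x = smear vs (\<lambda>y. weyl_op z (alpha y A (weyl_op (- z) x))) 0"
    unfolding alpha_def[of z] smear_op_def smear_linear[OF continuous_alpha[OF A] bounded_linear_weyl_op] ..
  also have "(\<lambda>y. weyl_op z (alpha y A (weyl_op (- z) x))) = (\<lambda>y. alpha (y + z) A x)"
    using alpha_alpha[OF A, of z] by (auto simp: alpha_def[of z, symmetric] fun_eq_iff add.commute)
  also have "smear vs (\<lambda>y. alpha (y + z) A x) 0 = smear vs (\<lambda>y. alpha y A x) (0 + z)"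
    using smear_translate[of vs "\<lambda>y. alpha y A x" z] by (simp add: fun_eq_iff)
  finally show ?thesis by simp
qed

lemma norm_smear_op_le:
  assumes A: "clinear_op A" and K: "\<And>x. norm (A x) \<le> K * norm x"
  shows "norm (smear_op vs A x) \<le> K * norm x"
  unfolding smear_op_def by (intro smear_bound continuous_alpha A norm_alpha_le K)

lemma clinear_op_smear_op:
  assumes A: "clinear_op A" shows "clinear_op (smear_op vs A)"
proof -
  obtain K where K: "\<And>x. norm (A x) \<le> norm x * K"
    using bounded_linear.bounded[OF clinear_op_bounded_linear[OF A]] by blast
  have l: "bounded_linear (alpha y A)" for y using clinear_op_alpha[OF A] clinear_op_bounded_linear by blast
  have c: "smear_op vs A (cscale c x) = cscale c (smear_op vs A x)" for c x
    unfolding smear_op_def clinear_op_cscale[OF clinear_op_alpha[OF A]] smear_linear[OF continuous_alpha[OF A] bounded_linear_cscale] ..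
  moreover have "bounded_linear (smear_op vs A)"
  proof (rule bounded_linear_intro[where K=K])
    show "smear_op vs A (x + y) = smear_op vs A x + smear_op vs A y" for x y
      unfolding smear_op_def linear_add[OF bounded_linear.linear[OF l]] smear_add[OF continuous_alpha[OF A] continuous_alpha[OF A]] ..
    show "smear_op vs A (r *\<^sub>R x) = r *\<^sub>R smear_op vs A x" for r x
      using c[of "of_real r" x] by (simp add: cscale_simps)
    show "norm (smear_op vs A x) \<le> norm x * K" for x
      using norm_smear_op_le[OF A, of K vs x] K by (simp add: mult.commute)
  qed
  ultimately show ?thesis by (simp add: clinear_op_def)
qed

definition berezin_op :: "('n::finite hfock \<Rightarrow> 'n hfock) \<Rightarrow> complex ^ 'n \<Rightarrow> complex" where
  "berezin_op A z = cinner (A (kern_vec z)) (kern_vec z)"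

text \<open>The Berezin transform is one matrix element of the orbit, traversed in the opposite
  direction. This is the origin of the many reflections \<open>- y\<close> and \<open>- z\<close>
  below.\<close>

lemma berezin_op_alpha: "berezin_op A z = cinner (alpha (- z) A (kern_vec 0)) (kern_vec 0)"
  by (simp add: berezin_op_def cinner_alpha flip: kern_vec_eq_weyl_op)

lemma berezin_op_alpha_translate:
  assumes "clinear_op A" shows "berezin_op (alpha w A) z = berezin_op A (z - w)"
  by (simp add: berezin_op_alpha[of A] berezin_op_alpha[of "alpha w A"] alpha_alpha[OF assms] add.commute)

lemma bounded_linear_cinner_left: "bounded_linear (\<lambda>x. cinner x y)"
  by (rule bounded_bilinear.bounded_linear_left[OF bounded_bilinear_cinner])

lemma continuous_berezin_op:
  assumes "clinear_op A" shows "continuous_on UNIV (\<lambda>y. berezin_op A (- y))"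
  unfolding berezin_op_alpha[of A] minus_minus
  by (rule bounded_linear.continuous_on[OF bounded_linear_cinner_left continuous_alpha[OF assms]])

lemma berezin_op_smear_op:
  assumes A: "clinear_op A"
  shows "berezin_op (smear_op vs A) z = smear vs (\<lambda>y. berezin_op A (- y)) (- z)"
  unfolding berezin_op_alpha[of A] minus_minus smear_linear[OF continuous_alpha[OF A] bounded_linear_cinner_left]
  by (simp add: berezin_op_alpha alpha_smear_op[OF A])

section \<open>Injectivity of the Berezin transform\<close>

lemma integrable_exp_gauss:
  "integrable lborel (\<lambda>w :: complex ^ 'n::finite. (exp (C * norm w))\<^sup>2 * gauss_wt w)"
proof (rule Bochner_Integration.integrable_bound)
  show "integrable lborel (\<lambda>w :: complex ^ 'n. exp (2 * C\<^sup>2 / pi) * exp (- (pi / 2 * (norm w)\<^sup>2)))"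
    by (intro integrable_mult_right integrable_gauss) simp
  \<comment> \<open>Half of the Gaussian decay absorbs the linear exponent, by completing the
    square.\<close>
  have "2 * C * r - pi * r\<^sup>2 \<le> 2 * C\<^sup>2 / pi - pi / 2 * r\<^sup>2" for r
  proof -
    have "0 \<le> (pi * r - 2 * C)\<^sup>2 / (2 * pi)" by simp
    also have "\<dots> = pi / 2 * r\<^sup>2 - 2 * C * r + 2 * C\<^sup>2 / pi" by (simp add: field_simps power2_eq_square)
    finally show ?thesis by (simp add: field_simps)
  qed
  then have "exp (2 * C * r - pi * r\<^sup>2) \<le> exp (2 * C\<^sup>2 / pi - pi / 2 * r\<^sup>2)" for r by simp
  moreover have "exp (2 * C * r - pi * r\<^sup>2) = (exp (C * r))\<^sup>2 * exp (- pi * r\<^sup>2)" for r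
    by (simp flip: exp_double exp_add)
  moreover have "exp (2 * C\<^sup>2 / pi - pi / 2 * r\<^sup>2) = exp (2 * C\<^sup>2 / pi) * exp (- (pi / 2 * r\<^sup>2))" for r
    by (simp flip: exp_add)
  ultimately show "AE w :: complex ^ 'n in lborel. norm ((exp (C * norm w))\<^sup>2 * gauss_wt w)
      \<le> norm (exp (2 * C\<^sup>2 / pi) * exp (- (pi / 2 * (norm w)\<^sup>2)))"
    by (simp add: gauss_wt_def)
qed simp

text \<open>The \<open>itself\<close> argument fixes the dimension, which \<open>C\<close> does not
  determine.\<close>

definition growth_const :: "'n::finite itself \<Rightarrow> real \<Rightarrow> real" where
  "growth_const T C = sqrt (\<integral>w. (exp (C * norm w))\<^sup>2 * gauss_wt (w :: complex ^ 'n::finite) \<partial>lborel)"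

lemma growth_fock:
  fixes f :: "'n::finite fn"
  assumes f: "entire_fn f" and b: "\<And>w. cmod (f w) \<le> M * exp (C * norm w)"
  shows "f \<in> fock" "fock_norm f \<le> M * growth_const TYPE('n) C"
proof -
  have M: "0 \<le> M" using order_trans[OF norm_ge_zero b[of 0]] by simp
  have le: "(cmod (f w))\<^sup>2 * gauss_wt w \<le> M\<^sup>2 * ((exp (C * norm w))\<^sup>2 * gauss_wt w)" for w
    using power_mono[OF b[of w], of 2] by (simp add: power_mult_distrib mult_right_mono mult.assoc[symmetric])
  have i: "integrable lborel (\<lambda>w :: complex ^ 'n. M\<^sup>2 * ((exp (C * norm w))\<^sup>2 * gauss_wt w))"
    by (intro integrable_mult_right integrable_exp_gauss)
  have "integrable lborel (\<lambda>w. (cmod (f w))\<^sup>2 * gauss_wt w)"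
  proof (rule Bochner_Integration.integrable_bound[OF i])
    show "(\<lambda>w. (cmod (f w))\<^sup>2 * gauss_wt w) \<in> borel_measurable lborel"
      using entire_measurable[OF f] by measurable
    show "AE w in lborel. norm ((cmod (f w))\<^sup>2 * gauss_wt w) \<le> norm (M\<^sup>2 * ((exp (C * norm w))\<^sup>2 * gauss_wt w))"
      using le by simp
  qed
  with f show "f \<in> fock" by (simp add: fock_def)
  have "(\<integral>w. (cmod (f w))\<^sup>2 * gauss_wt w \<partial>lborel) \<le> (\<integral>w. M\<^sup>2 * ((exp (C * norm w))\<^sup>2 * gauss_wt (w :: complex ^ 'n)) \<partial>lborel)"
    using \<open>integrable lborel (\<lambda>w. (cmod (f w))\<^sup>2 * gauss_wt w)\<close> i le by (intro integral_mono)
  then have "fock_norm f \<le> sqrt (M\<^sup>2 * (\<integral>w. (exp (C * norm w))\<^sup>2 * gauss_wt (w :: complex ^ 'n) \<partial>lborel))"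
    unfolding fock_norm_def by simp
  then show "fock_norm f \<le> M * growth_const TYPE('n) C"
    using M by (simp add: growth_const_def real_sqrt_mult)
qed

text \<open>Up to a scalar, \<open>exp_vec q 0 \<zeta>\<close> is the kernel at \<open>cnj \<zeta> *s q\<close>; the index \<open>k\<close> counts derivatives
  with respect to \<open>\<zeta>\<close>.\<close>

definition exp_vec :: "complex ^ 'n::finite \<Rightarrow> nat \<Rightarrow> complex \<Rightarrow> 'n hfock" where
  "exp_vec q k \<zeta> = abs_hfock (\<lambda>w. (of_real pi * cdot q w) ^ k * exp (\<zeta> * (of_real pi * cdot q w)))"

lemma power_le_exp: "0 \<le> x \<Longrightarrow> x ^ k \<le> exp (real k * x)" for x :: real
proof -
  assume "0 \<le> x"
  moreover have "x \<le> exp x" using exp_ge_add_one_self[of x] by linarith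
  ultimately have "x ^ k \<le> exp x ^ k" by (intro power_mono)
  then show ?thesis by (simp add: exp_of_nat_mult)
qed

lemma norm_exp_mult_le: "cmod (exp (\<zeta> * c)) \<le> exp (cmod \<zeta> * cmod c)"
  using norm_exp[of "\<zeta> * c"] by (simp add: norm_mult)

lemma cdot_pi_le: "cmod (of_real pi * cdot q w) \<le> pi * norm q * norm w"
  using norm_cdot_le[of q w] by (simp add: norm_mult mult.assoc)

lemma rep_hfock_exp_vec: "rep_hfock (exp_vec q k \<zeta>) = (\<lambda>w. (of_real pi * cdot q w) ^ k * exp (\<zeta> * (of_real pi * cdot q w)))"
proof -
  have "(\<lambda>c. (of_real pi * c) ^ k * exp (\<zeta> * (of_real pi * c))) holomorphic_on UNIV"
    by (intro holomorphic_intros)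
  then have e: "entire_fn (\<lambda>w. (of_real pi * cdot q w) ^ k * exp (\<zeta> * (of_real pi * cdot q w)))"
    by (rule entire_comp_cdot[OF holomorphic_derivI[OF _ open_UNIV UNIV_I]])
  have "(\<lambda>w. (of_real pi * cdot q w) ^ k * exp (\<zeta> * (of_real pi * cdot q w))) \<in> fock"
  proof (rule growth_fock(1)[OF e, of 1 "(real k + cmod \<zeta>) * (pi * norm q)"])
    fix w
    define c where "c = of_real pi * cdot q w"
    have "cmod (c ^ k * exp (\<zeta> * c)) \<le> exp (real k * cmod c) * exp (cmod \<zeta> * cmod c)"
      unfolding norm_mult norm_power by (intro mult_mono power_le_exp norm_exp_mult_le) auto
    also have "\<dots> = exp ((real k + cmod \<zeta>) * cmod c)" by (simp flip: exp_add add: algebra_simps)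
    also have "\<dots> \<le> exp ((real k + cmod \<zeta>) * (pi * norm q * norm w))"
      unfolding c_def exp_le_cancel_iff by (intro mult_left_mono cdot_pi_le) auto
    finally show "cmod ((of_real pi * cdot q w) ^ k * exp (\<zeta> * (of_real pi * cdot q w)))
        \<le> 1 * exp ((real k + cmod \<zeta>) * (pi * norm q) * norm w)" by (simp add: c_def mult.assoc)
  qed
  then show ?thesis by (simp add: exp_vec_def abs_hfock_inverse)
qed

text \<open>The derivative is needed in the Fock norm. The pointwise Taylor remainder is quadratic
  in the increment and at most exponential in \<open>norm w\<close>, and \<open>growth_fock\<close>
  converts such a bound into a norm bound.\<close>

lemma exp_vec_has_derivative:
  fixes q :: "complex ^ 'n::finite"
  shows "(exp_vec q k has_derivative (\<lambda>h. cscale h (exp_vec q (Suc k) \<zeta>))) (at \<zeta>)"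
proof (rule has_derivativeI_sandwich[where e=1])
  \<comment> \<open>The exponent collects \<open>k + 2\<close> from the power of \<open>c\<close>
    including the quadratic remainder, \<open>cmod \<zeta>\<close> from the exponential, and 1 from
    the Taylor bound for increments of modulus below 1.\<close>
  define C where "C = (real k + 3 + cmod \<zeta>) * (pi * norm q)"
  show "bounded_linear (\<lambda>h. cscale h (exp_vec q (Suc k) \<zeta>))" by (rule bounded_linear_cscale_left)
  show "((\<lambda>y. norm (y - \<zeta>) * growth_const TYPE('n) C) \<longlongrightarrow> 0) (at \<zeta>)"
    by (auto intro!: tendsto_eq_intros)
  fix y assume y: "y \<noteq> \<zeta>" "dist y \<zeta> < 1"
  define h where "h = y - \<zeta>"
  have h: "h \<noteq> 0" "cmod h < 1" "y = \<zeta> + h" using y by (auto simp: h_def dist_norm)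
  define d where "d = exp_vec q k y - exp_vec q k \<zeta> - cscale h (exp_vec q (Suc k) \<zeta>)"
  have "fock_norm (rep_hfock d) \<le> (cmod h)\<^sup>2 * growth_const TYPE('n) C"
  proof (rule growth_fock(2)[OF fock_entire[OF rep_hfock_fock]])
    fix w
    define c where "c = of_real pi * cdot q w"
    have eq: "rep_hfock d w = c ^ k * exp (\<zeta> * c) * (exp (h * c) - (\<Sum>i\<le>1. (h * c) ^ i / fact i))"
      by (simp only: d_def rep_hfock_simps rep_hfock_cscale rep_hfock_exp_vec c_def[symmetric] h(3)) (simp add: exp_add algebra_simps)
    have tay: "cmod (exp (h * c) - (\<Sum>i\<le>1. (h * c) ^ i / fact i)) \<le> exp (cmod c) * (cmod h * cmod c)\<^sup>2"
    proof -
      have "cmod (exp (h * c) - (\<Sum>i\<le>1. (h * c) ^ i / fact i)) \<le> exp (cmod h * cmod c) * (cmod h * cmod c)\<^sup>2"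
        using Taylor_exp_field[of "h * c" 1] by (simp add: norm_mult power2_eq_square)
      also have "exp (cmod h * cmod c) \<le> exp (1 * cmod c)"
        using h(2) unfolding exp_le_cancel_iff by (intro mult_right_mono) auto
      finally show ?thesis by (simp add: mult_right_mono)
    qed
    have "cmod (rep_hfock d w) \<le> (cmod c ^ k * exp (cmod \<zeta> * cmod c)) * (exp (cmod c) * (cmod h * cmod c)\<^sup>2)"
      unfolding eq norm_mult norm_power by (intro mult_mono norm_exp_mult_le tay) simp_all
    also have "\<dots> = (cmod h)\<^sup>2 * (cmod c ^ (k + 2) * exp ((cmod \<zeta> + 1) * cmod c))"
      by (simp add: power_add power_mult_distrib distrib_right exp_add power2_eq_square)
    also have "\<dots> \<le> (cmod h)\<^sup>2 * (exp (real (k + 2) * cmod c) * exp ((cmod \<zeta> + 1) * cmod c))"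
      by (intro mult_left_mono mult_right_mono power_le_exp) auto
    also have "\<dots> = (cmod h)\<^sup>2 * exp ((real k + 3 + cmod \<zeta>) * cmod c)"
      by (simp flip: exp_add add: algebra_simps)
    also have "\<dots> \<le> (cmod h)\<^sup>2 * exp ((real k + 3 + cmod \<zeta>) * (pi * norm q * norm w))"
      unfolding c_def by (intro mult_left_mono iffD2[OF exp_le_cancel_iff] cdot_pi_le) auto
    finally show "cmod (rep_hfock d w) \<le> (cmod h)\<^sup>2 * exp (C * norm w)" by (simp add: C_def mult.assoc)
  qed
  then have "norm d / norm h \<le> norm h * growth_const TYPE('n) C"
    using h(1) by (simp add: norm_hfock field_simps power2_eq_square)
  then show "norm ((exp_vec q k y - exp_vec q k \<zeta>) - cscale (y - \<zeta>) (exp_vec q (Suc k) \<zeta>)) / norm (y - \<zeta>)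
      \<le> norm (y - \<zeta>) * growth_const TYPE('n) C"
    by (simp add: d_def h_def)
qed simp

lemma kern_eq: "kern z w = complex_of_real (exp (- (pi / 2 * (norm z)\<^sup>2))) * exp (of_real pi * cdot z w)"
  unfolding kern_def exp_of_real[symmetric] exp_add[symmetric] by (rule arg_cong[where f=exp]) simp

lemma kern_vec_exp_vec: "kern_vec (cnj \<zeta> *s q) = exp (- (pi / 2 * (norm (cnj \<zeta> *s q))\<^sup>2)) *\<^sub>R exp_vec q 0 \<zeta>"
proof (rule hfock_eqI)
  fix w
  have "cdot (cnj \<zeta> *s q) w = \<zeta> * cdot q w"
    by (simp add: cdot_def sum_distrib_left mult.assoc)
  then show "rep_hfock (kern_vec (cnj \<zeta> *s q)) w = rep_hfock (exp (- (pi / 2 * (norm (cnj \<zeta> *s q))\<^sup>2)) *\<^sub>R exp_vec q 0 \<zeta>) w"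
    by (simp add: rep_hfock_exp_vec kern_eq mult.left_commute)
qed

text \<open>\<open>cinner\<close> is antilinear in its second argument; the conjugate placed inside
  \<open>exp_vec\<close> compensates for it, so the real derivative is multiplication by a complex
  number and the function is holomorphic.\<close>

lemma has_derivative_cinner_exp_vec:
  assumes A: "clinear_op A"
  shows "((\<lambda>\<zeta>. cinner (A (exp_vec q 0 \<zeta>)) (exp_vec q 0 (cnj \<zeta>))) has_field_derivative
     cinner (A (exp_vec q 0 \<zeta>)) (exp_vec q 1 (cnj \<zeta>)) + cinner (A (exp_vec q 1 \<zeta>)) (exp_vec q 0 (cnj \<zeta>))) (at \<zeta>)"
proof -
  have 1: "((\<lambda>\<zeta>. A (exp_vec q 0 \<zeta>)) has_derivative (\<lambda>h. A (cscale h (exp_vec q 1 \<zeta>)))) (at \<zeta>)"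
    using bounded_linear.has_derivative[OF clinear_op_bounded_linear[OF A] exp_vec_has_derivative[of q 0 \<zeta>]] by simp
  have "((exp_vec q 0 \<circ> cnj) has_derivative ((\<lambda>h. cscale h (exp_vec q (Suc 0) (cnj \<zeta>))) \<circ> cnj)) (at \<zeta>)"
    by (rule diff_chain_at[OF bounded_linear_imp_has_derivative[OF bounded_linear_cnj]]) (rule exp_vec_has_derivative)
  then have 2: "((\<lambda>\<zeta>. exp_vec q 0 (cnj \<zeta>)) has_derivative (\<lambda>h. cscale (cnj h) (exp_vec q 1 (cnj \<zeta>)))) (at \<zeta>)"
    by (simp add: comp_def)
  show ?thesis unfolding has_field_derivative_def
    by (rule has_derivative_eq_rhs[OF bounded_bilinear.FDERIV[OF bounded_bilinear_cinner 1 2]])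
      (simp add: clinear_op_cscale[OF A] cinner_simps fun_eq_iff algebra_simps)
qed

text \<open>The form \<open>\<langle>A K\<^sub>z, K\<^sub>w\<rangle>\<close> is holomorphic in \<open>(cnj z, w)\<close>, and the diagonal is totally real in these
  variables: along \<open>z = cnj \<zeta> q\<close>, \<open>w = \<zeta> q\<close> it vanishes for real \<open>\<zeta>\<close>, hence also at \<open>\<zeta> = \<i>\<close>.\<close>

lemma berezin_op_zero_antipodal:
  assumes A: "clinear_op A" and 0: "\<And>z. berezin_op A z = 0"
  shows "cinner (A (kern_vec (- u))) (kern_vec u) = 0"
proof -
  \<comment> \<open>This choice makes the parameter \<open>\<i>\<close> correspond to the pair
    \<open>- u\<close>, \<open>u\<close>, while real parameters correspond to diagonal
    pairs.\<close>
  define q where "q = (- \<i>) *s u"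
  have u: "kern_vec (- u) = kern_vec (cnj \<i> *s q)" "kern_vec u = kern_vec (cnj (cnj \<i>) *s q)"
    by (auto simp: q_def vector_smult_assoc vec_eq_iff intro!: arg_cong[where f=kern_vec])
  define h where "h = (\<lambda>\<zeta>. cinner (A (exp_vec q 0 \<zeta>)) (exp_vec q 0 (cnj \<zeta>)))"
  have hol: "h holomorphic_on UNIV"
    unfolding h_def holomorphic_on_def field_differentiable_def
    using has_derivative_cinner_exp_vec[OF A, THEN has_field_derivative_at_within] by blast
  have 0: "h \<zeta> = 0" if "\<zeta> \<in> \<real>" for \<zeta>
  proof -
    have c: "cnj \<zeta> = \<zeta>" using that by (simp add: Reals_cnj_iff)
    have "berezin_op A (cnj \<zeta> *s q) = 0" by (rule 0)
    then show ?thesis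
      unfolding berezin_op_def kern_vec_exp_vec linear_scale[OF bounded_linear.linear[OF clinear_op_bounded_linear[OF A]]] cinner_scaleR
      by (simp add: h_def c)
  qed
  have "0 islimpt (\<real> :: complex set)"
    unfolding islimpt_approachable
  proof (intro allI impI)
    fix e :: real assume "e > 0"
    then show "\<exists>x'\<in>\<real>. x' \<noteq> 0 \<and> dist x' (0 :: complex) < e"
      by (intro bexI[of _ "of_real (e / 2)"]) auto
  qed
  then have "h \<i> = 0"
    using analytic_continuation[OF hol open_UNIV connected_UNIV, of \<real> 0 \<i>] 0 by auto
  then show ?thesis
    unfolding u kern_vec_exp_vec linear_scale[OF bounded_linear.linear[OF clinear_op_bounded_linear[OF A]]] cinner_scaleR
    by (simp add: h_def)
qed

text \<open>Translating the midpoint \<open>p\<close> of \<open>a\<close> and \<open>b\<close> to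
  the origin makes the pair antipodal. Conjugation only translates the Berezin transform, so it
  still vanishes, and the phases that arise are nonzero.\<close>

lemma berezin_op_zero_kernels:
  assumes A: "clinear_op A" and 0: "\<And>z. berezin_op A z = 0"
  shows "cinner (A (kern_vec a)) (kern_vec b) = 0"
proof -
  define p where "p = (1/2) *\<^sub>R (a + b)"
  define u where "u = (1/2) *\<^sub>R (b - a)"
  have ab: "a = p + (- u)" "b = p + u"
    by (simp_all add: p_def u_def scaleR_right_diff_distrib scaleR_right_distrib flip: scaleR_left_distrib)
  have kern_vec_shift: "weyl_op p (kern_vec w) = cscale (phase p w) (kern_vec (p + w))" for w
    by (simp add: kern_vec_eq_weyl_op[of w] kern_vec_eq_weyl_op[of "p + w"] weyl_op_weyl_op)
  have "cinner (alpha (- p) A (kern_vec (- u))) (kern_vec u) = 0"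
    using berezin_op_zero_antipodal[OF clinear_op_alpha[OF A]] 0 by (simp add: berezin_op_alpha_translate[OF A])
  then have "cinner (A (weyl_op p (kern_vec (- u)))) (weyl_op p (kern_vec u)) = 0" by (simp add: cinner_alpha)
  moreover have "phase p w \<noteq> 0" for w using norm_phase[of p w] by auto
  ultimately have "cinner (A (kern_vec (p + (- u)))) (kern_vec (p + u)) = 0"
    by (simp add: kern_vec_shift clinear_op_cscale[OF A] cinner_simps)
  then show ?thesis unfolding ab .
qed

section \<open>Resolution of the identity by the kernels\<close>

lemma cinner_kern_vec_mult: "cinner x (kern_vec z) * cnj (cinner y (kern_vec z)) = rep_hfock x z * cnj (rep_hfock y z) * complex_of_real (gauss_wt z)"
proof -
  have "exp (- of_real (pi / 2 * (norm z)\<^sup>2)) * cnj (exp (- of_real (pi / 2 * (norm z)\<^sup>2))) = complex_of_real (gauss_wt z)"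
    unfolding gauss_wt_def exp_cnj exp_add[symmetric] exp_of_real[symmetric] by (simp add: field_simps)
  then show ?thesis by (simp add: cinner_kern_vec mult.assoc mult.left_commute)
qed

lemma integrable_cinner_kern_vec: "integrable lborel (\<lambda>z. cinner x (kern_vec z) * cnj (cinner y (kern_vec z)))"
  unfolding cinner_kern_vec_mult by (intro fock_inner_integrable rep_hfock_fock)

lemma integral_cinner_kern_vec: "(\<integral>z. cinner x (kern_vec z) * cnj (cinner y (kern_vec z)) \<partial>lborel) = cinner x y"
  unfolding cinner_kern_vec_mult by (simp add: cinner_def fock_inner_def)

lemma integral_norm_cinner_kern_vec:
  "integrable lborel (\<lambda>z. (cmod (cinner x (kern_vec z)))\<^sup>2)" "(\<integral>z. (cmod (cinner x (kern_vec z)))\<^sup>2 \<partial>lborel) = (norm x)\<^sup>2"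
proof -
  have "complex_of_real ((cmod (cinner x (kern_vec z)))\<^sup>2) = complex_of_real ((cmod (rep_hfock x z))\<^sup>2 * gauss_wt z)" for z
    unfolding of_real_mult complex_norm_square using cinner_kern_vec_mult[of x z x] by simp
  then have eq: "(cmod (cinner x (kern_vec z)))\<^sup>2 = (cmod (rep_hfock x z))\<^sup>2 * gauss_wt z" for z
    using of_real_eq_iff by blast
  show "integrable lborel (\<lambda>z. (cmod (cinner x (kern_vec z)))\<^sup>2)"
    unfolding eq by (intro fock_integrable rep_hfock_fock)
  show "(\<integral>z. (cmod (cinner x (kern_vec z)))\<^sup>2 \<partial>lborel) = (norm x)\<^sup>2"
    unfolding eq by (simp add: norm_hfock fock_norm_def)
qed

lemma continuous_kern_vec: "continuous_on UNIV kern_vec"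
  using continuous_weyl_op_left[of "kern_vec 0"] by (simp flip: kern_vec_eq_weyl_op)

lemma continuous_cinner_kern_vec: "continuous_on UNIV (\<lambda>z. cinner x (kern_vec z))"
  by (rule bounded_linear.continuous_on[OF bounded_bilinear.bounded_linear_right[OF bounded_bilinear_cinner] continuous_kern_vec])

text \<open>The expansion of \<open>x\<close> in the kernels, truncated to a box. Lebesgue measure
  is the right one because the Gaussian weight is already contained in the two normalized
  kernels.\<close>

definition kernel_expansion :: "nat \<Rightarrow> 'n::finite hfock \<Rightarrow> 'n hfock" where
  "kernel_expansion n x = integral (cbox (- (real n *\<^sub>R One)) (real n *\<^sub>R One)) (\<lambda>z. cscale (cinner x (kern_vec z)) (kern_vec z))"

lemma continuous_kernel_expansion_integrand: "continuous_on S (\<lambda>z. cscale (cinner x (kern_vec z)) (kern_vec z))"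
proof -
  have "bounded_bilinear (\<lambda>c x. cscale c (x :: 'a hfock))"
    by standard (auto simp: cscale_simps norm_cscale intro!: exI[of _ 1])
  from bounded_bilinear.continuous_on[OF this continuous_cinner_kern_vec continuous_kern_vec]
  show ?thesis by (rule continuous_on_subset) simp
qed

lemma cinner_kernel_expansion:
  "cinner (kernel_expansion n x) y = (\<integral>z. indicator (cbox (- (real n *\<^sub>R One)) (real n *\<^sub>R One)) z *\<^sub>R (cinner x (kern_vec z) * cnj (cinner y (kern_vec z))) \<partial>lborel)"
proof -
  let ?B = "cbox (- (real n *\<^sub>R One)) (real n *\<^sub>R One) :: (complex ^ 'a) set"
  have "cinner (kernel_expansion n x) y = integral ?B ((\<lambda>x. cinner x y) \<circ> (\<lambda>z. cscale (cinner x (kern_vec z)) (kern_vec z)))"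
    unfolding kernel_expansion_def
    by (rule integral_linear[OF integrable_continuous[OF continuous_kernel_expansion_integrand] bounded_linear_cinner_left, symmetric])
  also have "(\<lambda>x. cinner x y) \<circ> (\<lambda>z. cscale (cinner x (kern_vec z)) (kern_vec z)) = (\<lambda>z. cinner x (kern_vec z) * cnj (cinner y (kern_vec z)))"
    by (auto simp: cinner_simps cinner_commute[of y])
  also have "integral ?B \<dots> = (LINT z:?B|lborel. cinner x (kern_vec z) * cnj (cinner y (kern_vec z)))"
  proof (rule set_borel_integral_eq_integral(2)[symmetric])
    have "integrable lborel (\<lambda>z. indicator ?B z *\<^sub>R (cinner x (kern_vec z) * cnj (cinner y (kern_vec z))))"
      by (intro borel_integrable_compact compact_cbox continuous_on_mult continuous_on_cnj
        continuous_on_subset[OF continuous_cinner_kern_vec]) auto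
    then show "set_integrable lborel ?B (\<lambda>z. cinner x (kern_vec z) * cnj (cinner y (kern_vec z)))"
      by (simp add: set_integrable_def)
  qed
  finally show ?thesis by (simp add: set_lebesgue_integral_def)
qed

text \<open>The squared norm of the remainder \<open>y\<close> is the integral outside the box of a
  product. Bounding the product by half the sum of squares produces \<open>(norm y)^2 / 2\<close>,
  which is absorbed on the left, and the tail \<open>T n\<close> vanishes by dominated
  convergence.\<close>

lemma kernel_expansion_tendsto: "(\<lambda>n. kernel_expansion n x) \<longlonglongrightarrow> x"
proof -
  define B where "B = (\<lambda>n. cbox (- (real n *\<^sub>R One)) (real n *\<^sub>R One) :: (complex ^ 'a) set)"
  define g where "g = (\<lambda>z. (cmod (cinner x (kern_vec z)))\<^sup>2)"
  define T where "T = (\<lambda>n. \<integral>z. indicator (- B n) z * g z \<partial>lborel)"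
  have mB: "B n \<in> sets borel" for n by (simp add: B_def)
  have ig: "integrable lborel g" unfolding g_def by (rule integral_norm_cinner_kern_vec)
  have iT: "integrable lborel (\<lambda>z. indicator (- B n) z * g z)" for n
    using integrable_mult_indicator[of "- B n" lborel g] ig mB by simp
  have T0: "T \<longlonglongrightarrow> (\<integral>z. 0 \<partial>(lborel :: (complex ^ 'a) measure))"
    unfolding T_def
  proof (rule integral_dominated_convergence[where w=g])
    show "AE z in lborel. (\<lambda>n. indicator (- B n) z * g z) \<longlonglongrightarrow> 0"
    proof (rule AE_I2)
      fix z :: "complex ^ 'a"
      obtain N :: nat where N: "norm z \<le> real N" using real_arch_simple by blast
      have "z \<in> B n" if "n \<ge> N" for n
      proof -
        have "\<bar>z \<bullet> b\<bar> \<le> real n" if "b \<in> Basis" for b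
          using Basis_le_norm[OF that, of z] N \<open>n \<ge> N\<close> by linarith
        then show ?thesis by (force simp: B_def mem_box abs_le_iff)
      qed
      then have "\<forall>\<^sub>F n in sequentially. indicator (- B n) z * g z = 0"
        by (intro eventually_sequentiallyI[of N]) simp
      then show "(\<lambda>n. indicator (- B n) z * g z) \<longlonglongrightarrow> 0" by (rule tendsto_eventually)
    qed
    show "AE z in lborel. norm (indicator (- B n) z * g z) \<le> g z" for n
      by (rule AE_I2) (auto simp: g_def indicator_def)
  qed (use iT ig in auto)
  have le: "(norm (x - kernel_expansion n x))\<^sup>2 \<le> T n" for n
  proof -
    define y where "y = x - kernel_expansion n x"
    let ?h = "\<lambda>z. cinner x (kern_vec z) * cnj (cinner y (kern_vec z))"
    have iB: "integrable lborel (\<lambda>z. indicator (B n) z *\<^sub>R ?h z)"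
      by (rule integrable_mult_indicator[OF _ integrable_cinner_kern_vec]) (simp add: mB)
    have "cinner y y = cinner x y - cinner (kernel_expansion n x) y"
      using cinner_simps(1)[of y "kernel_expansion n x" y] by (simp add: y_def)
    also have "\<dots> = (\<integral>z. ?h z - indicator (B n) z *\<^sub>R ?h z \<partial>lborel)"
      using Bochner_Integration.integral_diff[OF integrable_cinner_kern_vec iB]
      by (simp add: integral_cinner_kern_vec cinner_kernel_expansion B_def)
    finally have "(norm y)\<^sup>2 = Re (\<integral>z. ?h z - indicator (B n) z *\<^sub>R ?h z \<partial>lborel)"
      by (simp add: power2_norm_eq_inner flip: Re_cinner)
    also have "\<dots> \<le> cmod (\<integral>z. ?h z - indicator (B n) z *\<^sub>R ?h z \<partial>lborel)" by (rule complex_Re_le_cmod)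
    also have "\<dots> \<le> (\<integral>z. (indicator (- B n) z * g z + (cmod (cinner y (kern_vec z)))\<^sup>2) / 2 \<partial>lborel)"
    proof (rule Bochner_Integration.integral_norm_bound_integral)
      show "integrable lborel (\<lambda>z. ?h z - indicator (B n) z *\<^sub>R ?h z)"
        by (intro Bochner_Integration.integrable_diff integrable_cinner_kern_vec iB)
      show "integrable lborel (\<lambda>z. (indicator (- B n) z * g z + (cmod (cinner y (kern_vec z)))\<^sup>2) / 2)"
        by (intro integrable_divide Bochner_Integration.integrable_add iT integral_norm_cinner_kern_vec)
      fix z
      show "cmod (?h z - indicator (B n) z *\<^sub>R ?h z) \<le> (indicator (- B n) z * g z + (cmod (cinner y (kern_vec z)))\<^sup>2) / 2"
        using sum_squares_bound[of "cmod (cinner x (kern_vec z))" "cmod (cinner y (kern_vec z))"]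
        by (cases "z \<in> B n") (auto simp: g_def norm_mult)
    qed
    also have "\<dots> = (T n + (norm y)\<^sup>2) / 2"
      using Bochner_Integration.integral_add[OF iT integral_norm_cinner_kern_vec(1)[of y], of n]
      by (simp add: T_def integral_norm_cinner_kern_vec)
    finally show ?thesis by (simp add: y_def)
  qed
  have "(\<lambda>n. (norm (x - kernel_expansion n x))\<^sup>2) \<longlonglongrightarrow> 0"
  proof (rule tendsto_sandwich[of "\<lambda>_. 0" _ _ T])
    show "T \<longlonglongrightarrow> 0" using T0 by simp
  qed (use le in auto)
  then have "(\<lambda>n. sqrt ((norm (x - kernel_expansion n x))\<^sup>2)) \<longlonglongrightarrow> sqrt 0" by (rule tendsto_real_sqrt)
  then have "(\<lambda>n. norm (kernel_expansion n x - x)) \<longlonglongrightarrow> 0" by (simp add: norm_minus_commute)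
  then show ?thesis by (simp add: tendsto_norm_zero_iff LIM_zero_iff)
qed

text \<open>The operator passes through the integral defining \<open>kernel_expansion\<close>, so it
  vanishes on a sequence converging to \<open>x\<close>.\<close>

lemma clinear_op_eq_zeroI:
  assumes A: "clinear_op A" and 0: "\<And>z. A (kern_vec z) = 0"
  shows "A x = 0"
proof -
  have "A (kernel_expansion n x) = 0" for n
  proof -
    let ?B = "cbox (- (real n *\<^sub>R One)) (real n *\<^sub>R One) :: (complex ^ 'a) set"
    have "A (kernel_expansion n x) = integral ?B (A \<circ> (\<lambda>z. cscale (cinner x (kern_vec z)) (kern_vec z)))"
      unfolding kernel_expansion_def
      by (rule integral_linear[OF integrable_continuous[OF continuous_kernel_expansion_integrand] clinear_op_bounded_linear[OF A], symmetric])
    also have "A \<circ> (\<lambda>z. cscale (cinner x (kern_vec z)) (kern_vec z)) = (\<lambda>z. 0)"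
      by (auto simp: clinear_op_cscale[OF A] 0 intro!: hfock_eqI)
    finally show ?thesis by simp
  qed
  moreover have "(\<lambda>n. A (kernel_expansion n x)) \<longlonglongrightarrow> A x"
    by (rule bounded_linear.tendsto[OF clinear_op_bounded_linear[OF A] kernel_expansion_tendsto])
  ultimately show ?thesis using LIMSEQ_unique[of "\<lambda>n. A (kernel_expansion n x)" 0 "A x"] by simp
qed

lemma berezin_op_inject:
  assumes A: "clinear_op A" and B: "clinear_op B" and eq: "\<And>z. berezin_op A z = berezin_op B z"
  shows "A = B"
proof
  fix x
  have C: "clinear_op (\<lambda>x. A x - B x)" by (rule clinear_op_diff[OF A B])
  have "cinner (A x - B x) y = cinner (A x) y - cinner (B x) y" for x y
    using cinner_simps(1)[of "A x - B x" "B x" y] by simp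
  then have "berezin_op (\<lambda>x. A x - B x) z = 0" for z using eq by (simp add: berezin_op_def)
  from berezin_op_zero_kernels[OF C this] have "cinner (A (kern_vec a) - B (kern_vec a)) (kern_vec b) = 0" for a b .
  then have "A (kern_vec a) - B (kern_vec a) = 0" for a
    by (intro hfock_eqI) (simp add: cinner_kern_vec)
  from clinear_op_eq_zeroI[OF C this] show "A x = B x" by simp
qed

section \<open>Laplacians of Berezin transforms\<close>

lemma has_dirderiv_uminus:
  assumes "has_dirderiv v u D" shows "has_dirderiv v (\<lambda>z. u (- z)) (\<lambda>z. - D (- z))"
  unfolding has_dirderiv_def
proof
  fix z
  have "((\<lambda>t. u (- z + t *\<^sub>R ((- 1) *\<^sub>R v))) has_vector_derivative (- 1) *\<^sub>R D (- z)) (at 0)"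
    using has_dirderiv_scaleR[OF assms, of "-1"] unfolding has_dirderiv_def by blast
  then show "((\<lambda>t. u (- (z + t *\<^sub>R v))) has_vector_derivative - D (- z)) (at 0)"
    by (simp add: algebra_simps)
qed

lemma sum_Basis_vec:
  "(\<Sum>b\<in>(Basis :: (complex ^ 'n::finite) set). f b) = (\<Sum>i\<in>UNIV. f (axis i 1) + f (axis i \<i>))"
proof -
  have "(Basis :: (complex ^ 'n) set) = (\<Union>i\<in>UNIV. {axis i 1, axis i \<i>})"
    by (auto simp: Basis_vec_def Basis_complex_def)
  also have "(\<Sum>b\<in>\<dots>. f b) = (\<Sum>i\<in>UNIV. \<Sum>b\<in>{axis i 1, axis i \<i>}. f b)"
    by (rule sum.UNION_disjoint) (auto simp: axis_eq_axis)
  also have "\<dots> = (\<Sum>i\<in>UNIV. f (axis i 1) + f (axis i \<i>))"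
    by (rule sum.cong) (auto simp: axis_eq_axis)
  finally show ?thesis .
qed

lemma axis_in_Basis: "axis i 1 \<in> (Basis :: (complex ^ 'n::finite) set)" "axis i \<i> \<in> (Basis :: (complex ^ 'n::finite) set)"
  by (auto simp: Basis_vec_def Basis_complex_def)

lemma dirderiv_has_dirderiv: "has_dirderiv b F D \<Longrightarrow> dirderiv F b = D"
  unfolding dirderiv_def has_dirderiv_def by (auto intro!: ext vector_derivative_at)

text \<open>\<open>laplacian\<close> is built from \<open>vector_derivative\<close>, which is
  unspecified where no derivative exists. The two hypotheses guarantee that it has its intended
  meaning.\<close>

lemma laplacian_has_dirderiv:
  fixes F :: "'n::finite fn"
  assumes D1: "\<And>b. b \<in> Basis \<Longrightarrow> has_dirderiv b F (D1 b)" and D2: "\<And>b. b \<in> Basis \<Longrightarrow> has_dirderiv b (D1 b) (D2 b)"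
  shows "laplacian F z = (1/4) * (\<Sum>b\<in>Basis. D2 b z)"
proof -
  have "dirderiv (dirderiv F b) b z = D2 b z" if "b \<in> Basis" for b
    using dirderiv_has_dirderiv[OF D1[OF that]] dirderiv_has_dirderiv[OF D2[OF that]] by simp
  then show ?thesis
    unfolding laplacian_def sum_Basis_vec by (simp add: axis_in_Basis)
qed

lemma cinner_diff: "cinner (x - y) z = cinner x z - cinner y z"
  using cinner_simps(1)[of "x - y" y z] by simp

text \<open>The indices count derivatives in the two slots, so differentiating in \<open>t\<close>
  raises one index at a time. This gives the Berezin transform of every bounded operator explicit
  first and second derivatives.\<close>

definition exp_form :: "('n::finite hfock \<Rightarrow> 'n hfock) \<Rightarrow> complex ^ 'n \<Rightarrow> nat \<Rightarrow> nat \<Rightarrow> real \<Rightarrow> complex" where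
  "exp_form A b j k t = cinner (A (exp_vec b j (of_real t))) (exp_vec b k (of_real t))"

lemma exp_vec_has_vector_derivative:
  "((\<lambda>t::real. exp_vec b k (of_real t)) has_vector_derivative exp_vec b (Suc k) (of_real t)) (at t)"
proof -
  have "((exp_vec b k \<circ> of_real) has_derivative ((\<lambda>h. cscale h (exp_vec b (Suc k) (of_real t))) \<circ> of_real)) (at t)"
    by (rule diff_chain_at[OF bounded_linear_imp_has_derivative[OF bounded_linear_of_real]]) (rule exp_vec_has_derivative)
  then show ?thesis by (simp add: has_vector_derivative_def comp_def cscale_simps)
qed

lemma exp_form_has_vector_derivative:
  assumes A: "clinear_op A"
  shows "(exp_form A b j k has_vector_derivative exp_form A b j (Suc k) t + exp_form A b (Suc j) k t) (at t)"
  unfolding exp_form_def[abs_def]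
  by (rule bounded_bilinear.has_vector_derivative[OF bounded_bilinear_cinner
    bounded_linear.has_vector_derivative[OF clinear_op_bounded_linear[OF A] exp_vec_has_vector_derivative] exp_vec_has_vector_derivative])

text \<open>Conjugation moves the base point to the origin. There the kernels along a line are
  exponential vectors with Gaussian normalizations, whose two factors multiply to
  \<open>exp (- (pi * t^2))\<close>.\<close>

lemma berezin_op_line:
  assumes A: "clinear_op A" and b: "norm b = 1"
  shows "berezin_op A (z + t *\<^sub>R b) = exp (- (pi * t\<^sup>2)) *\<^sub>R exp_form (alpha (- z) A) b 0 0 t"
proof -
  have "cnj (of_real t) *s b = t *\<^sub>R b"
    by (auto simp: vec_eq_iff scaleR_conv_of_real[where 'a=complex])
  then have k: "kern_vec (t *\<^sub>R b) = exp (- (pi / 2 * t\<^sup>2)) *\<^sub>R exp_vec b 0 (of_real t)"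
    using kern_vec_exp_vec[of "of_real t" b] b by simp
  have "berezin_op A (z + t *\<^sub>R b) = berezin_op (alpha (- z) A) (t *\<^sub>R b)"
    by (simp add: berezin_op_alpha_translate[OF A] add.commute)
  also have "\<dots> = (exp (- (pi / 2 * t\<^sup>2)) * exp (- (pi / 2 * t\<^sup>2))) *\<^sub>R exp_form (alpha (- z) A) b 0 0 t"
    unfolding berezin_op_def k linear_scale[OF bounded_linear.linear[OF clinear_op_bounded_linear[OF clinear_op_alpha[OF A]]]] cinner_scaleR exp_form_def
    by simp
  also have "exp (- (pi / 2 * t\<^sup>2)) * exp (- (pi / 2 * t\<^sup>2)) = exp (- (pi * t\<^sup>2))"
    by (simp flip: exp_add)
  finally show ?thesis .
qed

definition berezin_D1 :: "('n::finite hfock \<Rightarrow> 'n hfock) \<Rightarrow> complex ^ 'n \<Rightarrow> complex ^ 'n \<Rightarrow> complex" where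
  "berezin_D1 A b z = exp_form (alpha (- z) A) b 0 1 0 + exp_form (alpha (- z) A) b 1 0 0"

text \<open>The last term comes from the second derivative \<open>- (2 * pi)\<close> of
  \<open>exp (- (pi * t^2))\<close> at 0; the terms mixing first derivatives vanish because that of
  the Gaussian is 0 there.\<close>

definition berezin_D2 :: "('n::finite hfock \<Rightarrow> 'n hfock) \<Rightarrow> complex ^ 'n \<Rightarrow> complex ^ 'n \<Rightarrow> complex" where
  "berezin_D2 A b z = exp_form (alpha (- z) A) b 0 2 0 + 2 *\<^sub>R exp_form (alpha (- z) A) b 1 1 0 + exp_form (alpha (- z) A) b 2 0 0
     - (2 * pi) *\<^sub>R exp_form (alpha (- z) A) b 0 0 0"

lemma berezin_op_line_derivative:
  assumes A: "clinear_op A" and b: "norm b = 1"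
  shows "((\<lambda>t. berezin_op A (z + t *\<^sub>R b)) has_vector_derivative
    exp (- (pi * t\<^sup>2)) *\<^sub>R (exp_form (alpha (- z) A) b 0 1 t + exp_form (alpha (- z) A) b 1 0 t)
      + (- (2 * pi * t) * exp (- (pi * t\<^sup>2))) *\<^sub>R exp_form (alpha (- z) A) b 0 0 t) (at t)"
  unfolding berezin_op_line[OF A b]
  by (rule has_vector_derivative_scaleR)
    (auto intro!: derivative_eq_intros exp_form_has_vector_derivative[OF clinear_op_alpha[OF A], of _ _ 0 0, simplified])

lemma has_dirderiv_berezin_op:
  assumes A: "clinear_op A" and b: "norm b = 1"
  shows "has_dirderiv b (berezin_op A) (berezin_D1 A b)"
  using berezin_op_line_derivative[OF A b, of _ 0] by (simp add: has_dirderiv_def berezin_D1_def)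

lemma has_dirderiv_berezin_D1:
  assumes A: "clinear_op A" and b: "norm b = 1"
  shows "has_dirderiv b (berezin_D1 A b) (berezin_D2 A b)"
  unfolding has_dirderiv_def
proof
  fix z
  define B where "B = alpha (- z) A"
  have B: "clinear_op B" unfolding B_def by (rule clinear_op_alpha[OF A])
  \<comment> \<open>Uniqueness of the derivative expresses \<open>berezin_D1\<close> along the line
    through the single operator \<open>B\<close>, so the second differentiation does not meet a
    conjugate varying with \<open>t\<close>.\<close>
  have eq: "berezin_D1 A b (z + t *\<^sub>R b) = exp (- (pi * t\<^sup>2)) *\<^sub>R (exp_form B b 0 1 t + exp_form B b 1 0 t)
      + (- (2 * pi * t) * exp (- (pi * t\<^sup>2))) *\<^sub>R exp_form B b 0 0 t" for t
    using vector_derivative_unique_at[OF has_dirderiv_line[OF has_dirderiv_berezin_op[OF A b]] berezin_op_line_derivative[OF A b]]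
    by (simp add: B_def)
  have P: "(exp_form B b j k has_vector_derivative exp_form B b j (Suc k) 0 + exp_form B b (Suc j) k 0) (at 0)" for j k
    by (rule exp_form_has_vector_derivative[OF B])
  have e: "((\<lambda>t. exp (- (pi * t\<^sup>2))) has_field_derivative 0) (at 0)"
    by (auto intro!: derivative_eq_intros)
  have e': "((\<lambda>t. - (2 * pi * t) * exp (- (pi * t\<^sup>2))) has_field_derivative - (2 * pi)) (at 0)"
    by (auto intro!: derivative_eq_intros)
  have "((\<lambda>t. exp (- (pi * t\<^sup>2)) *\<^sub>R (exp_form B b 0 1 t + exp_form B b 1 0 t)
      + (- (2 * pi * t) * exp (- (pi * t\<^sup>2))) *\<^sub>R exp_form B b 0 0 t) has_vector_derivative
     (exp (- (pi * 0\<^sup>2)) *\<^sub>R ((exp_form B b 0 (Suc 1) 0 + exp_form B b (Suc 0) 1 0) + (exp_form B b 1 (Suc 0) 0 + exp_form B b (Suc 1) 0 0))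
       + 0 *\<^sub>R (exp_form B b 0 1 0 + exp_form B b 1 0 0))
    + ((- (2 * pi * 0) * exp (- (pi * 0\<^sup>2))) *\<^sub>R (exp_form B b 0 (Suc 0) 0 + exp_form B b (Suc 0) 0 0) + (- (2 * pi)) *\<^sub>R exp_form B b 0 0 0)) (at 0)"
    by (rule has_vector_derivative_add[OF has_vector_derivative_scaleR[OF e has_vector_derivative_add[OF P P]]
       has_vector_derivative_scaleR[OF e' P]])
  then show "((\<lambda>t. berezin_D1 A b (z + t *\<^sub>R b)) has_vector_derivative berezin_D2 A b z) (at 0)"
    unfolding eq by (simp add: berezin_D2_def B_def[symmetric] scaleR_2 numeral_2_eq_2 algebra_simps)
qed

lemma continuous_berezin_D2:
  assumes A: "clinear_op A" shows "continuous_on UNIV (\<lambda>y. berezin_D2 A b (- y))"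
proof -
  have "continuous_on UNIV (\<lambda>y. exp_form (alpha y A) b j k 0)" for j k
    unfolding exp_form_def
    by (rule bounded_linear.continuous_on[OF bounded_linear_cinner_left continuous_alpha[OF A]])
  then show ?thesis unfolding berezin_D2_def minus_minus
    by (intro continuous_on_diff continuous_on_add continuous_on_scaleR continuous_on_const)
qed

lemma laplacian_berezin_op:
  assumes "clinear_op A" shows "laplacian (berezin_op A) z = (1/4) * (\<Sum>b\<in>Basis. berezin_D2 A b z)"
  using assms by (intro laplacian_has_dirderiv[where ?D1.0="berezin_D1 A"] has_dirderiv_berezin_op has_dirderiv_berezin_D1) auto

section \<open>Smoothed discrete Laplacians of operators\<close>

definition second_diff_op :: "complex ^ 'n::finite \<Rightarrow> ('n hfock \<Rightarrow> 'n hfock) \<Rightarrow> 'n hfock \<Rightarrow> 'n hfock" where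
  "second_diff_op v A x = alpha v A x + alpha (- v) A x - 2 *\<^sub>R A x"

text \<open>The operator \<open>Q_h\<close> of the overview. Of the factor
  \<open>1 / (4 * h^2)\<close>, the part \<open>1 / h^2\<close> normalizes the second difference and
  \<open>1 / 4\<close> relates the complex Laplacian to the sum over the real basis.\<close>

definition discrete_laplacian :: "real \<Rightarrow> (complex ^ 'n::finite) list \<Rightarrow> ('n hfock \<Rightarrow> 'n hfock) \<Rightarrow> 'n hfock \<Rightarrow> 'n hfock" where
  "discrete_laplacian h bs A x = (\<Sum>b\<in>Basis. (1 / (4 * h\<^sup>2)) *\<^sub>R smear_op (dirs h (remove1 b bs)) (second_diff_op (h *\<^sub>R b) A) x)"

lemma clinear_op_second_diff_op: "clinear_op A \<Longrightarrow> clinear_op (second_diff_op v A)"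
  unfolding second_diff_op_def[abs_def] by (intro clinear_op_diff clinear_op_add clinear_op_alpha clinear_op_scaleR)

lemma clinear_op_discrete_laplacian: "clinear_op A \<Longrightarrow> clinear_op (discrete_laplacian h bs A)"
  unfolding discrete_laplacian_def[abs_def] by (intro clinear_op_sum clinear_op_scaleR clinear_op_smear_op clinear_op_second_diff_op)

lemma alpha_second_diff_op:
  assumes A: "clinear_op A" shows "alpha y (second_diff_op v A) x = second_diff v (\<lambda>y. alpha y A x) y"
proof -
  have "alpha y (second_diff_op v A) x = alpha y (alpha v A) x + alpha y (alpha (- v) A) x - 2 *\<^sub>R alpha y A x"
    unfolding second_diff_op_def alpha_def[of y] weyl_op_diff weyl_op_add linear_scale[OF bounded_linear.linear[OF bounded_linear_weyl_op]] ..
  then show ?thesis by (simp add: alpha_alpha[OF A] second_diff_def)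
qed

lemma alpha_discrete_laplacian:
  assumes A: "clinear_op A"
  shows "alpha z (discrete_laplacian h bs A) x
    = (\<Sum>b\<in>Basis. (1 / (4 * h\<^sup>2)) *\<^sub>R smear (dirs h (remove1 b bs)) (second_diff (h *\<^sub>R b) (\<lambda>y. alpha y A x)) z)"
proof -
  have "alpha z (discrete_laplacian h bs A) x
    = (\<Sum>b\<in>Basis. (1 / (4 * h\<^sup>2)) *\<^sub>R alpha z (smear_op (dirs h (remove1 b bs)) (second_diff_op (h *\<^sub>R b) A)) x)"
    unfolding discrete_laplacian_def alpha_def[of z] linear_sum[OF bounded_linear.linear[OF bounded_linear_weyl_op]]
      linear_scale[OF bounded_linear.linear[OF bounded_linear_weyl_op]] ..
  then show ?thesis unfolding alpha_smear_op[OF clinear_op_second_diff_op[OF A]] alpha_second_diff_op[OF A] .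
qed

lemma smear_alpha_has_dirderiv2:
  assumes A: "clinear_op A" and bs: "set bs = Basis" and h: "h \<noteq> 0"
  shows "\<exists>D1 D2. (\<forall>b\<in>Basis. has_dirderiv b (\<lambda>z. alpha z (smear_op (dirs h bs) A) x) (D1 b)) \<and> (\<forall>b\<in>Basis. has_dirderiv b (D1 b) (D2 b)) \<and>
     (\<forall>z. (\<Sum>b\<in>Basis. D2 b z) = 4 *\<^sub>R alpha z (discrete_laplacian h bs A) x)"
proof -
  define D2 where "D2 = (\<lambda>b z. (1 / h\<^sup>2) *\<^sub>R smear (dirs h (remove1 b bs)) (second_diff (h *\<^sub>R b) (\<lambda>y. alpha y A x)) z)"
  have "\<forall>b\<in>Basis. \<exists>D. has_dirderiv b (\<lambda>z. alpha z (smear_op (dirs h bs) A) x) D \<and> has_dirderiv b D (D2 b)"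
  proof
    fix b :: "complex ^ 'a" assume "b \<in> Basis"
    then show "\<exists>D. has_dirderiv b (\<lambda>z. alpha z (smear_op (dirs h bs) A) x) D \<and> has_dirderiv b D (D2 b)"
      using smear_dirs_has_dirderiv2[OF continuous_alpha[OF A] _ h, of b bs x] bs
      unfolding D2_def alpha_smear_op[OF A] by simp
  qed
  then obtain D1 where "\<forall>b\<in>Basis. has_dirderiv b (\<lambda>z. alpha z (smear_op (dirs h bs) A) x) (D1 b) \<and> has_dirderiv b (D1 b) (D2 b)"
    by (meson bchoice)
  moreover have "(\<Sum>b\<in>Basis. D2 b z) = 4 *\<^sub>R alpha z (discrete_laplacian h bs A) x" for z
    unfolding alpha_discrete_laplacian[OF A] D2_def scaleR_sum_right by (simp add: h)
  ultimately show ?thesis by blast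
qed

text \<open>The reflection in \<open>berezin_op_alpha\<close> changes the sign of a first derivative
  and leaves a second derivative unchanged, so the orbit calculation transfers directly.\<close>

lemma laplacian_berezin_op_smear_op:
  assumes A: "clinear_op A" and bs: "set bs = Basis" and h: "h \<noteq> 0"
  shows "laplacian (berezin_op (smear_op (dirs h bs) A)) z = berezin_op (discrete_laplacian h bs A) z"
proof -
  let ?l = "\<lambda>x. cinner x (kern_vec 0)"
  obtain D1 D2 where D: "\<And>b. b \<in> Basis \<Longrightarrow> has_dirderiv b (\<lambda>z. alpha z (smear_op (dirs h bs) A) (kern_vec 0)) (D1 b)"
    "\<And>b. b \<in> Basis \<Longrightarrow> has_dirderiv b (D1 b) (D2 b)" "\<And>z. (\<Sum>b\<in>Basis. D2 b z) = 4 *\<^sub>R alpha z (discrete_laplacian h bs A) (kern_vec 0)"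
    using smear_alpha_has_dirderiv2[OF A bs h, of "kern_vec 0"] by blast
  have d1: "has_dirderiv b (berezin_op (smear_op (dirs h bs) A)) (\<lambda>z. - ?l (D1 b (- z)))" if "b \<in> Basis" for b
    using has_dirderiv_uminus[OF has_dirderiv_linear[OF D(1)[OF that] bounded_linear_cinner_left[of "kern_vec 0"]]]
    by (simp add: berezin_op_alpha[abs_def])
  have d2: "has_dirderiv b (\<lambda>z. - ?l (D1 b (- z))) (\<lambda>z. ?l (D2 b (- z)))" if "b \<in> Basis" for b
    using has_dirderiv_linear[OF has_dirderiv_uminus[OF has_dirderiv_linear[OF D(2)[OF that] bounded_linear_cinner_left[of "kern_vec 0"]]] bounded_linear_minus[OF bounded_linear_ident]]
    by simp
  have "laplacian (berezin_op (smear_op (dirs h bs) A)) z = (1/4) * (\<Sum>b\<in>Basis. ?l (D2 b (- z)))"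
    by (rule laplacian_has_dirderiv[OF d1 d2])
  also have "(\<Sum>b\<in>Basis. ?l (D2 b (- z))) = ?l (\<Sum>b\<in>Basis. D2 b (- z))"
    by (rule linear_sum[OF bounded_linear.linear[OF bounded_linear_cinner_left], symmetric])
  finally show ?thesis
    unfolding D(3) cinner_scaleR berezin_op_alpha[of "discrete_laplacian h bs A"] by (simp add: scaleR_conv_of_real)
qed

lemma smear_sum:
  assumes "finite I" "\<And>i. i \<in> I \<Longrightarrow> continuous_on UNIV (u i)"
  shows "smear vs (\<lambda>z. \<Sum>i\<in>I. u i z) = (\<lambda>z. \<Sum>i\<in>I. smear vs (u i) z)"
  using assms
proof (induction I rule: finite_induct)
  case empty
  have "smear vs (\<lambda>_. 0) = (\<lambda>_. 0)"
    using smear_linear[OF continuous_on_const[of UNIV 0] bounded_linear_zero, of vs] by simp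
  then show ?case by simp
next
  case (insert i I)
  then have "smear vs (\<lambda>z. u i z + (\<Sum>i\<in>I. u i z)) = (\<lambda>z. smear vs (u i) z + smear vs (\<lambda>z. \<Sum>i\<in>I. u i z) z)"
    by (intro smear_add continuous_on_sum) auto
  with insert show ?case by simp
qed

text \<open>Averaging the scalar identity for \<open>T\<close> integrates the second derivatives of
  the Berezin transform of \<open>S\<close> into second differences. Unlike derivatives, these are
  again Berezin transforms of bounded operators built from \<open>S\<close>, so injectivity gives an
  identity of operators.\<close>

lemma smear_op_eq_discrete_laplacian:
  assumes S: "clinear_op S" and T: "clinear_op T" and L: "\<And>z. laplacian (berezin_op S) z = berezin_op T z"
    and bs: "set bs = Basis" and h: "h \<noteq> 0"
  shows "smear_op (dirs h bs) T = discrete_laplacian h bs S"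
proof (rule berezin_op_inject[OF clinear_op_smear_op[OF T] clinear_op_discrete_laplacian[OF S]])
  fix z
  let ?l = "\<lambda>x. cinner x (kern_vec 0)"
  define u where "u = (\<lambda>y. berezin_op S (- y))"
  have cu: "continuous_on UNIV u" unfolding u_def by (rule continuous_berezin_op[OF S])
  have sD2: "smear (dirs h bs) (\<lambda>y. berezin_D2 S b (- y))
     = (\<lambda>z. (1 / h\<^sup>2) *\<^sub>R smear (dirs h (remove1 b bs)) (second_diff (h *\<^sub>R b) u) z)" if b: "b \<in> Basis" for b
  proof (rule smear_dirs_of_has_dirderiv2[OF cu continuous_berezin_D2[OF S]])
    show "has_dirderiv b u (\<lambda>y. - berezin_D1 S b (- y))"
      unfolding u_def using b by (intro has_dirderiv_uminus has_dirderiv_berezin_op S) simp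
    show "has_dirderiv b (\<lambda>y. - berezin_D1 S b (- y)) (\<lambda>y. berezin_D2 S b (- y))"
      using has_dirderiv_linear[OF has_dirderiv_uminus[OF has_dirderiv_berezin_D1[OF S]] bounded_linear_minus[OF bounded_linear_ident], of b] b by simp
  qed (use b bs h in auto)
  have bzT: "berezin_op T (- y) = (1/4) *\<^sub>R (\<Sum>b\<in>Basis. berezin_D2 S b (- y))" for y
    using L[of "- y"] laplacian_berezin_op[OF S, of "- y"] by (simp add: scaleR_conv_of_real)
  have "berezin_op (smear_op (dirs h bs) T) z = smear (dirs h bs) (\<lambda>y. (1/4) *\<^sub>R (\<Sum>b\<in>Basis. berezin_D2 S b (- y))) (- z)"
    unfolding berezin_op_smear_op[OF T] bzT ..
  also have "\<dots> = (1/4) *\<^sub>R (\<Sum>b\<in>Basis. smear (dirs h bs) (\<lambda>y. berezin_D2 S b (- y)) (- z))"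
    unfolding smear_linear[OF continuous_on_sum[OF continuous_berezin_D2[OF S]] bounded_linear_scaleR_right]
      smear_sum[OF finite_Basis continuous_berezin_D2[OF S]] ..
  also have "\<dots> = (\<Sum>b\<in>Basis. (1 / (4 * h\<^sup>2)) *\<^sub>R smear (dirs h (remove1 b bs)) (second_diff (h *\<^sub>R b) u) (- z))"
    unfolding scaleR_sum_right by (rule sum.cong) (simp_all add: sD2)
  also have "\<dots> = berezin_op (discrete_laplacian h bs S) z"
  proof -
    have "smear vs (second_diff v u) z = ?l (smear vs (second_diff v (\<lambda>y. alpha y S (kern_vec 0))) z)" for vs v z
    proof -
      have "second_diff v u = (\<lambda>y. ?l (second_diff v (\<lambda>y. alpha y S (kern_vec 0)) y))"
        by (simp add: u_def berezin_op_alpha[abs_def] second_diff_def[abs_def] cinner_simps cinner_diff cinner_scaleR)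
      then show ?thesis
        by (simp add: smear_linear[OF continuous_second_diff[OF continuous_alpha[OF S]] bounded_linear_cinner_left])
    qed
    then show ?thesis
      unfolding berezin_op_alpha[of "discrete_laplacian h bs S"] alpha_discrete_laplacian[OF S]
        linear_sum[OF bounded_linear.linear[OF bounded_linear_cinner_left]] cinner_scaleR by simp
  qed
  finally show "berezin_op (smear_op (dirs h bs) T) z = berezin_op (discrete_laplacian h bs S) z" .
qed

lemma sum_list_norm_dirs:
  assumes "set bs \<subseteq> Basis" "h > 0"
  shows "sum_list (map norm (dirs h bs)) = 2 * h * length bs"
proof -
  have "map norm (dirs h bs) = map (\<lambda>_. h) (bs @ bs)"
    using assms by (auto simp: dirs_def)
  then show ?thesis by (simp only: sum_list_triv) simp
qed

lemma smear_dirs_tendsto: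
  assumes u: "continuous_on UNIV u" and bs: "set bs \<subseteq> Basis" and e: "e > 0"
  shows "\<exists>d>0. \<forall>h. 0 < h \<longrightarrow> h < d \<longrightarrow> norm (smear (dirs h bs) u z - u z) \<le> e"
proof -
  have "isCont u z" using u by (simp add: continuous_on_eq_continuous_at)
  then obtain r where r: "r > 0" "\<And>y. dist y z < r \<Longrightarrow> dist (u y) (u z) < e"
    using e unfolding continuous_at_eps_delta by blast
  show ?thesis
  proof (intro exI[of _ "r / (2 * length bs + 1)"] conjI allI impI)
    fix h assume h: "0 < h" "h < r / (2 * length bs + 1)"
    have "h * (2 * length bs + 1) < r" using h by (simp add: pos_less_divide_eq)
    then have "2 * h * length bs < r" using h(1) by (simp add: algebra_simps)
    then show "norm (smear (dirs h bs) u z - u z) \<le> e"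
      using r(2) by (intro smear_close[OF u]) (auto simp: sum_list_norm_dirs[OF bs h(1)] dist_norm less_imp_le)
  qed (use r in auto)
qed

lemma inner_alpha_smear_op_le:
  assumes A: "clinear_op A" and K: "\<And>x. norm (A x) \<le> K * norm x"
  shows "\<bar>inner (alpha z (smear_op vs A) x) y\<bar> \<le> K * norm x * norm y"
proof -
  have "norm (alpha z (smear_op vs A) x) \<le> K * norm x"
    by (intro norm_alpha_le norm_smear_op_le A K)
  then have "norm (alpha z (smear_op vs A) x) * norm y \<le> K * norm x * norm y"
    by (rule mult_right_mono) simp
  with Cauchy_Schwarz_ineq2[of "alpha z (smear_op vs A) x" y] show ?thesis by (rule order_trans)
qed

section \<open>Norm Lipschitz continuity of the orbit\<close>

lemma alpha_Lipschitz:
  fixes S :: "'n::finite hfock \<Rightarrow> 'n hfock"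
  assumes S: "clinear_op S" and T: "clinear_op T" and L: "\<And>z. laplacian (berezin_op S) z = berezin_op T z"
  shows "\<exists>C\<ge>0. \<forall>v x. norm v \<le> 1 \<longrightarrow> norm (alpha v S x - S x) \<le> C * norm v * norm x"
proof -
  obtain bs :: "(complex ^ 'n) list" where bs: "set bs = Basis" using finite_list finite_Basis by blast
  obtain KS where KS: "\<And>x. norm (S x) \<le> KS * norm x" "KS > 0"
    using bounded_linear.pos_bounded[OF clinear_op_bounded_linear[OF S]] by (auto simp: mult.commute)
  obtain KT where KT: "\<And>x. norm (T x) \<le> KT * norm x" "KT > 0"
    using bounded_linear.pos_bounded[OF clinear_op_bounded_linear[OF T]] by (auto simp: mult.commute)
  define N where "N = real DIM(complex ^ 'n)"
  \<comment> \<open>The constant of \<open>Lipschitz_of_bounded_laplacian\<close> for a function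
    bounded by \<open>KS\<close> with real Laplacian bounded by \<open>4 * KT\<close>, on unit
    vectors.\<close>
  define C where "C = N * (KS * N + 4 * KT)"
  have C: "C \<ge> 0" using KS KT by (simp add: C_def N_def)
  have smooth: "\<bar>inner (alpha v (smear_op (dirs h bs) S) x) y - inner (smear_op (dirs h bs) S x) y\<bar> \<le> C * norm v * norm x * norm y"
    if v: "norm v \<le> 1" and h: "h > 0" for v x y h
  proof -
    obtain D1 D2 where D: "\<And>b. b \<in> Basis \<Longrightarrow> has_dirderiv b (\<lambda>z. alpha z (smear_op (dirs h bs) S) x) (D1 b)"
      "\<And>b. b \<in> Basis \<Longrightarrow> has_dirderiv b (D1 b) (D2 b)" "\<And>z. (\<Sum>b\<in>Basis. D2 b z) = 4 *\<^sub>R alpha z (discrete_laplacian h bs S) x"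
      using smear_alpha_has_dirderiv2[OF S bs, of h x] h by auto
    note bl = bounded_linear_inner_left[of y]
    define u where "u = (\<lambda>z. inner (alpha z (smear_op (dirs h bs) S) x) y)"
    have "\<bar>u (0 + v) - u 0\<bar> \<le> DIM(complex ^ 'n) * ((KS * norm x * norm y) * DIM(complex ^ 'n) + 4 * (KT * norm x * norm y)) * norm v"
    proof (rule Lipschitz_of_bounded_laplacian[where ?D1.0="\<lambda>b z. inner (D1 b z) y" and ?D2.0="\<lambda>b z. inner (D2 b z) y"])
      show "continuous_on UNIV u" unfolding u_def
        by (rule bounded_linear.continuous_on[OF bl continuous_alpha[OF clinear_op_smear_op[OF S]]])
      show "has_dirderiv b u (\<lambda>z. inner (D1 b z) y)" if "b \<in> Basis" for b
        unfolding u_def by (rule has_dirderiv_linear[OF D(1)[OF that] bl])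
      show "has_dirderiv b (\<lambda>z. inner (D1 b z) y) (\<lambda>z. inner (D2 b z) y)" if "b \<in> Basis" for b
        by (rule has_dirderiv_linear[OF D(2)[OF that] bl])
      show "\<bar>u z\<bar> \<le> KS * norm x * norm y" for z
        unfolding u_def by (rule inner_alpha_smear_op_le[OF S KS(1)])
      show "\<bar>\<Sum>b\<in>Basis. inner (D2 b z) y\<bar> \<le> 4 * (KT * norm x * norm y)" for z
      proof -
        \<comment> \<open>Replacing the discrete Laplacian of \<open>S\<close> by the average of
          \<open>T\<close> removes the factor \<open>1 / h^2\<close>, so the bound is uniform in
          \<open>h\<close>.\<close>
        have "(\<Sum>b\<in>Basis. inner (D2 b z) y) = 4 * inner (alpha z (smear_op (dirs h bs) T) x) y"
          using smear_op_eq_discrete_laplacian[OF S T L bs, of h] h D(3)[of z] by (simp add: inner_sum_left[symmetric])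
        moreover have "\<bar>inner (alpha z (smear_op (dirs h bs) T) x) y\<bar> \<le> KT * norm x * norm y"
          by (rule inner_alpha_smear_op_le[OF T KT(1)])
        ultimately show ?thesis by simp
      qed
    qed (rule v)
    also have "\<dots> = C * norm v * norm x * norm y" by (simp add: C_def N_def algebra_simps)
    finally show ?thesis by (simp add: u_def)
  qed
  have lim: "\<bar>inner (alpha v S x) y - inner (S x) y\<bar> \<le> C * norm v * norm x * norm y" if v: "norm v \<le> 1" for v x y
  proof (rule field_le_epsilon)
    fix e :: real assume e: "e > 0"
    define q where "q = norm y + 1"
    \<comment> \<open>Two approximation errors of size \<open>e' * norm y\<close> occur, at
      \<open>v\<close> and at 0; the summand 1 in \<open>q\<close> keeps the denominator positive
      when \<open>y = 0\<close>.\<close>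
    define e' where "e' = e / (2 * q)"
    have p: "0 < q" by (simp add: q_def add_nonneg_pos)
    have e': "e' > 0" unfolding e'_def using e p by (intro divide_pos_pos) auto
    have "2 * e' * norm y \<le> 2 * e' * q" using e' by (intro mult_left_mono) (auto simp: q_def)
    also have "\<dots> = e" using p by (simp add: e'_def)
    finally have e'': "2 * e' * norm y \<le> e" .
    obtain d1 where d1: "d1 > 0" "\<And>h. 0 < h \<Longrightarrow> h < d1 \<Longrightarrow> norm (smear (dirs h bs) (\<lambda>z. alpha z S x) v - alpha v S x) \<le> e'"
      using smear_dirs_tendsto[OF continuous_alpha[OF S] equalityD1[OF bs] e'] by meson
    obtain d2 where d2: "d2 > 0" "\<And>h. 0 < h \<Longrightarrow> h < d2 \<Longrightarrow> norm (smear (dirs h bs) (\<lambda>z. alpha z S x) 0 - alpha 0 S x) \<le> e'"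
      using smear_dirs_tendsto[OF continuous_alpha[OF S] equalityD1[OF bs] e'] by meson
    define h where "h = min d1 d2 / 2"
    have h: "0 < h" "h < d1" "h < d2" using d1(1) d2(1) by (auto simp: h_def min_def)
    have close: "\<bar>inner a y - inner c y\<bar> \<le> e' * norm y" if "norm (a - c) \<le> e'" for a c
      using Cauchy_Schwarz_ineq2[of "a - c" y] mult_right_mono[OF that, of "norm y"] by (simp add: inner_diff_left)
    have "\<bar>inner (alpha v (smear_op (dirs h bs) S) x) y - inner (alpha v S x) y\<bar> \<le> e' * norm y"
      using d1(2)[OF h(1,2)] by (intro close) (simp add: alpha_smear_op[OF S])
    moreover have "\<bar>inner (smear_op (dirs h bs) S x) y - inner (S x) y\<bar> \<le> e' * norm y"
      using d2(2)[OF h(1,3)] by (intro close) (simp add: smear_op_def)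
    ultimately show "\<bar>inner (alpha v S x) y - inner (S x) y\<bar> \<le> C * norm v * norm x * norm y + e"
      using smooth[OF v h(1), of x y] e'' by linarith
  qed
  have "norm (alpha v S x - S x) \<le> C * norm v * norm x" if "norm v \<le> 1" for v x
  proof (cases "alpha v S x - S x = 0")
    case False
    define d where "d = alpha v S x - S x"
    \<comment> \<open>Testing the matrix element bound against \<open>y = d\<close> and dividing by
      \<open>norm d\<close> recovers the norm of the vector itself.\<close>
    have "norm d * norm d \<le> (C * norm v * norm x) * norm d"
      using lim[OF that, of x d] by (simp add: d_def inner_diff_left[symmetric] power2_norm_eq_inner[symmetric] power2_eq_square)
    then show ?thesis using False by (simp add: d_def)
  qed (use C in auto)
  with C show ?thesis by blast
qed

section \<open>Transfer between operators on functions and on the Fock type\<close>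

definition lift :: "'n::finite op \<Rightarrow> 'n hfock \<Rightarrow> 'n hfock" where "lift S x = abs_hfock (S (rep_hfock x))"

text \<open>Outside \<open>fock\<close> the values of \<open>unlift A\<close> are unspecified. Only
  \<open>lift (unlift A) = A\<close> is used as an equality of maps; operators on functions are
  compared on \<open>fock\<close> alone.\<close>

definition unlift :: "('n::finite hfock \<Rightarrow> 'n hfock) \<Rightarrow> 'n op" where "unlift A f = rep_hfock (A (abs_hfock f))"

lemma rep_hfock_lift: "bounded_fock_op S \<Longrightarrow> rep_hfock (lift S x) = S (rep_hfock x)"
  by (simp add: lift_def bounded_fock_op_def abs_hfock_inverse)

lemma clinear_op_lift:
  assumes S: "bounded_fock_op S" shows "clinear_op (lift S)"
proof -
  have add: "lift S (x + y) = lift S x + lift S y" for x y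
    by (rule hfock_eqI) (use S in \<open>simp add: rep_hfock_lift bounded_fock_op_def\<close>)
  have sc: "lift S (cscale c x) = cscale c (lift S x)" for c x
    by (rule hfock_eqI) (use S in \<open>simp add: rep_hfock_lift bounded_fock_op_def\<close>)
  obtain C where "\<And>f. f \<in> fock \<Longrightarrow> fock_norm (S f) \<le> C * fock_norm f"
    using S unfolding bounded_fock_op_def by blast
  then have C: "norm (lift S x) \<le> norm x * C" for x
    by (simp add: norm_hfock rep_hfock_lift[OF S] mult.commute)
  have "bounded_linear (lift S)"
    by (rule bounded_linear_intro[OF add _ C]) (simp flip: cscale_simps(5) add: sc)
  with sc show ?thesis by (simp add: clinear_op_def)
qed

lemma bounded_unlift:
  assumes A: "clinear_op A" shows "bounded_fock_op (unlift A)"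
proof -
  note lin = bounded_linear.linear[OF clinear_op_bounded_linear[OF A]]
  have 1: "abs_hfock (\<lambda>w. f w + g w) = abs_hfock f + abs_hfock g" if "f \<in> fock" "g \<in> fock" for f g :: "'a fn"
    using that by (simp add: plus_hfock_def abs_hfock_inverse)
  have 2: "abs_hfock (\<lambda>w. a * f w) = cscale a (abs_hfock f)" if "f \<in> fock" for f :: "'a fn" and a
    using that by (simp add: cscale_def abs_hfock_inverse)
  obtain K where K: "\<And>x. norm (A x) \<le> norm x * K"
    using bounded_linear.bounded[OF clinear_op_bounded_linear[OF A]] by blast
  show ?thesis unfolding bounded_fock_op_def
  proof (intro conjI ballI allI exI[of _ K])
    fix f g :: "'a fn" and a :: complex assume f: "f \<in> fock"
    show "unlift A f \<in> fock" by (simp add: unlift_def)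
    show "unlift A (\<lambda>w. a * f w) = (\<lambda>w. a * unlift A f w)"
      by (simp add: unlift_def 2[OF f] clinear_op_cscale[OF A])
    show "fock_norm (unlift A f) \<le> K * fock_norm f"
      using K[of "abs_hfock f"] by (simp add: unlift_def fock_norm_abs_hfock[OF f] norm_hfock[symmetric] mult.commute)
    assume g: "g \<in> fock"
    show "unlift A (\<lambda>w. f w + g w) = (\<lambda>w. unlift A f w + unlift A g w)"
      by (simp add: unlift_def 1[OF f g] linear_add[OF lin])
  qed
qed

lemma lift_unlift: "lift (unlift A) = A"
  by (simp add: lift_def unlift_def fun_eq_iff rep_hfock_inverse)

lemma berezin_lift: "bounded_fock_op S \<Longrightarrow> berezin S = berezin_op (lift S)"
  by (simp add: berezin_def berezin_op_def cinner_def rep_hfock_lift fun_eq_iff)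

lemma W2inf_iff:
  "S \<in> W2inf \<longleftrightarrow> bounded_fock_op S \<and> (\<exists>T. clinear_op T \<and> (\<forall>z. laplacian (berezin_op (lift S)) z = berezin_op T z))"
proof -
  have "(\<exists>T. bounded_fock_op T \<and> (\<forall>z. laplacian (berezin_op (lift S)) z = berezin T z)) \<longleftrightarrow>
    (\<exists>T. clinear_op T \<and> (\<forall>z. laplacian (berezin_op (lift S)) z = berezin_op T z))"
    using clinear_op_lift berezin_lift bounded_unlift lift_unlift by metis
  then show ?thesis by (auto simp: W2inf_def berezin_lift)
qed

lemma opnorm_le:
  assumes D: "\<And>f. f \<in> fock \<Longrightarrow> D f = rep_hfock (A (abs_hfock f))" and C: "\<And>x. norm (A x) \<le> C * norm x" "0 \<le> C"
  shows "fock_opnorm D \<le> C"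
  unfolding fock_opnorm_def
proof (rule cSup_least)
  have "fock_norm (\<lambda>_. 0) \<le> 1" by (simp add: fock_norm_def)
  then show "{fock_norm (D f) |f. f \<in> fock \<and> fock_norm f \<le> 1} \<noteq> {}" using fock_zero by blast
  fix r assume "r \<in> {fock_norm (D f) |f. f \<in> fock \<and> fock_norm f \<le> 1}"
  then obtain f where f: "f \<in> fock" "fock_norm f \<le> 1" "r = fock_norm (D f)" by blast
  then have "r = norm (A (abs_hfock f))" "norm (abs_hfock f) \<le> 1" by (simp_all add: D norm_hfock abs_hfock_inverse)
  then show "r \<le> C" using C(1)[of "abs_hfock f"] mult_left_mono[of "norm (abs_hfock f)" 1 C] C(2) by simp
qed

text \<open>\<open>fock_opnorm\<close> is a real supremum, informative only for bounded sets;
  boundedness of \<open>A\<close> supplies the upper bound, and scaling \<open>x\<close> to norm 1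
  does the rest.\<close>

lemma le_opnorm:
  assumes D: "\<And>f. f \<in> fock \<Longrightarrow> D f = rep_hfock (A (abs_hfock f))" and A: "bounded_linear A"
  shows "norm (A x) \<le> fock_opnorm D * norm x"
proof (cases "x = 0")
  case True
  then show ?thesis using linear_0[OF bounded_linear.linear[OF A]] by simp
next
  case False
  obtain K where K: "K > 0" "\<And>x. norm (A x) \<le> norm x * K" using bounded_linear.pos_bounded[OF A] by blast
  define y where "y = (1 / norm x) *\<^sub>R x"
  have y: "norm y = 1" using False by (simp add: y_def)
  have "norm (A y) \<le> fock_opnorm D"
    unfolding fock_opnorm_def
  proof (rule cSup_upper)
    show "norm (A y) \<in> {fock_norm (D f) |f. f \<in> fock \<and> fock_norm f \<le> 1}"
      using y by (intro CollectI exI[of _ "rep_hfock y"]) (simp add: D norm_hfock)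
    show "bdd_above {fock_norm (D f) |f. f \<in> fock \<and> fock_norm f \<le> 1}"
    proof (rule bdd_aboveI[of _ K])
      fix r assume "r \<in> {fock_norm (D f) |f. f \<in> fock \<and> fock_norm f \<le> 1}"
      then obtain f where f: "f \<in> fock" "fock_norm f \<le> 1" "r = fock_norm (D f)" by blast
      then have "r = norm (A (abs_hfock f))" "norm (abs_hfock f) \<le> 1" by (simp_all add: D norm_hfock abs_hfock_inverse)
      moreover from this(2) have "norm (abs_hfock f) * K \<le> 1 * K" using K(1) by (intro mult_right_mono) auto
      ultimately show "r \<le> K" using K(2)[of "abs_hfock f"] by linarith
    qed
  qed
  moreover have "norm (A y) = norm (A x) / norm x"
    unfolding y_def linear_scale[OF bounded_linear.linear[OF A]] by simp
  ultimately show ?thesis using False by (simp add: pos_divide_le_eq)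
qed

text \<open>The adjoint is given by \<open>THE\<close>. Existence comes from \<open>weyl z\<close>
  being isometric with inverse \<open>weyl (- z)\<close>, and uniqueness from nondegeneracy of the
  inner product.\<close>

lemma fock_adjoint_weyl:
  assumes f: "f \<in> fock" shows "fock_adjoint (weyl z) f = weyl (- z) f"
  unfolding fock_adjoint_def
proof (rule the_equality)
  have eq: "fock_inner (weyl z g) f = fock_inner g (weyl (- z) f)" if g: "g \<in> fock" for g
    using cinner_weyl_op_adjoint[of z "abs_hfock g" "abs_hfock f"] f g by (simp add: cinner_def rep_hfock_weyl_op abs_hfock_inverse)
  then show "weyl (- z) f \<in> fock \<and> (\<forall>g\<in>fock. fock_inner (weyl z g) f = fock_inner g (weyl (- z) f))"
    by (simp add: weyl_fock f)
  fix h assume h: "h \<in> fock \<and> (\<forall>g\<in>fock. fock_inner (weyl z g) f = fock_inner g h)"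
  then have "cinner x (abs_hfock h) = cinner x (abs_hfock (weyl (- z) f))" for x
    using eq by (simp add: cinner_def abs_hfock_inverse weyl_fock f)
  then have "inner x (abs_hfock h) = inner x (abs_hfock (weyl (- z) f))" for x by (metis Re_cinner)
  then have "inner x (abs_hfock h - abs_hfock (weyl (- z) f)) = 0" for x by (simp add: inner_diff_right)
  then have "abs_hfock h - abs_hfock (weyl (- z) f) = 0" using inner_eq_zero_iff by blast
  then have "abs_hfock h = abs_hfock (weyl (- z) f)" by simp
  then show "h = weyl (- z) f" using h by (simp add: abs_hfock_inject weyl_fock f)
qed

lemma weyl_conj:
  assumes S: "bounded_fock_op S" and f: "f \<in> fock"
  shows "weyl z (S (fock_adjoint (weyl z) f)) = rep_hfock (alpha z (lift S) (abs_hfock f))"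
  by (simp add: alpha_def rep_hfock_weyl_op rep_hfock_lift[OF S] fock_adjoint_weyl[OF f] abs_hfock_inverse[OF f])

text \<open>Continuity at 0 suffices: \<open>alpha z A - alpha z0 A\<close> is
  \<open>alpha z0\<close> applied to \<open>alpha (z - z0) A - A\<close>, and conjugation preserves
  norm bounds.\<close>

lemma Cbu_iff:
  "S \<in> Cbu \<longleftrightarrow> bounded_fock_op S \<and>
     (\<forall>e>0. \<exists>d>0. \<forall>z. norm z < d \<longrightarrow> (\<forall>x. norm (alpha z (lift S) x - lift S x) \<le> e * norm x))"
  (is "_ \<longleftrightarrow> _ \<and> ?R")
proof -
  define Df where "Df = (\<lambda>z z0 f. weyl z (S (fock_adjoint (weyl z) f)) - weyl z0 (S (fock_adjoint (weyl z0) f)))"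
  have rep: "Df z z0 f = rep_hfock ((\<lambda>x. alpha z (lift S) x - alpha z0 (lift S) x) (abs_hfock f))"
    if "bounded_fock_op S" "f \<in> fock" for z z0 f
    using that by (simp add: Df_def weyl_conj fun_eq_iff)
  have bl: "bounded_linear (\<lambda>x. alpha z (lift S) x - alpha z0 (lift S) x)" if "bounded_fock_op S" for z z0
    by (intro clinear_op_bounded_linear clinear_op_diff clinear_op_alpha clinear_op_lift that)
  have fwd: "?R" if S: "bounded_fock_op S" and c: "\<forall>z0. \<forall>e>0. \<exists>d>0. \<forall>z. dist z z0 < d \<longrightarrow> fock_opnorm (Df z z0) < e"
  proof (intro allI impI)
    fix e :: real assume "e > 0"
    then obtain d where d: "d > 0" "\<And>z. dist z 0 < d \<Longrightarrow> fock_opnorm (Df z 0) < e" using c by blast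
    have "norm (alpha z (lift S) x - lift S x) \<le> e * norm x" if "norm z < d" for z x
    proof -
      have "norm (alpha z (lift S) x - alpha 0 (lift S) x) \<le> fock_opnorm (Df z 0) * norm x"
        by (rule le_opnorm[OF rep[OF S] bl[OF S]])
      also have "\<dots> \<le> e * norm x" using d(2)[of z] that by (intro mult_right_mono) auto
      finally show ?thesis by simp
    qed
    with d(1) show "\<exists>d>0. \<forall>z. norm z < d \<longrightarrow> (\<forall>x. norm (alpha z (lift S) x - lift S x) \<le> e * norm x)" by blast
  qed
  have bwd: "\<exists>d>0. \<forall>z. dist z z0 < d \<longrightarrow> fock_opnorm (Df z z0) < e" if S: "bounded_fock_op S" and R: ?R and e: "e > 0" for z0 e
  proof -
    obtain d where d: "d > 0" "\<And>z x. norm z < d \<Longrightarrow> norm (alpha z (lift S) x - lift S x) \<le> (e / 2) * norm x"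
      using R e by (meson half_gt_zero)
    have "fock_opnorm (Df z z0) < e" if z: "dist z z0 < d" for z
    proof -
      have le: "norm (alpha z (lift S) x - alpha z0 (lift S) x) \<le> (e / 2) * norm x" for x
      proof -
        have "alpha z (lift S) x = alpha z0 (alpha (z - z0) (lift S)) x"
          by (simp add: alpha_alpha[OF clinear_op_lift[OF S]])
        then have "alpha z (lift S) x - alpha z0 (lift S) x = alpha z0 (\<lambda>x. alpha (z - z0) (lift S) x - lift S x) x"
          by (simp add: alpha_def[of z0] weyl_op_diff)
        then show ?thesis
          using norm_alpha_le[of "\<lambda>x. alpha (z - z0) (lift S) x - lift S x" "e / 2" z0 x] d(2)[of "z - z0"] z
          by (simp add: dist_norm)
      qed
      have "fock_opnorm (Df z z0) \<le> e / 2"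
      proof (rule opnorm_le)
        show "Df z z0 f = rep_hfock ((\<lambda>x. alpha z (lift S) x - alpha z0 (lift S) x) (abs_hfock f))" if "f \<in> fock" for f
          by (rule rep[OF S that])
        show "norm (alpha z (lift S) x - alpha z0 (lift S) x) \<le> (e / 2) * norm x" for x by (rule le)
      qed (use e in simp)
      then show ?thesis using e by linarith
    qed
    with d(1) show ?thesis by (intro exI[of _ d]) simp
  qed
  have "S \<in> Cbu \<longleftrightarrow> bounded_fock_op S \<and> (\<forall>z0. \<forall>e>0. \<exists>d>0. \<forall>z. dist z z0 < d \<longrightarrow> fock_opnorm (Df z z0) < e)"
    by (simp only: Cbu_def mem_Collect_eq Df_def)
  then show ?thesis using fwd bwd by metis
qed

section \<open>The two inclusions\<close>

lemma W2inf_subset_Cbu: "(W2inf :: 'n::finite op set) \<subseteq> Cbu"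
proof
  fix S :: "'n op" assume "S \<in> W2inf"
  then obtain T where S: "bounded_fock_op S" and T: "clinear_op T" "\<And>z. laplacian (berezin_op (lift S)) z = berezin_op T z"
    unfolding W2inf_iff by blast
  obtain C where C: "C \<ge> 0" "\<And>v x. norm v \<le> 1 \<Longrightarrow> norm (alpha v (lift S) x - lift S x) \<le> C * norm v * norm x"
    using alpha_Lipschitz[OF clinear_op_lift[OF S] T] by blast
  show "S \<in> Cbu" unfolding Cbu_iff
  proof (intro conjI S allI impI)
    fix e :: real assume e: "e > 0"
    have "norm (alpha z (lift S) x - lift S x) \<le> e * norm x" if z: "norm z < min 1 (e / (C + 1))" for z x
    proof -
      have "(C + 1) * norm z \<le> e" using z C(1) by (simp add: pos_less_divide_eq mult.commute less_imp_le)
      moreover have "C * norm z \<le> (C + 1) * norm z" by (intro mult_right_mono) auto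
      ultimately have "C * norm z \<le> e" by linarith
      then have "C * norm z * norm x \<le> e * norm x" by (intro mult_right_mono) auto
      then show ?thesis using C(2)[of z x] z by linarith
    qed
    moreover have "min 1 (e / (C + 1)) > 0" using e C(1) by simp
    ultimately show "\<exists>d>0. \<forall>z. norm z < d \<longrightarrow> (\<forall>x. norm (alpha z (lift S) x - lift S x) \<le> e * norm x)" by blast
  qed
qed

lemma diff_rep:
  assumes "bounded_fock_op S" "bounded_fock_op T" "f \<in> fock"
  shows "S f - T f = rep_hfock ((\<lambda>x. lift S x - lift T x) (abs_hfock f))"
  using assms by (simp add: rep_hfock_lift abs_hfock_inverse fun_eq_iff)

text \<open>The usual argument with three errors of size \<open>e / 3\<close>; conjugation does not
  increase the error of approximating \<open>S\<close> by \<open>T\<close>.\<close>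

lemma Cbu_closed:
  assumes "S \<in> opnorm_closure Cbu" shows "S \<in> Cbu"
  unfolding Cbu_iff
proof (intro conjI allI impI)
  show S: "bounded_fock_op S" using assms by (simp add: opnorm_closure_def)
  fix e :: real assume e: "e > 0"
  then obtain T where T: "T \<in> Cbu" "fock_opnorm (\<lambda>f. S f - T f) < e / 3"
    using assms unfolding opnorm_closure_def by (auto dest: spec[of _ "e / 3"])
  have bT: "bounded_fock_op T" using T(1) by (simp add: Cbu_iff)
  obtain d where d: "d > 0" "\<And>z x. norm z < d \<Longrightarrow> norm (alpha z (lift T) x - lift T x) \<le> (e / 3) * norm x"
    using T(1) e unfolding Cbu_iff by (metis zero_less_divide_iff zero_less_numeral)
  have close: "norm (lift S x - lift T x) \<le> (e / 3) * norm x" for x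
  proof -
    have "norm (lift S x - lift T x) \<le> fock_opnorm (\<lambda>f. S f - T f) * norm x"
      by (rule le_opnorm[OF diff_rep[OF S bT] clinear_op_bounded_linear[OF clinear_op_diff[OF clinear_op_lift[OF S] clinear_op_lift[OF bT]]]])
    also have "\<dots> \<le> (e / 3) * norm x" using T(2) by (intro mult_right_mono) auto
    finally show ?thesis .
  qed
  have "norm (alpha z (lift S) x - lift S x) \<le> e * norm x" if z: "norm z < d" for z x
  proof -
    have 1: "norm (alpha z (lift S) x - alpha z (lift T) x) \<le> (e / 3) * norm x"
      using norm_alpha_le[of "\<lambda>x. lift S x - lift T x" "e / 3" z x] close by (simp add: alpha_def weyl_op_diff)
    have "alpha z (lift S) x - lift S x = (alpha z (lift S) x - alpha z (lift T) x)
        + (alpha z (lift T) x - lift T x) - (lift S x - lift T x)" by simp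
    also have "norm \<dots> \<le> norm (alpha z (lift S) x - alpha z (lift T) x)
        + norm (alpha z (lift T) x - lift T x) + norm (lift S x - lift T x)"
      by (rule order_trans[OF norm_triangle_ineq4 add_right_mono[OF norm_triangle_ineq]])
    also have "\<dots> \<le> (e / 3) * norm x + (e / 3) * norm x + (e / 3) * norm x"
      by (intro add_mono 1 d(2) z close)
    finally show ?thesis by simp
  qed
  with d(1) show "\<exists>d>0. \<forall>z. norm z < d \<longrightarrow> (\<forall>x. norm (alpha z (lift S) x - lift S x) \<le> e * norm x)" by blast
qed

lemma Cbu_approx:
  fixes S :: "'n::finite op"
  assumes "S \<in> Cbu" and e: "e > 0"
  shows "\<exists>T\<in>W2inf. fock_opnorm (\<lambda>f. S f - T f) < e"
proof -
  have S: "bounded_fock_op S" using assms(1) by (simp add: Cbu_iff)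
  note cS = clinear_op_lift[OF S]
  obtain d where d: "d > 0" "\<And>z x. norm z < d \<Longrightarrow> norm (alpha z (lift S) x - lift S x) \<le> (e / 2) * norm x"
    using assms unfolding Cbu_iff by (meson half_gt_zero)
  obtain bs :: "(complex ^ 'n) list" where bs: "set bs = Basis" using finite_list finite_Basis by blast
  \<comment> \<open>The averages displace a point by at most \<open>2 * h * length bs\<close>. The
    extra 1 makes this strictly less than \<open>d\<close> and the denominator positive.\<close>
  define h where "h = d / (2 * length bs + 1)"
  have h: "h > 0" using d(1) by (simp add: h_def add_nonneg_pos)
  have "h * (2 * length bs + 1) = d" by (simp add: h_def)
  then have hd: "2 * h * length bs < d" using h by (simp add: algebra_simps)
  define T where "T = unlift (smear_op (dirs h bs) (lift S))"
  have bT: "bounded_fock_op T" unfolding T_def by (intro bounded_unlift clinear_op_smear_op cS)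
  have lT: "lift T = smear_op (dirs h bs) (lift S)" by (simp add: T_def lift_unlift)
  have "T \<in> W2inf"
    unfolding W2inf_iff lT
    by (intro conjI bT exI[of _ "discrete_laplacian h bs (lift S)"] allI clinear_op_discrete_laplacian cS laplacian_berezin_op_smear_op bs) (use h in auto)
  moreover have "fock_opnorm (\<lambda>f. S f - T f) \<le> e / 2"
  proof (rule opnorm_le[where A="\<lambda>x. lift S x - lift T x", OF diff_rep[OF S bT]])
    fix x
    have "norm (smear_op (dirs h bs) (lift S) x - lift S x) \<le> (e / 2) * norm x"
      unfolding smear_op_def
    proof (rule smear_close[OF continuous_alpha[OF cS]])
      fix y :: "complex ^ 'n" assume "norm (y - 0) \<le> sum_list (map norm (dirs h bs))"
      then have "norm y < d" using hd sum_list_norm_dirs[OF equalityD1[OF bs] h] by simp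
      then show "norm (alpha y (lift S) x - lift S x) \<le> (e / 2) * norm x" by (rule d(2))
    qed
    then show "norm (lift S x - lift T x) \<le> (e / 2) * norm x" by (simp add: lT norm_minus_commute)
  qed (use e in auto)
  ultimately show ?thesis using e by (intro bexI[of _ T]) auto
qed

theorem theorem4p4:
  shows "(Cbu :: 'n::finite op set) = opnorm_closure W2inf"
proof
  show "(Cbu :: 'n op set) \<subseteq> opnorm_closure W2inf"
  proof
    fix S :: "'n op" assume S: "S \<in> Cbu"
    then have "bounded_fock_op S" by (simp add: Cbu_iff)
    with Cbu_approx[OF S] show "S \<in> opnorm_closure W2inf" by (simp add: opnorm_closure_def)
  qed
  have "opnorm_closure W2inf \<subseteq> (opnorm_closure Cbu :: 'n op set)"
    using W2inf_subset_Cbu unfolding opnorm_closure_def by blast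
  then show "opnorm_closure W2inf \<subseteq> (Cbu :: 'n op set)"
    using Cbu_closed by blast
qed

end
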